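(* (a) There exists an infinite sequence of quadruples of binary strings $(a,b,c,d)_n$, indexed by integers $n\to\infty$, such that the lengths of all strings $a,b,c,d$ are $\Theta(n)$, $\mathrm I(a:b)=O(\log n)$, $\mathrm I(a:b|c)=O(\log n)$, and $$\mathrm I(c:d)-\mathrm I(c:d|a)-\mathrm I(c:d|b)=\Omega(n).$$ (b) There exists an infinite sequence of quadruples of binary strings $(a,b,c,d)_n$, indexed by integers $n\to\infty$, such that the lengths of all strings $a,b,c,d$ are $\Theta(n)$, $\mathrm C(c|a,b)=O(\log n)$, $\mathrm I(a:b|c)=O(\log n)$, and $$\mathrm I(c:d)-\mathrm I(c:d|a)-\mathrm I(c:d|b)-\mathrm I(a:b)=\Omega(n).$$ Here the constants hidden in $\Theta(\cdot)$, $O(\cdot)$ and $\Omega(\cdot)$ do not depend on $n$.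
   Context: Kolmogorov complexity: a programming language is a partial computable function $\mathcal L:\{0,1\}^*\times\{0,1\}^*\to\{0,1\}^*$ (program, input $\mapsto$ output), and $\mathrm C_{\mathcal L}(x|y)=\min\{|p|:\mathcal L(p,y)=x\}$. Fix a universal language $\mathcal U$, i.e. one such that for every $\mathcal L$ there is a constant with $\mathrm C_{\mathcal U}(x|y)\le \mathrm C_{\mathcal L}(x|y)+O(1)$ for all $x,y$; write $\mathrm C(x|y)=\mathrm C_{\mathcal U}(x|y)$ and $\mathrm C(x)$ for the complexity of $x$ given the empty string. The complexity of a tuple of strings (or conditional on a tuple) is defined via its code under a fixed computable bijection between finite tuples of binary strings and binary strings. Define $\mathrm I(x:y):=\mathrm C(x)+\mathrm C(y)-\mathrm C(x,y)$ and $\mathrm I(x:y|z):=\mathrm C(x,z)+\mathrm C(y,z)-\mathrm C(x,y,z)-\mathrm C(z)$. *)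

theory Defs
  imports Complex_Main "HOL-Library.Nat_Bijection" "HOL-Library.Extended_Nat"
    "HOL-Library.Landau_Symbols"
begin

definition mu_search :: "(nat \<Rightarrow> nat option) \<Rightarrow> nat option" where
  "mu_search h =
     (if \<exists>k. h k = Some 0 \<and> (\<forall>j<k. \<exists>v. h j = Some (Suc v))
      then Some (LEAST k. h k = Some 0) else None)"

text \<open>
  Kleene's partial recursive functions. In \<open>partial_recursive n f\<close> only the values of \<open>f\<close> on
  argument lists of length \<open>n\<close> are meaningful; \<open>None\<close> means that the computation diverges.
  Composition is strict: \<open>those\<close> yields \<open>None\<close> as soon as one inner value is undefined.
\<close>

inductive partial_recursive :: "nat \<Rightarrow> (nat list \<Rightarrow> nat option) \<Rightarrow> bool" where
  zero: "partial_recursive n (\<lambda>xs. Some 0)"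
| succ: "partial_recursive 1 (\<lambda>xs. Some (Suc (hd xs)))"
| proj: "i < n \<Longrightarrow> partial_recursive n (\<lambda>xs. Some (xs ! i))"
| comp: "partial_recursive (length gs) f \<Longrightarrow> (\<And>g. g \<in> set gs \<Longrightarrow> partial_recursive n g) \<Longrightarrow>
    partial_recursive n (\<lambda>xs. Option.bind (those (map (\<lambda>g. g xs) gs)) f)"
| prim_rec: "partial_recursive n f \<Longrightarrow> partial_recursive (n + 2) g \<Longrightarrow>
    partial_recursive (n + 1)
      (\<lambda>xs. rec_nat (f (tl xs)) (\<lambda>k r. Option.bind r (\<lambda>v. g (k # v # tl xs))) (hd xs))"
| mu: "partial_recursive (n + 1) f \<Longrightarrow> partial_recursive n (\<lambda>xs. mu_search (\<lambda>k. f (k # xs)))"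

type_synonym str = "bool list"

text \<open>Bijective base-2 numeration, least significant digit first.\<close>

fun nat_of_str :: "str \<Rightarrow> nat" where
  "nat_of_str [] = 0"
| "nat_of_str (b # bs) = 2 * nat_of_str bs + (if b then 2 else 1)"

lemma bij_nat_of_str: "bij nat_of_str"
proof (rule bijI)
  have "nat_of_str x = nat_of_str y \<Longrightarrow> x = y" for x y
  proof (induction x arbitrary: y)
    case Nil
    then show ?case by (cases y) (auto split: if_splits)
  next
    case (Cons b bs)
    then obtain c cs where y: "y = c # cs"
      by (cases y) (auto split: if_splits)
    have "2 * nat_of_str bs + (if b then 2 else 1) = 2 * nat_of_str cs + (if c then 2 else 1)"
      using Cons.prems y by simp
    then have "b = c \<and> nat_of_str bs = nat_of_str cs"
      by (cases b; cases c; simp; presburger)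
    then show ?case using Cons.IH y by simp
  qed
  then show "inj nat_of_str" by (auto intro: injI)
  have "\<exists>x. nat_of_str x = n" for n
  proof (induction n rule: less_induct)
    case (less n)
    show ?case
    proof (cases "n = 0")
      case True
      then show ?thesis by (intro exI[of _ "[]"]) simp
    next
      case False
      then have "(n - 1) div 2 < n" by auto
      with less obtain x where x: "nat_of_str x = (n - 1) div 2" by blast
      show ?thesis
        by (rule exI[of _ "even n # x"]) (use x False in \<open>auto; presburger\<close>)
    qed
  qed
  then show "surj nat_of_str" by (metis surjI)
qed

text \<open>\<open>L p y\<close> is the output, if any, of program \<open>p\<close> on input \<open>y\<close>.\<close>

type_synonym lang = "str \<Rightarrow> str \<Rightarrow> str option"

definition programming_language :: "lang \<Rightarrow> bool" where
  "programming_language L \<longleftrightarrow>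
     (\<exists>f. partial_recursive 2 f \<and>
          (\<forall>p y. f [nat_of_str p, nat_of_str y] = map_option nat_of_str (L p y)))"

text \<open>
  A computable bijection between finite tuples of strings and strings; effectivity on tuples is
  taken with respect to the standard numbering \<open>list_encode\<close> of finite sequences. The inverse of
  such a bijection is then computable as well.
\<close>

definition computable_tuple_bijection :: "(str list \<Rightarrow> str) \<Rightarrow> bool" where
  "computable_tuple_bijection code \<longleftrightarrow> bij code \<and>
     (\<exists>f. partial_recursive 1 f \<and>
          (\<forall>xs. f [list_encode (map nat_of_str xs)] = Some (nat_of_str (code xs))))"

text \<open>The infimum is \<open>\<infinity>\<close> if no program maps \<open>y\<close> to \<open>x\<close>.\<close>

definition complexity :: "lang \<Rightarrow> str \<Rightarrow> str \<Rightarrow> enat" where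
  "complexity L x y = (INF p \<in> {p. L p y = Some x}. enat (length p))"

definition universal_language :: "lang \<Rightarrow> bool" where
  "universal_language U \<longleftrightarrow> programming_language U \<and>
     (\<forall>L. programming_language L \<longrightarrow>
        (\<exists>k::nat. \<forall>x y. complexity U x y \<le> complexity L x y + enat k))"

text \<open>
  Real-valued complexity, to be used for universal \<open>U\<close>, where \<open>complexity U x y\<close> is always finite.
\<close>

definition condC :: "lang \<Rightarrow> str \<Rightarrow> str \<Rightarrow> real" where
  "condC U x y = real (the_enat (complexity U x y))"

definition plainC :: "lang \<Rightarrow> str \<Rightarrow> real" where
  "plainC U x = condC U x []"

definition mutual_info :: "lang \<Rightarrow> (str list \<Rightarrow> str) \<Rightarrow> str \<Rightarrow> str \<Rightarrow> real" where
  "mutual_info U code x y = plainC U x + plainC U y - plainC U (code [x, y])"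

definition cond_mutual_info :: "lang \<Rightarrow> (str list \<Rightarrow> str) \<Rightarrow> str \<Rightarrow> str \<Rightarrow> str \<Rightarrow> real" where
  "cond_mutual_info U code x y z =
     plainC U (code [x, z]) + plainC U (code [y, z]) - plainC U (code [x, y, z]) - plainC U z"

text \<open>
  \<open>f(n) = \<Omega>(n)\<close> as a lower bound on the signed value. The library's \<open>\<Omega>\<close> bounds the absolute value
  \<open>\<bar>f n\<bar>\<close> and would also admit linearly decreasing \<open>f\<close>.
\<close>

definition grows_linearly :: "(nat \<Rightarrow> real) \<Rightarrow> bool" where
  "grows_linearly f \<longleftrightarrow> (\<exists>\<epsilon>>0. \<forall>\<^sub>F n in sequentially. f n \<ge> \<epsilon> * real n)"

end

theory Submission
  imports Defs "HOL-Number_Theory.Cong"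
begin

text \<open>
  Let \<open>Q\<close> be a fixed prime (here \<open>127\<close>). A random non-vertical line \<open>c\<close> over the field with \<open>Q\<close>
  elements, two independent random points \<open>a\<close>, \<open>b\<close> of it, and the parabola \<open>d\<close> with leading
  coefficient \<open>-1\<close> through \<open>a\<close> and \<open>b\<close> have \<open>I(a:b|c) = I(c:d|a) = I(c:d|b) = 0\<close>, whereas
  \<open>I(c:d)\<close> is almost one bit, since \<open>c\<close> and \<open>d\<close> determine the pair of points only up to order.
  Both \<open>I(a:b)\<close> and \<open>H(c|a,b)\<close> are caused only by the event \<open>a = b\<close>, of probability \<open>1 / Q\<close>, and
  are small against this bit. So take \<open>n\<close> independent copies, encoded by one incompressible number.

  What remains of \<open>I(a:b)\<close>, or of \<open>H(c|a,b)\<close>, is linear in \<open>n\<close> with a small coefficient. It is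
  removed by hashing. In (a), the ordinates in \<open>a\<close> are replaced by a hash value short enough to be
  independent of \<open>b\<close>; in (b), a hash of \<open>c\<close> that suffices to recover \<open>c\<close> from \<open>a\<close> and \<open>b\<close> is
  appended to \<open>a\<close>. The hash seed is random, and is stored in \<open>a\<close> only.

  All complexities are estimated by counting: a lower bound for a tuple results from recovering the
  incompressible number from the tuple and a short supplement.
\<close>

section \<open>Partial recursive functions\<close>

text \<open>Hashing is not free. Let k be the number of places where a = b. In (a) the hash shortens
  \<open>a\<close> by about k base-\<open>Q\<close> digits, which raises the bound on I(c:d|a) by k
  log Q; in (b) it lengthens \<open>a\<close> by as much, which raises the bounds on both I(c:d|a)
  and I(a:b). The gain per configuration is log Q - log ((Q + 1) / 2), and Q has to be so large that
  the loss, at most 8 log Q / Q, stays below it. For the Mersenne prime 127 there are exactly 2^6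
  unordered distances, the gain log 127 - 6 is at least 0.9, and the loss is below 0.45.

  The number k, and with it the length of a hash value, depends on the configuration. Decoders are
  therefore told n and k, at logarithmic cost. A decoder searches for any number that matches its
  data, and what it finds need not meet the conditions imposed on the true number. The hash must
  thus exclude every competitor of the true value. For this reason the incompressible number is
  taken from a set of good numbers; at least half of all numbers are good, so the restriction costs
  only a constant.\<close>

definition partial :: "nat \<Rightarrow> (nat list \<Rightarrow> nat option) \<Rightarrow> bool" where
  "partial n f \<longleftrightarrow> (\<exists>f'. partial_recursive n f' \<and> (\<forall>xs. length xs = n \<longrightarrow> f' xs = f xs))"

definition recursive :: "nat \<Rightarrow> (nat list \<Rightarrow> nat) \<Rightarrow> bool" where
  "recursive n F \<longleftrightarrow> partial n (\<lambda>xs. Some (F xs))"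

lemma partialI: "partial_recursive n f \<Longrightarrow> partial n f"
  by (auto simp: partial_def)

text \<open>This closure is the purpose of \<open>partial\<close>: the inductive rules yield
  functions of a fixed shape, which match the intended ones only on argument lists of length
  \<open>n\<close>.\<close>

lemma partial_cong: "partial n f \<Longrightarrow> (\<And>xs. length xs = n \<Longrightarrow> f xs = g xs) \<Longrightarrow> partial n g"
  by (auto simp: partial_def)

lemma recursive_cong: "recursive n F \<Longrightarrow> (\<And>xs. length xs = n \<Longrightarrow> F xs = G xs) \<Longrightarrow> recursive n G"
  unfolding recursive_def by (erule partial_cong) simp

lemma partial_comp:
  assumes "partial (length gs) f" "\<And>g. g \<in> set gs \<Longrightarrow> partial n g"
  shows "partial n (\<lambda>xs. Option.bind (those (map (\<lambda>g. g xs) gs)) f)"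
proof -
  obtain f' where f': "partial_recursive (length gs) f'"
    "\<And>xs. length xs = length gs \<Longrightarrow> f' xs = f xs"
    using assms(1) by (auto simp: partial_def)
  obtain h where h: "\<And>g. g \<in> set gs \<Longrightarrow> partial_recursive n (h g)"
    "\<And>g xs. g \<in> set gs \<Longrightarrow> length xs = n \<Longrightarrow> h g xs = g xs"
    using assms(2) unfolding partial_def by metis
  have p: "partial_recursive n
      (\<lambda>xs. Option.bind (those (map (\<lambda>g. g xs) (map h gs))) f')"
    by (rule partial_recursive.comp) (use f' h in auto)
  have len: "those ys = Some zs \<Longrightarrow> length zs = length ys" for ys :: "nat option list" and zs
    by (induction ys arbitrary: zs) (auto split: option.splits)
  have "Option.bind (those (map (\<lambda>g. g xs) (map h gs))) f' =
      Option.bind (those (map (\<lambda>g. g xs) gs)) f" if "length xs = n" for xs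
  proof -
    have "map (\<lambda>g. g xs) (map h gs) = map (\<lambda>g. g xs) gs"
      using h(2) that by auto
    moreover have "Option.bind (those (map (\<lambda>g. g xs) gs)) f' =
        Option.bind (those (map (\<lambda>g. g xs) gs)) f"
      using len[of "map (\<lambda>g. g xs) gs"] f'(2)
      by (cases "those (map (\<lambda>g. g xs) gs)") auto
    ultimately show ?thesis by (simp only:)
  qed
  with p show ?thesis unfolding partial_def by blast
qed

lemma those_map_Some: "those (map (\<lambda>g. Some (g xs)) gs) = Some (map (\<lambda>g. g xs) gs)"
  by (induction gs) auto

lemma partial_comp_rf:
  assumes "partial (length gs) f" "\<And>g. g \<in> set gs \<Longrightarrow> recursive n g"
  shows "partial n (\<lambda>xs. f (map (\<lambda>g. g xs) gs))"
proof -
  have "partial n (\<lambda>xs. Option.bind (those (map (\<lambda>g. g xs) (map (\<lambda>G xs. Some (G xs)) gs))) f)"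
    by (rule partial_comp) (use assms in \<open>auto simp: recursive_def\<close>)
  then show ?thesis by (simp add: comp_def those_map_Some)
qed

lemma recursive_comp:
  assumes "recursive (length gs) F" "\<And>g. g \<in> set gs \<Longrightarrow> recursive n g"
  shows "recursive n (\<lambda>xs. F (map (\<lambda>g. g xs) gs))"
  using partial_comp_rf[OF assms(1)[unfolded recursive_def] assms(2)] by (simp add: recursive_def)

text \<open>The intermediate result goes in front of the original arguments, which are passed on as
  projections. Programs with several stages are chained in this way.\<close>

lemma partial_bind:
  assumes "partial n g" "partial (Suc n) f"
  shows "partial n (\<lambda>xs. Option.bind (g xs) (\<lambda>v. f (v # xs)))"
proof -
  let ?ps = "map (\<lambda>i xs. Some (xs ! i)) [0..<n] :: (nat list \<Rightarrow> nat option) list"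
  have "partial n (\<lambda>xs. Option.bind (those (map (\<lambda>g. g xs) (g # ?ps))) f)"
    by (rule partial_comp) (use assms in \<open>auto intro: partialI[OF partial_recursive.proj]\<close>)
  moreover have "Option.bind (those (map (\<lambda>g. g xs) (g # ?ps))) f =
      Option.bind (g xs) (\<lambda>v. f (v # xs))" if "length xs = n" for xs
  proof -
    have "map (\<lambda>g. g xs) ?ps = map Some (map ((!) xs) [0..<n])" by simp
    moreover have "those (map Some ys) = Some ys" for ys :: "nat list"
      by (induction ys) auto
    moreover have "map ((!) xs) [0..<n] = xs" using that map_nth by blast
    ultimately show ?thesis by (cases "g xs") auto
  qed
  ultimately show ?thesis by (rule partial_cong)
qed

lemma recursive_proj: "i < n \<Longrightarrow> recursive n (\<lambda>xs. xs ! i)"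
  unfolding recursive_def by (intro partialI partial_recursive.proj)

lemma recursive_hd: "recursive (Suc n) hd"
  by (rule recursive_cong[OF recursive_proj[of 0]]) (auto simp: length_Suc_conv)

text \<open>Weakening: under a recursion or a sum the bound variable is the head of the argument
  list, and the outer arguments form its tail.\<close>

lemma recursive_tl: assumes "recursive n F" shows "recursive (Suc n) (\<lambda>xs. F (tl xs))"
proof -
  let ?ps = "map (\<lambda>i xs. xs ! Suc i) [0..<n] :: (nat list \<Rightarrow> nat) list"
  have "recursive (Suc n) (\<lambda>xs. F (map (\<lambda>g. g xs) ?ps))"
    by (rule recursive_comp) (use assms in \<open>auto intro: recursive_proj\<close>)
  then show ?thesis
  proof (rule recursive_cong)
    fix xs :: "nat list" assume "length xs = Suc n"
    then have "map (\<lambda>g. g xs) ?ps = tl xs"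
      by (intro nth_equalityI) (auto simp: nth_tl)
    then show "F (map (\<lambda>g. g xs) ?ps) = F (tl xs)" by simp
  qed
qed

lemma recursive_comp1: "recursive 1 (\<lambda>xs. f (xs ! 0)) \<Longrightarrow> recursive n G \<Longrightarrow> recursive n (\<lambda>xs. f (G xs))"
  using recursive_comp[of "[G]" "\<lambda>xs. f (xs ! 0)" n] by simp

lemma recursive_comp2:
  "recursive 2 (\<lambda>xs. f (xs ! 0) (xs ! 1)) \<Longrightarrow> recursive n G \<Longrightarrow> recursive n H \<Longrightarrow> recursive n (\<lambda>xs. f
      (G xs) (H xs))"
  using recursive_comp[of "[G, H]" "\<lambda>xs. f (xs ! 0) (xs ! 1)" n] by (auto simp: numeral_2_eq_2)

lemma recursive_Suc: "recursive n F \<Longrightarrow> recursive n (\<lambda>xs. Suc (F xs))"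
proof (rule recursive_comp1[of Suc])
  have "recursive 1 (\<lambda>xs. Suc (hd xs))"
    unfolding recursive_def by (intro partialI partial_recursive.succ)
  then show "recursive 1 (\<lambda>xs. Suc (xs ! 0))"
    by (rule recursive_cong) (auto simp: hd_conv_nth length_Suc_conv)
qed

lemma recursive_const: "recursive n (\<lambda>xs. c)"
proof (induction c)
  case 0
  then show ?case unfolding recursive_def by (intro partialI partial_recursive.zero)
qed (rule recursive_Suc)

lemma recursive_rec:
  assumes N: "recursive n N" and B: "recursive n B" and S: "recursive (Suc (Suc n)) (\<lambda>xs. S (hd
      xs) (hd (tl xs)) (tl (tl xs)))"
  shows "recursive n (\<lambda>xs. rec_nat (B xs) (\<lambda>k r. S k r xs) (N xs))"
proof -
  obtain b where b: "partial_recursive n b" "\<And>xs. length xs = n \<Longrightarrow> b xs = Some (B xs)"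
    using B by (auto simp: recursive_def partial_def)
  obtain s where s: "partial_recursive (n + 2) s"
    "\<And>xs. length xs = n + 2 \<Longrightarrow> s xs = Some (S (hd xs) (hd (tl xs)) (tl (tl xs)))"
    using S by (auto simp: recursive_def partial_def)
  let ?R = "\<lambda>xs. rec_nat (b (tl xs)) (\<lambda>k r. Option.bind r (\<lambda>v. s (k # v # tl xs))) (hd xs)"
  have val: "?R (i # xs) = Some (rec_nat (B xs) (\<lambda>k r. S k r xs) i)" if "length xs = n" for i xs
    using that by (induction i) (simp_all add: b s)
  have "partial (Suc n) ?R"
    using partialI[OF partial_recursive.prim_rec[OF b(1) s(1)]] by simp
  then have "partial n (\<lambda>xs. Option.bind (Some (N xs)) (\<lambda>v. ?R (v # xs)))"
    by (rule partial_bind[OF N[unfolded recursive_def]])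
  then show ?thesis unfolding recursive_def by (rule partial_cong) (simp del: list.sel add: val)
qed

lemma recursive_add: assumes "recursive n F" "recursive n G" shows "recursive n (\<lambda>xs. F xs + G xs)"
proof -
  have "recursive n (\<lambda>xs. rec_nat (F xs) (\<lambda>k r. (\<lambda>k r xs. Suc r) k r xs) (G xs))"
    by (rule recursive_rec) (use assms in \<open>auto intro!: recursive_Suc recursive_tl[of _ hd]
        recursive_hd\<close>)
  moreover have "rec_nat a (\<lambda>k r. Suc r) b = a + b" for a b by (induction b) auto
  ultimately show ?thesis by simp
qed

lemma recursive_diff: assumes "recursive n F" "recursive n G" shows "recursive n (\<lambda>xs. F xs - G xs)"
proof -
  have p: "recursive m (\<lambda>xs. H xs - Suc 0)" if "recursive m H" for m H
  proof -
    have "recursive m (\<lambda>xs. rec_nat ((\<lambda>_. 0) xs) (\<lambda>k r. (\<lambda>k r xs. k) k r xs) (H xs))"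
      by (rule recursive_rec) (use that in \<open>auto intro!: recursive_hd recursive_const\<close>)
    moreover have "rec_nat 0 (\<lambda>k r. k) b = b - Suc 0" for b by (induction b) auto
    ultimately show ?thesis by simp
  qed
  have "recursive n (\<lambda>xs. rec_nat (F xs) (\<lambda>k r. (\<lambda>k r xs. r - Suc 0) k r xs) (G xs))"
    by (rule recursive_rec) (use assms in \<open>auto intro!: p recursive_tl[of _ hd] recursive_hd\<close>)
  moreover have "rec_nat a (\<lambda>k r. r - Suc 0) b = a - b" for a b by (induction b) auto
  ultimately show ?thesis by simp
qed

lemma recursive_mult: assumes "recursive n F" "recursive n G" shows "recursive n (\<lambda>xs. F xs * G xs)"
proof -
  have "recursive n (\<lambda>xs. rec_nat ((\<lambda>_. 0) xs) (\<lambda>k r. (\<lambda>k r xs. r + F xs) k r xs) (G xs))"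
    by (rule recursive_rec)
      (use assms in \<open>auto intro!: recursive_add recursive_tl[of _ hd] recursive_hd
          recursive_const recursive_tl[of _ "\<lambda>xs. F (tl xs)"] recursive_tl[of _ F]\<close>)
  moreover have "rec_nat 0 (\<lambda>k r. r + a) b = a * b" for a b :: nat by (induction b) auto
  ultimately show ?thesis by simp
qed

lemma recursive_power: assumes "recursive n F" "recursive n G" shows "recursive n (\<lambda>xs. F xs ^ G
    xs)"
proof -
  have "recursive n (\<lambda>xs. rec_nat ((\<lambda>_. 1) xs) (\<lambda>k r. (\<lambda>k r xs. r * F xs) k r xs) (G xs))"
    by (rule recursive_rec)
      (use assms in \<open>auto intro!: recursive_mult recursive_tl[of _ hd] recursive_hd
          recursive_const recursive_tl[of _ "\<lambda>xs. F (tl xs)"] recursive_tl[of _ F]\<close>)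
  moreover have "rec_nat 1 (\<lambda>k r. r * a) b = a ^ b" for a b :: nat by (induction b) auto
  ultimately show ?thesis by simp
qed

text \<open>Bounded sums stand in for further recursions: division, unpairing, trailing zeros and
  digit vectors are all written as such sums.\<close>

lemma recursive_sum:
  assumes N: "recursive n N" and S: "recursive (Suc n) (\<lambda>xs. f (hd xs) (tl xs))"
  shows "recursive n (\<lambda>xs. \<Sum>i<N xs. f i xs)"
proof -
  \<comment> \<open>In the recursion step the accumulator sits between the index and the outer
    arguments; these projections drop it.\<close>
  let ?ps = "hd # map (\<lambda>i xs. xs ! Suc (Suc i)) [0..<n] :: (nat list \<Rightarrow> nat) list"
  have "recursive (Suc (Suc n)) (\<lambda>xs. (\<lambda>ys. f (hd ys) (tl ys)) (map (\<lambda>g. g xs) ?ps))"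
    by (rule recursive_comp) (use S in \<open>auto intro: recursive_proj recursive_hd\<close>)
  then have f: "recursive (Suc (Suc n)) (\<lambda>xs. f (hd xs) (tl (tl xs)))"
  proof (rule recursive_cong)
    fix xs :: "nat list" assume "length xs = Suc (Suc n)"
    then have "map (\<lambda>g. g xs) ?ps = hd xs # tl (tl xs)"
      by (auto intro!: nth_equalityI simp: nth_tl)
    then show "(\<lambda>ys. f (hd ys) (tl ys)) (map (\<lambda>g. g xs) ?ps) = f (hd xs) (tl (tl xs))" by simp
  qed
  have "recursive n (\<lambda>xs. rec_nat ((\<lambda>_. 0) xs) (\<lambda>k r. (\<lambda>k r xs. r + f k xs) k r xs) (N xs))"
    by (rule recursive_rec) (auto intro!: N recursive_const recursive_add f recursive_tl[of _ hd]
        recursive_hd)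
  moreover have "rec_nat 0 (\<lambda>k r. r + f k xs) m = (\<Sum>i<m. f i xs)" for m xs
    by (induction m) auto
  ultimately show ?thesis by simp
qed

lemma recursive_if_le:
  assumes "recursive n F" "recursive n G" "recursive n A" "recursive n B"
  shows "recursive n (\<lambda>xs. if F xs \<le> G xs then A xs else B xs)"
proof -
  \<comment> \<open>With truncated subtraction, \<open>1 - (F xs - G xs)\<close> is the indicator of
    \<open>F xs \<le> G xs\<close>.\<close>
  have "recursive n (\<lambda>xs. (1 - (F xs - G xs)) * A xs + (1 - (1 - (F xs - G xs))) * B xs)"
    by (intro recursive_add recursive_mult recursive_diff recursive_const assms)
  then show ?thesis by (rule recursive_cong) auto
qed

lemma recursive_if_eq:
  assumes "recursive n F" "recursive n G" "recursive n A" "recursive n B"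
  shows "recursive n (\<lambda>xs. if F xs = G xs then A xs else B xs)"
proof -
  have "recursive n (\<lambda>xs. if F xs \<le> G xs then (if G xs \<le> F xs then A xs else B xs) else B xs)"
    by (intro recursive_if_le assms)
  then show ?thesis by (rule recursive_cong) auto
qed

lemma recursive_div: assumes "recursive n F" "recursive n G" shows "recursive n (\<lambda>xs. F xs div G
    xs)"
proof -
  \<comment> \<open>The quotient counts the positive multiples of \<open>b\<close> up to
    \<open>a\<close>; the guard \<open>1 \<le> b\<close> reproduces the value 0 of division by
    zero.\<close>
  have *: "a div b = (\<Sum>i<a. if Suc i * b \<le> a then (if 1 \<le> b then 1 else 0) else 0)" for a b :: nat
  proof (cases "b = 0")
    case False
    have "(\<Sum>i<a. if Suc i * b \<le> a then 1 else 0) = card {i. i < a \<and> Suc i * b \<le> a}"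
      by (simp flip: sum.inter_filter)
    also have "{i. i < a \<and> Suc i * b \<le> a} = {..<a div b}"
    proof -
      have "Suc i * b \<le> a \<longleftrightarrow> i < a div b" for i
        using False by (simp add: less_eq_div_iff_mult_less_eq flip: Suc_le_eq del: mult_Suc)
      moreover have "a div b \<le> a" by simp
      ultimately show ?thesis by (auto simp del: mult_Suc intro: order.strict_trans2)
    qed
    finally show ?thesis using False by simp
  qed simp
  show ?thesis unfolding *
    by (intro recursive_sum recursive_if_le recursive_mult recursive_Suc recursive_hd
        recursive_const assms recursive_tl[of _ F] recursive_tl[of _ G])
qed

lemma recursive_mod: assumes "recursive n F" "recursive n G" shows "recursive n (\<lambda>xs. F xs mod G
    xs)"
  using recursive_diff[OF assms(1) recursive_mult[OF recursive_div[OF assms] assms(2)]]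
  by (simp add: minus_div_mult_eq_mod)

lemma recursive_prod_encode:
  assumes "recursive n F" "recursive n G" shows "recursive n (\<lambda>xs. prod_encode (F xs, G xs))"
  unfolding prod_encode_def triangle_def split_conv
  by (intro recursive_add recursive_div recursive_mult recursive_Suc recursive_const assms)

text \<open>Both components are at most the code, so unpairing is an exhaustive search, written as a
  sum to which only the matching pair contributes.\<close>

lemma prod_decode_sum:
  "fst (prod_decode m) = (\<Sum>i<Suc m. \<Sum>j<Suc m. if prod_encode (i, j) = m then i else 0)"
  "snd (prod_decode m) = (\<Sum>i<Suc m. \<Sum>j<Suc m. if prod_encode (i, j) = m then j else 0)"
proof -
  obtain a b where ab: "prod_decode m = (a, b)" by fastforce
  then have m: "prod_encode (a, b) = m" by (metis prod_decode_inverse)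
  have le: "a < Suc m" "b < Suc m"
    using m le_prod_encode_1[of a b] le_prod_encode_2[of b a] by auto
  have eq: "prod_encode (i, j) = m \<longleftrightarrow> i = a \<and> j = b" for i j
    using m by (metis Pair_inject prod_encode_eq)
  have *: "(\<Sum>i<Suc m. \<Sum>j<Suc m. if i = a \<and> j = b then h i j else 0) = h a b"
    for h :: "nat \<Rightarrow> nat \<Rightarrow> nat"
  proof -
    have "(\<Sum>i<Suc m. \<Sum>j<Suc m. if i = a \<and> j = b then h i j else 0) =
        (\<Sum>i<Suc m. if i = a then (\<Sum>j<Suc m. if j = b then h a j else 0) else 0)"
      by (intro sum.cong refl) (auto intro!: sum.cong)
    also have "\<dots> = h a b" using le by (simp del: sum.lessThan_Suc)
    finally show ?thesis .
  qed
  show "fst (prod_decode m) = (\<Sum>i<Suc m. \<Sum>j<Suc m. if prod_encode (i, j) = m then i else 0)"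
    and "snd (prod_decode m) = (\<Sum>i<Suc m. \<Sum>j<Suc m. if prod_encode (i, j) = m then j else 0)"
    unfolding eq * by (simp_all add: ab)
qed

lemma recursive_fst_prod_decode: assumes "recursive n F" shows "recursive n (\<lambda>xs. fst
    (prod_decode (F xs)))"
  unfolding prod_decode_sum
  by (intro recursive_sum recursive_if_eq recursive_prod_encode recursive_Suc recursive_hd
      recursive_const assms recursive_tl[of _ hd]
      recursive_tl[of _ F] recursive_tl[of _ "\<lambda>xs. F (tl xs)"])

lemma recursive_snd_prod_decode: assumes "recursive n F" shows "recursive n (\<lambda>xs. snd
    (prod_decode (F xs)))"
  unfolding prod_decode_sum
  by (intro recursive_sum recursive_if_eq recursive_prod_encode recursive_Suc recursive_hd
      recursive_const assms recursive_tl[of _ hd]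
      recursive_tl[of _ F] recursive_tl[of _ "\<lambda>xs. F (tl xs)"])

text \<open>As \<open>H\<close> is total, the search cannot diverge before it reaches a zero. Which
  zero it returns is left open: the decoders below are content with any.\<close>

lemma partial_mu_least:
  assumes "recursive (Suc n) (\<lambda>xs. H (hd xs) (tl xs))"
  obtains f where "partial n f"
    "\<And>xs w. length xs = n \<Longrightarrow> H w xs = 0 \<Longrightarrow> \<exists>v. f xs = Some v \<and> H v xs = 0"
proof -
  obtain h where h: "partial_recursive (n + 1) h"
    "\<And>xs. length xs = Suc n \<Longrightarrow> h xs = Some (H (hd xs) (tl xs))"
    using assms by (auto simp: recursive_def partial_def)
  have "partial n (\<lambda>xs. mu_search (\<lambda>k. h (k # xs)))"
    by (intro partialI partial_recursive.mu h(1))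
  moreover have "\<exists>v. mu_search (\<lambda>k. h (k # xs)) = Some v \<and> H v xs = 0"
    if "length xs = n" "H w xs = 0" for xs w
  proof -
    have eq: "h (k # xs) = Some (H k xs)" for k using h(2) that(1) by simp
    define l where "l = (LEAST k. H k xs = 0)"
    have l: "H l xs = 0" unfolding l_def using that(2) by (rule LeastI)
    have "\<exists>v. H j xs = Suc v" if "j < l" for j
      using not_less_Least[OF that[unfolded l_def]] by (cases "H j xs") auto
    then have "\<exists>k. H k xs = 0 \<and> (\<forall>j<k. \<exists>v. H j xs = Suc v)" using l by blast
    then have "mu_search (\<lambda>k. h (k # xs)) = Some l" by (auto simp: mu_search_def eq l_def)
    with l show ?thesis by blast
  qed
  ultimately show thesis using that by blast
qed

section \<open>Programs that search\<close>

lemma recursive_tl_proj: "i < n \<Longrightarrow> recursive (Suc n) (\<lambda>xs. tl xs ! i)"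
  by (rule recursive_tl[of n "\<lambda>xs. xs ! i"]) (rule recursive_proj)

lemmas recursive_intros = recursive_const recursive_proj recursive_hd recursive_tl_proj
    recursive_Suc recursive_add recursive_diff recursive_mult recursive_power
  recursive_div recursive_mod recursive_if_le recursive_if_eq recursive_prod_encode
      recursive_fst_prod_decode recursive_snd_prod_decode recursive_sum

section \<open>Strings as numbers and a self-delimiting pairing\<close>

definition str_of :: "nat \<Rightarrow> str" where "str_of = inv nat_of_str"

lemma nat_of_str_of [simp]: "nat_of_str (str_of n) = n"
  unfolding str_of_def using bij_nat_of_str by (simp add: bij_def surj_f_inv_f)

lemma str_of_nat_of_str [simp]: "str_of (nat_of_str x) = x"
  unfolding str_of_def using bij_nat_of_str by (simp add: bij_def)

lemma str_of_eq_iff [simp]: "str_of m = str_of n \<longleftrightarrow> m = n"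
  by (metis nat_of_str_of)

lemma str_of_0 [simp]: "str_of 0 = []"
  by (metis nat_of_str.simps(1) str_of_nat_of_str)

text \<open>Bijective numeration lists the strings by length: those of length l have the numbers
  from 2^l - 1 to 2^(l+1) - 2.\<close>

lemma nat_of_str_bounds: "2 ^ length x \<le> Suc (nat_of_str x)" "Suc (nat_of_str x) < 2 ^ Suc
    (length x)"
  by (induction x) auto

lemma length_str_of_le: "real (length (str_of n)) \<le> log 2 (real n + 1)"
proof -
  have "real (2 ^ length (str_of n)) \<le> real (Suc n)"
    using nat_of_str_bounds(1)[of "str_of n"] by (simp only: of_nat_le_iff nat_of_str_of)
  then have "2 powr real (length (str_of n)) \<le> real n + 1"
    by (simp add: powr_realpow)
  then show ?thesis by (simp add: le_log_iff)
qed

text \<open>A self-delimiting code: the number of trailing binary zeros announces how many bits of the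
  odd part hold the first component.\<close>

definition join :: "nat \<Rightarrow> nat \<Rightarrow> nat" where
  "join m r = (let l = Suc (length (str_of m)) in 2 ^ l * Suc (2 * (m + 2 ^ l * r)))"

definition trailing_zeros :: "nat \<Rightarrow> nat" where
  "trailing_zeros p = (\<Sum>i<p. if p mod 2 ^ Suc i = 0 then 1 else 0)"

definition join_fst :: "nat \<Rightarrow> nat" where
  "join_fst p = p div 2 ^ Suc (trailing_zeros p) mod 2 ^ trailing_zeros p"

definition join_snd :: "nat \<Rightarrow> nat" where
  "join_snd p = p div 2 ^ Suc (2 * trailing_zeros p)"

lemma trailing_zeros_eq: "trailing_zeros (2 ^ l * Suc (2 * r)) = l"
proof -
  define p where "p = 2 ^ l * Suc (2 * r)"
  have iff: "p mod 2 ^ Suc i = 0 \<longleftrightarrow> i < l" for i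
  proof
    assume "i < l"
    then have "(2::nat) ^ Suc i dvd 2 ^ l" by (intro le_imp_power_dvd Suc_leI)
    then have "2 ^ Suc i dvd p" unfolding p_def by (rule dvd_mult2)
    then show "p mod 2 ^ Suc i = 0" by (simp only: dvd_eq_mod_eq_0)
  next
    assume "p mod 2 ^ Suc i = 0"
    then have d: "2 ^ Suc i dvd p" by (simp only: dvd_eq_mod_eq_0)
    show "i < l"
    proof (rule ccontr)
      assume "\<not> i < l"
      then have "(2::nat) ^ Suc l dvd 2 ^ Suc i" by (intro le_imp_power_dvd) linarith
      from dvd_trans[OF this d] have "2 ^ l * 2 dvd 2 ^ l * Suc (2 * r)"
        unfolding p_def power_Suc2 .
      then have "2 dvd Suc (2 * r)"
        by (subst (asm) dvd_times_left_cancel_iff) simp_all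
      then show False by simp
    qed
  qed
  \<comment> \<open>The sum in \<open>trailing_zeros\<close> stops at \<open>p\<close>, so
    \<open>l \<le> p\<close> is needed for it to count all \<open>l\<close> exponents.\<close>
  have "l \<le> 2 ^ l" using less_exp[of l] by linarith
  also have "2 ^ l * 1 \<le> p" unfolding p_def by (intro mult_le_mono order_refl) simp
  finally have "l \<le> p" by simp
  have "trailing_zeros p = card {i. i < p \<and> i < l}"
    by (simp add: trailing_zeros_def iff del: power_Suc flip: sum.inter_filter)
  also have "{i. i < p \<and> i < l} = {..<l}" using \<open>l \<le> p\<close> by auto
  finally show ?thesis by (simp add: p_def)
qed

lemma join_fst_join [simp]: "join_fst (join m r) = m"
  and join_snd_join [simp]: "join_snd (join m r) = r"
proof -
  define l where "l = Suc (length (str_of m))"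
  have m: "m < 2 ^ l" unfolding l_def using nat_of_str_bounds(2)[of "str_of m"] by simp
  have j: "join m r = 2 ^ l * Suc (2 * (m + 2 ^ l * r))" by (simp add: join_def l_def)
  have t: "trailing_zeros (join m r) = l" unfolding j by (rule trailing_zeros_eq)
  have "join m r div 2 ^ l div 2 = m + 2 ^ l * r" unfolding j by simp
  then have d: "join m r div 2 ^ Suc l = m + 2 ^ l * r"
    by (simp only: power_Suc2 div_mult2_eq)
  show "join_fst (join m r) = m" unfolding join_fst_def t d using m by simp
  have "(2::nat) ^ Suc (2 * l) = 2 ^ Suc l * 2 ^ l" by (subst power_add[symmetric]) (simp add:
      mult_2)
  then have "join m r div 2 ^ Suc (2 * l) = join m r div 2 ^ Suc l div 2 ^ l"
    by (simp only: div_mult2_eq)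
  also have "\<dots> = r" unfolding d using m by simp
  finally show "join_snd (join m r) = r" unfolding join_snd_def t .
qed

text \<open>The first component pays twice, for its own bits and for the zeros that announce their
  number; the second pays once. The long part of a program is therefore put second.\<close>

lemma log_join: "log 2 (real (join m r) + 1) \<le> 2 * log 2 (real m + 1) + log 2 (real r + 1) + 3"
proof -
  define l where "l = Suc (length (str_of m))"
  have m: "m < 2 ^ l" unfolding l_def using nat_of_str_bounds(2)[of "str_of m"] by simp
  have l2: "2 ^ l \<le> 2 * Suc m"
    unfolding l_def using nat_of_str_bounds(1)[of "str_of m"] by simp
  have j: "join m r = 2 ^ l * Suc (2 * (m + 2 ^ l * r))" by (simp add: join_def l_def)
  have "join m r + 1 \<le> 2 ^ l * Suc (2 * (m + 2 ^ l * r)) + 2 ^ l" unfolding j by simp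
  also have "\<dots> = 2 * 2 ^ l * (Suc m + 2 ^ l * r)" by (simp add: algebra_simps)
  also have "\<dots> \<le> 2 * 2 ^ l * (2 ^ l + 2 ^ l * r)"
    using m by (intro mult_le_mono2 add_le_mono1 Suc_leI)
  also have "\<dots> = 2 * (2 ^ l * 2 ^ l) * Suc r" by (simp add: algebra_simps)
  also have "\<dots> \<le> 2 * ((2 * Suc m) * (2 * Suc m)) * Suc r"
    by (intro mult_le_mono l2 order_refl)
  finally have "real (join m r + 1) \<le> real (2 * ((2 * Suc m) * (2 * Suc m)) * Suc r)"
    by (simp only: of_nat_le_iff)
  then have "real (join m r) + 1 \<le> 8 * (real m + 1) ^ 2 * (real r + 1)"
    by (simp add: power2_eq_square algebra_simps)
  then have "log 2 (real (join m r) + 1) \<le> log 2 (8 * (real m + 1) ^ 2 * (real r + 1))"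
    by (intro log_mono) auto
  also have "\<dots> = log 2 8 + 2 * log 2 (real m + 1) + log 2 (real r + 1)"
    by (simp add: log_mult log_nat_power)
  also have "log 2 8 = 3"
    using log_pow_cancel[of 2 3] by simp
  finally show ?thesis by simp
qed

lemma recursive_trailing_zeros: "recursive n F \<Longrightarrow> recursive n (\<lambda>xs. trailing_zeros (F xs))"
proof (rule recursive_comp1[of trailing_zeros])
  show "recursive 1 (\<lambda>xs. trailing_zeros (xs ! 0))" unfolding trailing_zeros_def by (intro
      recursive_intros) auto
qed

lemma recursive_join_fst: "recursive n F \<Longrightarrow> recursive n (\<lambda>xs. join_fst (F xs))"
  unfolding join_fst_def by (intro recursive_intros recursive_trailing_zeros)

lemma recursive_join_snd: "recursive n F \<Longrightarrow> recursive n (\<lambda>xs. join_snd (F xs))"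
  unfolding join_snd_def by (intro recursive_intros recursive_trailing_zeros)

section \<open>Complexity with respect to a universal language\<close>

context
  fixes U :: lang
  assumes univ: "universal_language U"
begin

text \<open>\<open>K\<close> is the constant that universality provides for the language computed by
  \<open>f\<close>.\<close>

lemma universal_bound:
  assumes "partial 2 f"
  obtains K :: nat where "\<And>p y x. f [nat_of_str p, nat_of_str y] = Some (nat_of_str x) \<Longrightarrow>
    complexity U x y \<le> enat (length p + K)"
proof -
  obtain f' where f': "partial_recursive 2 f'" "\<And>xs. length xs = 2 \<Longrightarrow> f' xs = f xs"
    using assms by (auto simp: partial_def)
  define L where "L p y = map_option str_of (f [nat_of_str p, nat_of_str y])" for p y
  have "map_option nat_of_str (L p y) = f' [nat_of_str p, nat_of_str y]" for p y
    by (simp add: L_def f' option.map_comp comp_def option.map_ident)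
  then have "programming_language L"
    using f'(1) unfolding programming_language_def by metis
  then obtain k :: nat where k: "\<And>x y. complexity U x y \<le> complexity L x y + enat k"
    using univ unfolding universal_language_def by blast
  show thesis
  proof
    fix p y x assume "f [nat_of_str p, nat_of_str y] = Some (nat_of_str x)"
    then have "L p y = Some x" by (simp add: L_def)
    then have "complexity L x y \<le> enat (length p)"
      unfolding complexity_def by (intro INF_lower) simp
    then have "complexity L x y + enat k \<le> enat (length p) + enat k" by (rule add_right_mono)
    then show "complexity U x y \<le> enat (length p + k)" using k[of x y] by simp
  qed
qed

text \<open>Obtained from the language in which every program outputs itself. Finiteness makes
  \<open>the_enat\<close> in \<open>condC\<close> meaningful.\<close>

lemma condC_length_bound:
  obtains K :: nat where "\<And>x y. condC U x y \<le> real (length x) + K"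
    "\<And>x y. complexity U x y \<noteq> \<infinity>"
proof -
  have "partial 2 (\<lambda>xs. Some (xs ! 0))"
    by (intro partialI partial_recursive.proj) simp
  then obtain K where K: "\<And>p y x. [nat_of_str p, nat_of_str y] ! 0 = nat_of_str x \<Longrightarrow>
      complexity U x y \<le> enat (length p + K)"
    by (rule universal_bound) auto
  show thesis
  proof
    fix x y
    have *: "complexity U x y \<le> enat (length x + K)" by (rule K) simp
    then show "complexity U x y \<noteq> \<infinity>" by (cases "complexity U x y") auto
    from * obtain c where "complexity U x y = enat c" "c \<le> length x + K"
      by (cases "complexity U x y") auto
    then show "condC U x y \<le> real (length x) + K" by (simp add: condC_def)
  qed
qed

lemma condC_program: obtains p where "U p y = Some x" "condC U x y = real (length p)"
proof -
  let ?A = "{p. U p y = Some x}"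
  have "complexity U x y \<noteq> \<infinity>" using condC_length_bound by metis
  then have "?A \<noteq> {}" unfolding complexity_def by (metis image_empty Inf_enat_def)
  then have ne: "(\<lambda>p. enat (length p)) ` ?A \<noteq> {}" by blast
  then have "complexity U x y \<in> (\<lambda>p. enat (length p)) ` ?A"
    unfolding complexity_def Inf_enat_def using ne by (auto intro: LeastI)
  then obtain p where "U p y = Some x" "complexity U x y = enat (length p)" by auto
  then show thesis by (intro that[of p]) (auto simp: condC_def)
qed

lemma condC_le: "complexity U x y \<le> enat n \<Longrightarrow> condC U x y \<le> real n"
  unfolding condC_def by (cases "complexity U x y") auto

text \<open>Only 2^l - 1 programs are shorter than l, and distinct strings have distinct shortest
  programs.\<close>

lemma exists_incompressible:
  assumes "2 ^ l \<le> card G" "finite G"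
  obtains w where "w \<in> G" "real l \<le> plainC U (str_of w)"
proof -
  have "\<exists>w\<in>G. real l \<le> plainC U (str_of w)"
  proof (rule ccontr)
    assume "\<not> ?thesis"
    then have *: "plainC U (str_of w) < real l" if "w \<in> G" for w using that by force
    have "\<exists>p. U p [] = Some (str_of w) \<and> plainC U (str_of w) = real (length p)" for w
      using condC_program[of "[]" "str_of w"] unfolding plainC_def by metis
    then obtain p where p: "\<And>w. U (p w) [] = Some (str_of w)"
      "\<And>w. plainC U (str_of w) = real (length (p w))" by metis
    have "inj_on (\<lambda>w. nat_of_str (p w)) G"
    proof (rule inj_onI)
      fix v w assume "nat_of_str (p v) = nat_of_str (p w)"
      then have "p v = p w" by (metis str_of_nat_of_str)
      then have "Some (str_of v) = Some (str_of w)" using p(1) by metis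
      then show "v = w" by simp
    qed
    moreover have "(\<lambda>w. nat_of_str (p w)) ` G \<subseteq> {..<2 ^ l - 1}"
    proof (intro image_subsetI)
      fix w assume "w \<in> G"
      then have "length (p w) < l" using *[of w] unfolding p(2) by simp
      then have "2 ^ Suc (length (p w)) \<le> (2::nat) ^ l" by (intro power_increasing) auto
      then show "nat_of_str (p w) \<in> {..<2 ^ l - 1}" using nat_of_str_bounds(2)[of "p w"] by simp
    qed
    ultimately have "card G \<le> card {..<2 ^ l - 1 :: nat}" by (rule card_inj_on_le) simp
    then have "card G \<le> 2 ^ l - 1" by simp
    moreover have "(0::nat) < 2 ^ l" by simp
    ultimately show False using assms(1) by linarith
  qed
  then show thesis using that by blast
qed

text \<open>The one device behind all complexity bounds: to compute \<open>Out m w\<close> it suffices to find, by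
  unbounded search, any \<open>w'\<close> that agrees with \<open>w\<close> on the available data.\<close>

lemma condC_search:
  fixes T X Y Out :: "nat \<Rightarrow> nat \<Rightarrow> nat" and E :: "nat \<Rightarrow> nat"
  assumes T: "recursive 2 (\<lambda>xs. T (xs ! 0) (xs ! 1))" and X: "recursive 2 (\<lambda>xs. X (xs ! 0) (xs !
      1))"
    and Y: "recursive 2 (\<lambda>xs. Y (xs ! 0) (xs ! 1))" and Out: "recursive 2 (\<lambda>xs. Out (xs ! 0) (xs
        ! 1))"
    and E: "recursive 1 (\<lambda>xs. E (xs ! 0))"
  shows "\<exists>K :: real. \<forall>m w. X m w < E m \<longrightarrow>
    (\<forall>w'. T m w' = T m w \<longrightarrow> X m w' = X m w \<longrightarrow> Y m w' = Y m w \<longrightarrow> Out m w' = Out m w) \<longrightarrow>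
    condC U (str_of (Out m w)) (str_of (Y m w)) \<le>
    condC U (str_of (T m w)) (str_of (Y m w)) + log 2 (E m) + 2 * log 2 (real m + 1) + K"
proof -
  obtain u where u: "partial_recursive 2 u"
    "\<And>p y. u [nat_of_str p, nat_of_str y] = map_option nat_of_str (U p y)"
  proof -
    have "programming_language U"
      using univ unfolding universal_language_def by (rule conjunct1)
    then show thesis
      unfolding programming_language_def by (elim exE conjE) (iprover intro: that)
  qed
  \<comment> \<open>A program is \<open>join m r\<close>, where \<open>r = X + E * q\<close> in
    mixed radix holds the supplement \<open>X\<close> and a shortest program \<open>q\<close> for
    \<open>T\<close>. Remainder and quotient by \<open>E\<close> separate the two.\<close>
  define M where "M xs = join_fst (xs ! 0)" for xs :: "nat list"
  define e where "e xs = join_snd (xs ! 0) mod E (M xs)" for xs :: "nat list"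
  define p where "p xs = join_snd (xs ! 0) div E (M xs)" for xs :: "nat list"
  note defs = M_def e_def p_def
  have E': "recursive n (\<lambda>xs. E (F xs))" if "recursive n F" for n F
    by (rule recursive_comp1[OF E that])
  have ep: "recursive n (\<lambda>xs. e (F xs # G xs))" "recursive n (\<lambda>xs. p (F xs # G xs))" if
      "recursive n F" for n F G
    unfolding defs nth_Cons_0
     apply (rule recursive_mod recursive_div)
      apply (rule recursive_join_snd)
      apply (rule that)
     apply (rule E' recursive_join_fst that)+
     apply (rule recursive_div)
      apply (rule recursive_join_snd)
      apply (rule that)
     apply (rule E' recursive_join_fst that)+
    done
  have "recursive 2 (\<lambda>xs. p (xs ! 0 # tl xs))" by (rule ep) (intro recursive_proj, simp)
  then have p: "recursive 2 p" by (rule recursive_cong) (auto simp: length_Suc_conv numeral_2_eq_2)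
  have "partial 2 (\<lambda>xs. u (map (\<lambda>g. g xs) [p, \<lambda>xs. xs ! 1]))"
    by (rule partial_comp_rf) (use p u(1) in \<open>auto intro: partialI recursive_proj simp:
        numeral_2_eq_2\<close>)
  then have run: "partial 2 (\<lambda>xs. u [p xs, xs ! 1])" by simp
  \<comment> \<open>A pair of opposite truncated differences vanishes exactly when the two numbers
    agree, so the zeros of \<open>H\<close> are the numbers compatible with the given
    \<open>T\<close>, \<open>X\<close> and \<open>Y\<close>.\<close>
  define H where "H w ys = (let m = join_fst (ys ! 1); t = ys ! 0 in
      (T m w - t) + (t - T m w) + ((X m w - e (ys ! 1 # [])) + (e (ys ! 1 # []) - X m w)) +
      ((Y m w - ys ! 2) + (ys ! 2 - Y m w)))" for w ys
  have "recursive (Suc 3) (\<lambda>xs. H (hd xs) (tl xs))"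
    unfolding H_def Let_def
    by (intro recursive_intros recursive_comp2[OF T] recursive_comp2[OF X] recursive_comp2[OF Y]
        recursive_join_fst ep) auto
  then obtain s where s: "partial 3 s"
    "\<And>ys w. length ys = 3 \<Longrightarrow> H w ys = 0 \<Longrightarrow> \<exists>v. s ys = Some v \<and> H v ys = 0"
    by (rule partial_mu_least) blast
  have out: "recursive (Suc 3) (\<lambda>xs. Out (join_fst (tl xs ! 1)) (hd xs))"
    by (intro recursive_intros recursive_join_fst recursive_comp2[OF Out]) auto
  have find: "partial 3 (\<lambda>xs. Option.bind (s xs) (\<lambda>v. Some (Out (join_fst (xs ! 1)) v)))"
    using partial_bind[OF s(1) out[unfolded recursive_def]] by (simp only: list.sel)
  have "partial 2 (\<lambda>xs. Option.bind (u [p xs, xs ! 1])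
      (\<lambda>t. Option.bind (s (t # xs)) (\<lambda>v. Some (Out (join_fst (xs ! 0)) v))))"
    using partial_bind[OF run find[unfolded eval_nat_numeral(3)]]
    by (simp only: One_nat_def nth_Cons_Suc)
  then obtain K :: nat where K: "\<And>q y x. Option.bind (u [p [nat_of_str q, nat_of_str y],
      nat_of_str y])
      (\<lambda>t. Option.bind (s [t, nat_of_str q, nat_of_str y])
        (\<lambda>v. Some (Out (join_fst (nat_of_str q)) v))) = Some (nat_of_str x) \<Longrightarrow>
      complexity U x y \<le> enat (length q + K)"
    by (rule universal_bound) (auto simp: numeral_2_eq_2)
  show ?thesis
  proof (intro exI[of _ "real K + 5"] allI impI)
    fix m w
    assume lt: "X m w < E m" and det: "\<forall>w'. T m w' = T m w \<longrightarrow> X m w' = X m w \<longrightarrow>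
      Y m w' = Y m w \<longrightarrow> Out m w' = Out m w"
    obtain q where q: "U q (str_of (Y m w)) = Some (str_of (T m w))"
      "condC U (str_of (T m w)) (str_of (Y m w)) = real (length q)"
      by (rule condC_program)
    define r where "r = X m w + E m * nat_of_str q"
    define P where "P = join m r"
    have P: "join_fst P = m" "e [P] = X m w" "p [P, y] = nat_of_str q" for y
      using lt by (auto simp: P_def defs r_def)
    have u1: "u [nat_of_str q, Y m w] = Some (T m w)"
      using u(2)[of q "str_of (Y m w)"] q by simp
    \<comment> \<open>The true \<open>w\<close> guarantees that the search halts, possibly at a
      different \<open>v\<close>; determinacy then makes the outputs agree.\<close>
    have "H w [T m w, P, Y m w] = 0" by (simp add: H_def P Let_def)
    then obtain v where v: "s [T m w, P, Y m w] = Some v" "H v [T m w, P, Y m w] = 0"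
      using s(2)[of "[T m w, P, Y m w]" w] by auto
    from v(2) have "T m v = T m w" "X m v = X m w" "Y m v = Y m w"
      by (auto simp: H_def P Let_def)
    then have "Out m v = Out m w" using det by blast
    then have "complexity U (str_of (Out m w)) (str_of (Y m w)) \<le> enat (length (str_of P) + K)"
      by (intro K) (simp add: P u1 v)
    then have "condC U (str_of (Out m w)) (str_of (Y m w)) \<le> real (length (str_of P) + K)"
      by (rule condC_le)
    moreover have "real (length (str_of P)) \<le> log 2 (real P + 1)" by (rule length_str_of_le)
    moreover have "log 2 (real P + 1) \<le> 2 * log 2 (real m + 1) + log 2 (real r + 1) + 3"
      unfolding P_def by (rule log_join)
    moreover have "log 2 (real r + 1) \<le> log 2 (real (E m)) + (real (length q) + 1)"
    proof -
      \<comment> \<open>In mixed radix the supplement adds log E to the length of \<open>q\<close>,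
        up to one bit, and needs no delimiter.\<close>
      have "Suc r \<le> E m * Suc (nat_of_str q)" using lt by (simp add: r_def)
      also have "\<dots> \<le> E m * 2 ^ Suc (length q)"
        using nat_of_str_bounds(2)[of q] by (intro mult_le_mono2) simp
      finally have "real (Suc r) \<le> real (E m * 2 ^ Suc (length q))" by (simp only: of_nat_le_iff)
      then have "real r + 1 \<le> real (E m) * 2 ^ Suc (length q)" by simp
      then have "log 2 (real r + 1) \<le> log 2 (real (E m) * 2 ^ Suc (length q))"
        by (intro log_mono) auto
      also have "\<dots> = log 2 (real (E m)) + (real (length q) + 1)"
        using lt log_pow_cancel[of "2::real" "Suc (length q)"]
        by (subst log_mult) auto
      finally show ?thesis .
    qed
    ultimately show "condC U (str_of (Out m w)) (str_of (Y m w)) \<le>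
        condC U (str_of (T m w)) (str_of (Y m w)) + log 2 (real (E m)) +
        2 * log 2 (real m + 1) + (real K + 5)"
      unfolding q(2) by simp
  qed
qed

end

section \<open>Digit vectors and hashing\<close>

definition dig :: "nat \<Rightarrow> nat \<Rightarrow> nat \<Rightarrow> nat" where
  "dig B x i = x div B ^ i mod B"

text \<open>Entries are reduced modulo the base, so that for prime \<open>B\<close> vectors over the
  field can be written with ordinary arithmetic on naturals.\<close>

definition vec :: "nat \<Rightarrow> nat \<Rightarrow> (nat \<Rightarrow> nat) \<Rightarrow> nat" where
  "vec B n f = (\<Sum>i<n. f i mod B * B ^ i)"

lemma dig_less: "0 < B \<Longrightarrow> dig B x i < B"
  by (simp add: dig_def)

lemma vec_less: assumes "0 < B" shows "vec B n f < B ^ n"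
proof (induction n)
  case (Suc n)
  have "vec B (Suc n) f = vec B n f + f n mod B * B ^ n" by (simp add: vec_def)
  also have "\<dots> < B ^ n + f n mod B * B ^ n" using Suc by simp
  also have "\<dots> = Suc (f n mod B) * B ^ n" by simp
  also have "\<dots> \<le> B * B ^ n" using assms by (intro mult_le_mono1 Suc_leI) simp
  finally show ?case by simp
qed (simp add: vec_def)

lemma dig_add_high:
  assumes "0 < B" "i < n" shows "dig B (x + B ^ n * d) i = dig B x i"
proof -
  obtain j where n: "n = i + Suc j" using assms(2) less_imp_Suc_add by (metis add_Suc_right)
  have "x + B ^ n * d = x + B ^ i * (B * (B ^ j * d))" by (simp add: n power_add)
  show ?thesis using assms(1) unfolding dig_def \<open>x + B ^ n * d = _\<close> by simp
qed

lemma dig_top: assumes "x < B ^ n" "d < B" shows "dig B (x + B ^ n * d) n = d"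
  using assms by (simp add: dig_def)

lemma dig_vec: assumes "0 < B" "i < n" shows "dig B (vec B n f) i = f i mod B"
  using assms(2)
proof (induction n)
  case (Suc n)
  have v: "vec B (Suc n) f = vec B n f + B ^ n * (f n mod B)" by (simp add: vec_def)
  show ?case
  proof (cases "i = n")
    case True
    show ?thesis unfolding v True using assms(1) by (intro dig_top vec_less) auto
  next
    case False
    then have "i < n" using Suc.prems by simp
    then show ?thesis unfolding v using dig_add_high[OF assms(1)] Suc.IH by simp
  qed
qed simp

lemma eq_if_dig_eq:
  assumes "x < B ^ n" "y < B ^ n" "\<And>i. i < n \<Longrightarrow> dig B x i = dig B y i"
  shows "x = y"
proof -
  have "x mod B ^ n = y mod B ^ n"
    using assms(3)
  proof (induction n)
    case (Suc n)
    have "a mod B ^ Suc n = B ^ n * dig B a n + a mod B ^ n" for a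
      unfolding dig_def power_Suc2 by (rule mod_mult2_eq)
    then show ?case using Suc by simp
  qed simp
  then show ?thesis using assms(1,2) by simp
qed

text \<open>Splitting off the top digit pairs each number with a shorter number and a digit, which
  yields the product.\<close>

lemma card_digits:
  assumes B: "0 < B" and A: "\<And>i. i < n \<Longrightarrow> A i \<subseteq> {..<B}"
  shows "card {x. x < B ^ n \<and> (\<forall>i<n. dig B x i \<in> A i)} = (\<Prod>i<n. card (A i))"
  using A
proof (induction n)
  case 0
  have "{x::nat. x < 1} = {0}" by auto
  then show ?case by simp
next
  case (Suc n)
  let ?S = "\<lambda>n. {x. x < B ^ n \<and> (\<forall>i<n. dig B x i \<in> A i)}"
  let ?f = "\<lambda>(x, d). x + B ^ n * d"
  have inj: "inj_on ?f (?S n \<times> A n)"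
  proof (rule inj_onI, clarify)
    fix a b c d
    assume "a < B ^ n" "c < B ^ n" "b \<in> A n" "d \<in> A n" "a + B ^ n * b = c + B ^ n * d"
    then have "(a + B ^ n * b) mod B ^ n = (c + B ^ n * d) mod B ^ n"
      "(a + B ^ n * b) div B ^ n = (c + B ^ n * d) div B ^ n" by simp_all
    then show "a = c \<and> b = d" using \<open>a < B ^ n\<close> \<open>c < B ^ n\<close> B by simp
  qed
  have "?S (Suc n) = ?f ` (?S n \<times> A n)"
  proof (intro equalityI subsetI)
    fix x assume x: "x \<in> ?S (Suc n)"
    have e: "x = x mod B ^ n + B ^ n * (x div B ^ n)" by simp
    have "x div B ^ n < B" using x B by (simp add: less_mult_imp_div_less)
    then have d: "dig B x n = x div B ^ n" by (simp add: dig_def)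
    have "dig B (x mod B ^ n) i = dig B x i" if "i < n" for i
      using dig_add_high[OF B that, of "x mod B ^ n" "x div B ^ n"] e by simp
    then have "(x mod B ^ n, x div B ^ n) \<in> ?S n \<times> A n" using x d B by auto
    then show "x \<in> ?f ` (?S n \<times> A n)" using e by (intro image_eqI) auto
  next
    fix x assume "x \<in> ?f ` (?S n \<times> A n)"
    then obtain a d where x: "x = a + B ^ n * d" "a \<in> ?S n" "d \<in> A n" by auto
    then have "d < B" using Suc.prems[of n] by auto
    have "x < B ^ n + B ^ n * d" using x by simp
    also have "\<dots> = B ^ n * Suc d" by simp
    also have "\<dots> \<le> B ^ n * B" using \<open>d < B\<close> by (intro mult_le_mono2) simp
    finally have "x < B ^ Suc n" by (simp add: mult.commute)
    moreover have "dig B x i \<in> A i" if "i < Suc n" for i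
    proof (cases "i = n")
      case True
      then show ?thesis using x dig_top[of a B n d] \<open>d < B\<close> by simp
    next
      case False
      then show ?thesis using x that dig_add_high[OF B, of i n a d] by simp
    qed
    ultimately show "x \<in> ?S (Suc n)" by blast
  qed
  then have "card (?S (Suc n)) = card (?S n) * card (A n)"
    using inj by (simp add: card_image card_cartesian_product)
  then show ?case using Suc by simp
qed

lemma card_agree:
  assumes "0 < B" "J \<subseteq> {..<n}"
  shows "card {y. y < B ^ n \<and> (\<forall>i\<in>J. dig B y i = c i mod B)} = B ^ (n - card J)"
proof -
  define A where "A i = (if i \<in> J then {c i mod B} else {..<B})" for i
  have "{y. y < B ^ n \<and> (\<forall>i\<in>J. dig B y i = c i mod B)} =
      {y. y < B ^ n \<and> (\<forall>i<n. dig B y i \<in> A i)}"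
    using assms dig_less[OF assms(1)] by (auto simp: A_def)
  then have "card {y. y < B ^ n \<and> (\<forall>i\<in>J. dig B y i = c i mod B)} = (\<Prod>i<n. card (A i))"
    using assms(1) by (simp only:) (rule card_digits, auto simp: A_def)
  also have "\<dots> = (\<Prod>i<n. if i \<in> J then 1 else B)"
    by (intro prod.cong) (auto simp: A_def)
  also have "\<dots> = B ^ card ({..<n} - J)"
    by (simp add: prod.If_cases Diff_eq)
  also have "card ({..<n} - J) = n - card J"
    using assms(2) by (subst card_Diff_subset) (auto intro: finite_subset)
  finally show ?thesis .
qed

text \<open>After division by g = \<open>gcd z P\<close> the coefficient is invertible modulo P / g.
  This fixes s modulo P / g, and only g blocks of that length remain.\<close>

lemma card_linear_congruence:
  fixes P z :: nat
  assumes "0 < P"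
  shows "card {s. s < P \<and> (s * z + D) mod P = v} \<le> gcd z P"
proof -
  define g where "g = gcd z P"
  obtain z' P' where zP: "z = z' * g" "P = P' * g" "coprime z' P'"
    using gcd_coprime_exists[of z P] assms unfolding g_def by auto
  have pos: "0 < P'" "0 < g" using assms zP by auto
  let ?F = "{s. s < P \<and> (s * z + D) mod P = v}"
  have inj: "inj_on (\<lambda>s. s div P') ?F"
  proof (rule inj_onI, clarify)
    fix s t assume st: "s < P" "t < P" "s div P' = t div P'"
      and v: "v = (s * z + D) mod P" "(t * z + D) mod P = (s * z + D) mod P"
    then have "[t * z + D = s * z + D] (mod P)" by (simp add: cong_def)
    then have "[t * z = s * z] (mod P)" by (simp add: cong_add_rcancel_nat)
    then have "(t * z') * g mod (P' * g) = (s * z') * g mod (P' * g)"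
      by (simp add: cong_def zP mult.assoc)
    then have "t * z' mod P' = s * z' mod P'"
      using pos by (simp add: mult_mod_left[symmetric])
    then have "[t * z' = s * z'] (mod P')" by (simp add: cong_def)
    then have "[t = s] (mod P')" using zP(3) by (simp add: cong_mult_rcancel_nat)
    then show "s = t" using st(3) by (metis cong_def div_mult_mod_eq)
  qed
  have "(\<lambda>s. s div P') ` ?F \<subseteq> {..<g}"
    using zP(2) by (auto simp: less_mult_imp_div_less mult.commute)
  then have "card ?F \<le> card {..<g}" using inj by (intro card_inj_on_le) auto
  then show ?thesis by (simp add: g_def)
qed

text \<open>All residues s z + D modulo P are multiples of g = \<open>gcd z P\<close>. The window
  contains 2 D / g of these, and each is attained at most g times.\<close>

lemma card_mod_window:
  fixes P z D :: nat
  assumes P: "0 < P" and D: "gcd z P dvd D"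
  shows "card {s. s < P \<and> (s * z + D) mod P < 2 * D} \<le> 2 * D"
proof -
  define g where "g = gcd z P"
  have g: "0 < g" using P by (simp add: g_def)
  obtain c where c: "D = g * c" using D by (auto simp: g_def)
  let ?V = "(\<lambda>t. g * t) ` {..<2 * c}"
  have "{s. s < P \<and> (s * z + D) mod P < 2 * D} \<subseteq> (\<Union>v\<in>?V. {s. s < P \<and> (s * z + D) mod P = v})"
  proof clarify
    fix s assume s: "s < P" "(s * z + D) mod P < 2 * D"
    have "g dvd (s * z + D) mod P"
      using D by (intro dvd_mod dvd_add dvd_mult) (auto simp: g_def)
    then obtain t where t: "(s * z + D) mod P = g * t" by blast
    then have "t < 2 * c" using s(2) g by (simp add: c)
    then show "s \<in> (\<Union>v\<in>?V. {s. s < P \<and> (s * z + D) mod P = v})" using t s by auto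
  qed
  then have "card {s. s < P \<and> (s * z + D) mod P < 2 * D} \<le>
      card (\<Union>v\<in>?V. {s. s < P \<and> (s * z + D) mod P = v})"
    by (intro card_mono) auto
  also have "\<dots> \<le> (\<Sum>v\<in>?V. card {s. s < P \<and> (s * z + D) mod P = v})"
    by (rule card_UN_le) simp
  also have "\<dots> \<le> (\<Sum>v\<in>?V. g)"
    unfolding g_def by (intro sum_mono card_linear_congruence P)
  also have "\<dots> \<le> 2 * c * g"
    using card_image_le[of "{..<2 * c}" "\<lambda>t. g * t"] by simp
  finally show ?thesis by (simp add: c ac_simps)
qed

section \<open>A linear hash modulo a prime power\<close>

definition Q :: nat where "Q = 127"

lemma Q_pos [simp]: "0 < Q" "2 \<le> Q" "Suc 0 \<le> Q" "Q \<noteq> 0" by (simp_all add: Q_def)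

lemma prime_Q: "prime Q"
proof -
  have "prime (127::nat)" by simp
  then show ?thesis by (simp add: Q_def)
qed

text \<open>A hash of \<open>y < Q ^ n\<close> with seed \<open>s < Q ^ (2 * n + 1)\<close> into \<open>n + 1 - j\<close> base-\<open>Q\<close> digits:
  the leading digits of a random multiple of \<open>y\<close>.\<close>

definition hash :: "nat \<Rightarrow> nat \<Rightarrow> nat \<Rightarrow> nat \<Rightarrow> nat" where
  "hash n j s y = s * y mod Q ^ (2 * n + 1) div Q ^ (n + j)"

lemma hash_less: assumes "j \<le> n" shows "hash n j s y < Q ^ (n + 1 - j)"
proof -
  have e: "Q ^ (2 * n + 1) = Q ^ (n + 1 - j) * Q ^ (n + j)"
    using assms by (simp flip: power_add add: mult_2)
  show ?thesis unfolding hash_def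
    by (rule less_mult_imp_div_less) (simp only: e[symmetric] mod_less_divisor zero_less_power
        Q_pos)
qed

text \<open>If the leading digits agree, then s y and s y' differ modulo P by less than D = Q^(n+j),
  so s (y - y') + D falls into the window of length 2 D. The modulus is not prime, but the gcd of y
  - y' with it is a power of \<open>Q\<close> below Q^n and hence divides D.\<close>

lemma card_hash_collision:
  assumes "y' \<noteq> y" "y < Q ^ n" "y' < Q ^ n" "j \<le> n"
  shows "card {s. s < Q ^ (2 * n + 1) \<and> hash n j s y' = hash n j s y} \<le> 2 * Q ^ (n + j)"
proof -
  have main: "card {s. s < Q ^ (2 * n + 1) \<and> hash n j s y' = hash n j s y} \<le> 2 * Q ^ (n + j)"
    if yy: "y' < y" "y < Q ^ n" for y y'
  proof -
    define z where "z = y - y'"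
    define P where "P = Q ^ (2 * n + 1)"
    define D where "D = Q ^ (n + j)"
    have P: "0 < P" and D0: "0 < D" by (simp_all add: P_def D_def)
    \<comment> \<open>Here \<open>2 \<le> Q\<close> and \<open>j \<le> n\<close> enter. The window
      ends at or below the modulus, so the residue found in it at the end is already
      reduced.\<close>
    have "2 * D \<le> Q * Q ^ (2 * n)"
      unfolding D_def using assms(4) by (intro mult_le_mono power_increasing) auto
    then have DP: "2 * D \<le> P" by (simp add: P_def)
    have "gcd z P dvd Q ^ (2 * n + 1)" by (simp add: P_def)
    then obtain i where i: "gcd z P = Q ^ i"
      using divides_primepow_nat[OF prime_Q] by blast
    have "gcd z P \<le> z" using yy by (intro gcd_le1_nat) (simp add: z_def)
    then have "Q ^ i \<le> z" by (simp only: i)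
    also have "z < Q ^ n" using yy by (simp add: z_def)
    finally have "Q ^ i < Q ^ n" .
    then have "i < n" by (rule power_less_imp_less_exp[rotated]) (simp add: Q_def)
    then have "gcd z P dvd D" unfolding i D_def by (intro le_imp_power_dvd) simp
    then have "card {s. s < P \<and> (s * z + D) mod P < 2 * D} \<le> 2 * D"
      by (rule card_mod_window[OF P])
    moreover have "{s. s < P \<and> hash n j s y' = hash n j s y} \<subseteq>
        {s. s < P \<and> (s * z + D) mod P < 2 * D}"
    proof clarify
      fix s assume "hash n j s y' = hash n j s y"
      then have h: "s * y' mod P div D = s * y mod P div D" by (simp add: hash_def P_def D_def)
      define u where "u = s * y mod P"
      define u' where "u' = s * y' mod P"
      have e: "u' div D = u div D" using h by (simp add: u_def u'_def)
      have "D * (u div D) + u mod D = u" "D * (u div D) + u' mod D = u'"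
        by (simp, simp flip: e)
      moreover have "u mod D < D" "u' mod D < D" using D0 by simp_all
      ultimately have uu: "u' < u + D" "u < u' + D" by linarith+
      have "[s * z + D + u' = s * z + D + s * y'] (mod P)"
        by (simp add: cong_def u'_def mod_add_right_eq)
      also have "s * z + D + s * y' = s * y + D"
      proof -
        have "y = y' + z" using yy by (simp add: z_def)
        then show ?thesis by (simp add: algebra_simps)
      qed
      also have "[s * y + D = u + D] (mod P)" by (simp add: cong_def u_def mod_add_left_eq)
      also have "u + D = (u + D - u') + u'" using uu by simp
      finally have "[s * z + D = u + D - u'] (mod P)" by (simp only: cong_add_rcancel_nat)
      moreover have "u + D - u' < 2 * D" using uu by linarith
      ultimately show "(s * z + D) mod P < 2 * D" using DP by (simp add: cong_def)
    qed
    then have "card {s. s < P \<and> hash n j s y' = hash n j s y} \<le>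
        card {s. s < P \<and> (s * z + D) mod P < 2 * D}"
      by (intro card_mono) auto
    ultimately show ?thesis by (simp add: P_def D_def)
  qed
  show ?thesis
  proof (cases "y' < y")
    case True
    then show ?thesis using main assms by blast
  next
    case False
    then have "y < y'" using assms(1) by simp
    then show ?thesis using main[of y y'] assms by (simp add: eq_commute)
  qed
qed

text \<open>With one digit more than the number of unknown digits, the hash pins down \<open>y\<close> for all but a
  fraction \<open>2 / Q\<close> of the seeds.\<close>

definition pinned :: "nat \<Rightarrow> nat set \<Rightarrow> nat \<Rightarrow> nat \<Rightarrow> bool" where
  "pinned n J s y \<longleftrightarrow> (\<forall>y'<Q ^ n. (\<forall>i\<in>J. dig Q y' i = dig Q y i) \<longrightarrow>
     hash n (card J) s y' = hash n (card J) s y \<longrightarrow> y' = y)"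

text \<open>Union bound: Q^(n - card J) candidates with at most 2 Q^(n + card J) colliding seeds
  each; the dependence on J cancels.\<close>

lemma card_not_pinned:
  assumes "y < Q ^ n" "J \<subseteq> {..<n}"
  shows "card {s. s < Q ^ (2 * n + 1) \<and> \<not> pinned n J s y} \<le> 2 * Q ^ (2 * n)"
proof -
  let ?Y = "{y'. y' < Q ^ n \<and> (\<forall>i\<in>J. dig Q y' i = dig Q y i mod Q)}"
  let ?C = "\<lambda>y'. {s. s < Q ^ (2 * n + 1) \<and> hash n (card J) s y' = hash n (card J) s y}"
  have J: "card J \<le> n" using card_mono[OF _ assms(2)] by simp
  have "dig Q y i mod Q = dig Q y i" for i by (simp add: dig_less)
  then have "{s. s < Q ^ (2 * n + 1) \<and> \<not> pinned n J s y} \<subseteq> (\<Union>y'\<in>?Y - {y}. ?C y')"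
    by (auto simp: pinned_def)
  then have "card {s. s < Q ^ (2 * n + 1) \<and> \<not> pinned n J s y} \<le> card (\<Union>y'\<in>?Y - {y}. ?C y')"
    by (intro card_mono) auto
  also have "\<dots> \<le> (\<Sum>y'\<in>?Y - {y}. card (?C y'))" by (rule card_UN_le) simp
  also have "\<dots> \<le> (\<Sum>y'\<in>?Y - {y}. 2 * Q ^ (n + card J))"
    using assms(1) J by (intro sum_mono card_hash_collision) auto
  also have "\<dots> \<le> card ?Y * (2 * Q ^ (n + card J))"
    by (simp add: card_mono)
  also have "card ?Y = Q ^ (n - card J)" by (rule card_agree) (use assms in auto)
  also have "Q ^ (n - card J) * (2 * Q ^ (n + card J)) = 2 * Q ^ (n - card J + (n + card J))"
    by (simp add: power_add)
  also have "n - card J + (n + card J) = 2 * n" using J by simp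
  finally show ?thesis .
qed

text \<open>The places where the points a and b coincide, since both lie on the same line.\<close>

definition coinc :: "nat \<Rightarrow> nat \<Rightarrow> nat \<Rightarrow> nat set" where
  "coinc n x z = {i. i < n \<and> dig Q x i = dig Q z i}"

lemma coinc_subset: "coinc n x z \<subseteq> {..<n}" by (auto simp: coinc_def)

lemma finite_coinc [simp]: "finite (coinc n x z)"
  by (rule finite_subset[OF coinc_subset]) simp

lemma card_coinc_le: "card (coinc n x z) \<le> n"
  using card_mono[OF _ coinc_subset[of n x z]] by simp

text \<open>Markov's inequality: n / Q coincidences are expected, so more than four times as many
  occur for at most a quarter of the \<open>z\<close>.\<close>

lemma card_many_coincidences:
  assumes "0 < n"
  shows "4 * card {z. z < Q ^ n \<and> 4 * n < Q * card (coinc n x z)} \<le> Q ^ n"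
proof -
  let ?Z = "{..<Q ^ n}"
  let ?B = "{z. z < Q ^ n \<and> 4 * n < Q * card (coinc n x z)}"
  have "card ?B * (4 * n) = (\<Sum>z\<in>?B. 4 * n)" by simp
  also have "\<dots> \<le> (\<Sum>z\<in>?B. Q * card (coinc n x z))" by (intro sum_mono) auto
  also have "\<dots> \<le> (\<Sum>z\<in>?Z. Q * card (coinc n x z))" by (intro sum_mono2) auto
  also have "\<dots> = Q * (\<Sum>z\<in>?Z. \<Sum>i<n. if dig Q x i = dig Q z i then 1 else 0)"
    by (simp add: sum_distrib_left coinc_def lessThan_def flip: sum.inter_filter)
  also have "\<dots> = Q * (\<Sum>i<n. \<Sum>z\<in>?Z. if dig Q x i = dig Q z i then 1 else 0)"
    by (subst sum.swap) simp
  also have "(\<Sum>i<n. \<Sum>z\<in>?Z. if dig Q x i = dig Q z i then 1 else 0) = (\<Sum>i<n. Q ^ (n - 1))"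
  proof (intro sum.cong refl)
    fix i assume "i \<in> {..<n}"
    then have "card {z. z < Q ^ n \<and> (\<forall>i\<in>{i}. dig Q z i = dig Q x i mod Q)} = Q ^ (n - card {i})"
      by (intro card_agree) auto
    then show "(\<Sum>z\<in>?Z. if dig Q x i = dig Q z i then 1 else 0) = Q ^ (n - 1)"
      by (simp add: dig_less eq_commute flip: sum.inter_filter)
  qed
  also have "Q * (\<Sum>i<n. Q ^ (n - 1)) = n * Q ^ n"
    using assms by (cases n) (simp_all add: algebra_simps)
  finally show ?thesis using assms by (simp add: mult.commute mult.left_commute)
qed

section \<open>Lines and parabolas\<close>

text \<open>A number \<open>w < Q ^ (6 * n + 1)\<close> encodes \<open>n\<close> independent configurations over the field with
  \<open>Q\<close> elements, and a hash seed: the line \<open>c0 + g t\<close> with \<open>c0 = e + x z\<close> meets the parabola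
  \<open>e + (g + x + z) t - t ^ 2\<close> exactly at \<open>t = x\<close> and \<open>t = z\<close>,
  the abscissas of \<open>a\<close> and \<open>b\<close>.\<close>

definition fE :: "nat \<Rightarrow> nat \<Rightarrow> nat" where "fE n w = w mod Q ^ n"
definition fG :: "nat \<Rightarrow> nat \<Rightarrow> nat" where "fG n w = w div Q ^ n mod Q ^ n"
definition fX :: "nat \<Rightarrow> nat \<Rightarrow> nat" where "fX n w = w div Q ^ (2 * n) mod Q ^ n"
definition fZ :: "nat \<Rightarrow> nat \<Rightarrow> nat" where "fZ n w = w div Q ^ (3 * n) mod Q ^ n"
definition fS :: "nat \<Rightarrow> nat \<Rightarrow> nat" where "fS n w = w div Q ^ (4 * n) mod Q ^ (2 * n + 1)"

definition mk :: "nat \<Rightarrow> nat \<Rightarrow> nat \<Rightarrow> nat \<Rightarrow> nat \<Rightarrow> nat \<Rightarrow> nat" where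
  "mk n e g x z s = e + Q ^ n * (g + Q ^ n * (x + Q ^ n * (z + Q ^ n * s)))"

text \<open>The point over \<open>x\<close>; swapping \<open>x\<close> and \<open>z\<close> gives the point over \<open>z\<close>.\<close>

definition ordinate :: "nat \<Rightarrow> nat \<Rightarrow> nat \<Rightarrow> nat \<Rightarrow> nat \<Rightarrow> nat" where
  "ordinate n e g x z = vec Q n (\<lambda>i. dig Q e i + dig Q x i * (dig Q g i + dig Q z i))"

text \<open>The two sets of known digits are complementary. Where the abscissas coincide so do the
  ordinates, and b reveals those digits of the ordinate of a; elsewhere two distinct points reveal
  the digits of the slope \<open>g\<close>. In either case a hash makes up for the rest.\<close>

definition good_tuple :: "nat \<Rightarrow> nat \<Rightarrow> nat \<Rightarrow> nat \<Rightarrow> nat \<Rightarrow> nat \<Rightarrow> bool" where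
  "good_tuple n e g x z s \<longleftrightarrow> Q * card (coinc n x z) \<le> 4 * n \<and>
     pinned n (coinc n x z) s (ordinate n e g x z) \<and> pinned n ({..<n} - coinc n x z) s g"

definition good :: "nat \<Rightarrow> nat \<Rightarrow> bool" where
  "good n w \<longleftrightarrow> w < Q ^ (6 * n + 1) \<and> good_tuple n (fE n w) (fG n w) (fX n w) (fZ n w) (fS n w)"

lemma add_mult_less:
  fixes a b M N :: nat
  assumes "a < M" "b < N" shows "a + M * b < M * N"
proof -
  have "a + M * b < M * Suc b" using assms(1) by simp
  also have "\<dots> \<le> M * N" using assms(2) by (intro mult_le_mono2) simp
  finally show ?thesis .
qed

lemma mk_less:
  assumes "e < Q ^ n" "g < Q ^ n" "x < Q ^ n" "z < Q ^ n" "s < Q ^ (2 * n + 1)"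
  shows "mk n e g x z s < Q ^ (6 * n + 1)"
proof -
  have "mk n e g x z s < Q ^ n * (Q ^ n * (Q ^ n * (Q ^ n * Q ^ (2 * n + 1))))"
    unfolding mk_def by (intro add_mult_less assms)
  also have "\<dots> = Q ^ (n + (n + (n + (n + (2 * n + 1)))))" by (simp only: power_add)
  also have "n + (n + (n + (n + (2 * n + 1)))) = 6 * n + 1" by simp
  finally show ?thesis .
qed

lemma fields_mk:
  assumes "e < Q ^ n" "g < Q ^ n" "x < Q ^ n" "z < Q ^ n" "s < Q ^ (2 * n + 1)"
  shows "fE n (mk n e g x z s) = e" "fG n (mk n e g x z s) = g" "fX n (mk n e g x z s) = x"
    "fZ n (mk n e g x z s) = z" "fS n (mk n e g x z s) = s"
proof -
  have p: "Q ^ (2 * n) = Q ^ n * Q ^ n" "Q ^ (3 * n) = Q ^ n * Q ^ n * Q ^ n"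
    "Q ^ (4 * n) = Q ^ n * Q ^ n * Q ^ n * Q ^ n"
    by (simp_all add: numeral_eq_Suc power_add)
  have d: "(a + Q ^ n * b) div Q ^ n = b" "(a + Q ^ n * b) mod Q ^ n = a" if "a < Q ^ n" for a b
    using that by simp_all
  note defs = fE_def fG_def fX_def fZ_def fS_def mk_def p div_mult2_eq
  show "fE n (mk n e g x z s) = e" "fG n (mk n e g x z s) = g" "fX n (mk n e g x z s) = x"
    "fZ n (mk n e g x z s) = z" "fS n (mk n e g x z s) = s"
    unfolding defs by (simp_all only: d assms mod_less)
qed

lemma mk_fields:
  assumes "w < Q ^ (6 * n + 1)"
  shows "mk n (fE n w) (fG n w) (fX n w) (fZ n w) (fS n w) = w"
proof -
  have p: "Q ^ (2 * n) = Q ^ n * Q ^ n" "Q ^ (3 * n) = Q ^ n * Q ^ n * Q ^ n"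
    "Q ^ (4 * n) = Q ^ n * Q ^ n * Q ^ n * Q ^ n"
    by (simp_all add: numeral_eq_Suc power_add)
  have e: "a mod Q ^ n + Q ^ n * (a div Q ^ n) = a" for a by simp
  have "Q ^ (4 * n) * Q ^ (2 * n + 1) = Q ^ (6 * n + 1)" by (simp flip: power_add)
  then have "w div Q ^ (4 * n) < Q ^ (2 * n + 1)"
    using assms by (intro less_mult_imp_div_less) (simp only: mult.commute)
  then have "fS n w = w div Q ^ (4 * n)" by (simp add: fS_def)
  then show ?thesis unfolding mk_def fE_def fG_def fX_def fZ_def p div_mult2_eq by (simp only: e)
qed

lemma fields_less:
  "fE n w < Q ^ n" "fG n w < Q ^ n" "fX n w < Q ^ n" "fZ n w < Q ^ n" "fS n w < Q ^ (2 * n + 1)"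
  unfolding fE_def fG_def fX_def fZ_def fS_def by (intro mod_less_divisor zero_less_power Q_pos)+

lemma ordinate_less: "ordinate n e g x z < Q ^ n"
  by (simp add: ordinate_def vec_less)

text \<open>The bad fraction is at most 1/4 for too many coincidences plus 2 / Q for each of the two
  hash conditions.\<close>

lemma card_good:
  assumes "0 < n"
  shows "Q ^ (6 * n + 1) \<le> 2 * card {w. good n w}"
proof -
  define V where "V = {..<Q ^ n}"
  define S where "S = {..<Q ^ (2 * n + 1)}"
  define A where "A = (V \<times> V) \<times> (V \<times> V)"
  define f where "f = (\<lambda>(((e, g), (x, z)), s). mk n e g x z s)"
  define B1 where "B1 = ((V \<times> V) \<times> (SIGMA x:V. {z. z < Q ^ n \<and> 4 * n < Q * card (coinc n x z)}))
      \<times> S"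
  define B2 where "B2 = (SIGMA a:A. case a of ((e, g), (x, z)) \<Rightarrow>
    {s. s < Q ^ (2 * n + 1) \<and> \<not> pinned n (coinc n x z) s (ordinate n e g x z)})"
  define B3 where "B3 = (SIGMA a:A. case a of ((e, g), (x, z)) \<Rightarrow>
    {s. s < Q ^ (2 * n + 1) \<and> \<not> pinned n ({..<n} - coinc n x z) s g})"
  define N where "N = Q ^ (2 * n)"
  have fin: "finite V" "finite S" "finite A" by (simp_all add: V_def S_def A_def)
  have cV: "card V = Q ^ n" and cS: "card S = Q * N" by (simp_all add: V_def S_def N_def)
  have N: "Q ^ n * Q ^ n = N" by (simp add: N_def mult_2 power_add)
  have cA: "card A = N * N" by (simp add: A_def card_cartesian_product cV N)
  have c1: "4 * card B1 \<le> N * N * (Q * N)"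
  proof -
    have "4 * card (SIGMA x:V. {z. z < Q ^ n \<and> 4 * n < Q * card (coinc n x z)}) =
        (\<Sum>x\<in>V. 4 * card {z. z < Q ^ n \<and> 4 * n < Q * card (coinc n x z)})"
      using fin by (subst card_SigmaI) (auto simp: sum_distrib_left)
    also have "\<dots> \<le> (\<Sum>x\<in>V. Q ^ n)" by (intro sum_mono card_many_coincidences assms)
    also have "\<dots> = N" by (simp add: cV N)
    finally have "N * (4 * card (SIGMA x:V. {z. z < Q ^ n \<and> 4 * n < Q * card (coinc n x z)})) *
        (Q * N) \<le> N * N * (Q * N)" by (intro mult_le_mono) auto
    then show ?thesis
      by (simp only: B1_def card_cartesian_product cV cS N ac_simps)
  qed
  \<comment> \<open>The seed ranges independently of the other fields, so both hash conditions are
    counted seed by seed over each fixed choice of those.\<close>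
  have pin: "card (SIGMA a:A. case a of ((e, g), (x, z)) \<Rightarrow>
      {s. s < Q ^ (2 * n + 1) \<and> \<not> pinned n (J x z) s (h e g x z)}) \<le> 2 * (N * N * N)"
    if "\<And>x z. J x z \<subseteq> {..<n}" "\<And>e g x z. e \<in> V \<Longrightarrow> g \<in> V \<Longrightarrow> h e g x z < Q ^ n" for J h
  proof -
    have "card (SIGMA a:A. case a of ((e, g), (x, z)) \<Rightarrow>
        {s. s < Q ^ (2 * n + 1) \<and> \<not> pinned n (J x z) s (h e g x z)}) =
        (\<Sum>a\<in>A. card (case a of ((e, g), (x, z)) \<Rightarrow>
        {s. s < Q ^ (2 * n + 1) \<and> \<not> pinned n (J x z) s (h e g x z)}))"
      using fin by (intro card_SigmaI) auto
    also have "\<dots> \<le> (\<Sum>a\<in>A. 2 * N)"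
    proof (intro sum_mono)
      fix a assume "a \<in> A"
      then obtain e g x z where a: "a = ((e, g), (x, z))" "e \<in> V" "g \<in> V" by (auto simp: A_def)
      show "card (case a of ((e, g), (x, z)) \<Rightarrow>
        {s. s < Q ^ (2 * n + 1) \<and> \<not> pinned n (J x z) s (h e g x z)}) \<le> 2 * N"
        unfolding a(1) prod.case N_def using that a(2,3) by (intro card_not_pinned) auto
    qed
    also have "\<dots> = 2 * (N * N * N)" by (simp add: cA)
    finally show ?thesis .
  qed
  have c2: "card B2 \<le> 2 * (N * N * N)" unfolding B2_def
    by (intro pin coinc_subset ordinate_less)
  have c3: "card B3 \<le> 2 * (N * N * N)" unfolding B3_def
    by (rule pin) (auto simp: V_def)
  have inj: "inj_on f (A \<times> S)"
  proof (rule inj_onI)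
    fix t t' assume "t \<in> A \<times> S" "t' \<in> A \<times> S" and eq: "f t = f t'"
    then obtain e g x z s e' g' x' z' s' where t: "t = (((e, g), (x, z)), s)"
      "t' = (((e', g'), (x', z')), s')"
      "e < Q ^ n" "g < Q ^ n" "x < Q ^ n" "z < Q ^ n" "s < Q ^ (2 * n + 1)"
      "e' < Q ^ n" "g' < Q ^ n" "x' < Q ^ n" "z' < Q ^ n" "s' < Q ^ (2 * n + 1)"
      by (auto simp: A_def V_def S_def)
    have "mk n e g x z s = mk n e' g' x' z' s'" using eq by (simp add: f_def t)
    then show "t = t'" using fields_mk[OF t(3-7)] fields_mk[OF t(8-12)] by (simp add: t)
  qed
  have sub: "f ` (A \<times> S - (B1 \<union> B2 \<union> B3)) \<subseteq> {w. good n w}"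
  proof (intro image_subsetI)
    fix t assume t: "t \<in> A \<times> S - (B1 \<union> B2 \<union> B3)"
    then obtain e g x z s where te: "t = (((e, g), (x, z)), s)"
      and lt: "e < Q ^ n" "g < Q ^ n" "x < Q ^ n" "z < Q ^ n" "s < Q ^ (2 * n + 1)"
      by (auto simp: A_def V_def S_def)
    have "good_tuple n e g x z s"
      using t lt by (auto simp: te good_tuple_def B1_def B2_def B3_def A_def V_def S_def)
    then have "good n (mk n e g x z s)" using fields_mk[OF lt] mk_less[OF lt] by (simp add:
        good_def)
    then show "f t \<in> {w. good n w}" by (simp add: f_def te)
  qed
  have fing: "finite {w. good n w}"
    by (rule finite_subset[of _ "{..<Q ^ (6 * n + 1)}"]) (auto simp: good_def)
  have finB: "finite B1" "finite B2" "finite B3"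
    unfolding B1_def B2_def B3_def using fin by (auto intro!: finite_SigmaI split: prod.splits)
  have "card (A \<times> S) - card (B1 \<union> B2 \<union> B3) \<le> card (A \<times> S - (B1 \<union> B2 \<union> B3))"
    using finB by (intro diff_card_le_card_Diff) auto
  also have "card (A \<times> S - (B1 \<union> B2 \<union> B3)) \<le> card {w. good n w}"
    using card_mono[OF fing sub] inj by (simp add: card_image inj_on_diff)
  finally have "card (A \<times> S) \<le> card {w. good n w} + (card B1 + card B2 + card B3)"
    using card_Un_le[of "B1 \<union> B2" B3] card_Un_le[of B1 B2] by linarith
  moreover have "card (A \<times> S) = Q * (N * N * N)" by (simp add: card_cartesian_product cA cS)
  moreover have "N * N * (Q * N) = Q * (N * N * N)" by simp
  ultimately have "4 * (Q * (N * N * N)) \<le> 4 * card {w. good n w} + Q * (N * N * N) + 16 * (N * N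
      * N)"
    using c1 c2 c3 by linarith
  \<comment> \<open>Four times the number of good \<open>w\<close> is at least (3 Q - 16) N^3, and 3
    Q - 16 \<ge> 2 Q.\<close>
  then have "Q * (N * N * N) \<le> 2 * card {w. good n w}" by (simp add: Q_def)
  moreover have "Q ^ (6 * n + 1) = Q * (N * N * N)" by (simp add: N_def flip: power_add)
  ultimately show ?thesis by simp
qed

section \<open>Recovering a configuration from partial data\<close>

definition c0 :: "nat \<Rightarrow> nat \<Rightarrow> nat" where
  "c0 n w = vec Q n (\<lambda>i. dig Q (fE n w) i + dig Q (fX n w) i * dig Q (fZ n w) i)"
definition d1 :: "nat \<Rightarrow> nat \<Rightarrow> nat" where
  "d1 n w = vec Q n (\<lambda>i. dig Q (fG n w) i + (dig Q (fX n w) i + dig Q (fZ n w) i))"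
definition ya :: "nat \<Rightarrow> nat \<Rightarrow> nat" where
  "ya n w = ordinate n (fE n w) (fG n w) (fX n w) (fZ n w)"
definition yb :: "nat \<Rightarrow> nat \<Rightarrow> nat" where
  "yb n w = ordinate n (fE n w) (fG n w) (fZ n w) (fX n w)"
text \<open>Two known points give the n - k slope digits outside the coincidences, so k + 1 hash
  digits suffice for the slope. Dually, \<open>h2\<close> has n + 1 - k digits.\<close>

definition h1 :: "nat \<Rightarrow> nat \<Rightarrow> nat \<Rightarrow> nat" where
  "h1 n k w = hash n (n - k) (fS n w) (fG n w)"
definition h2 :: "nat \<Rightarrow> nat \<Rightarrow> nat \<Rightarrow> nat" where
  "h2 n k w = hash n k (fS n w) (ya n w)"

text \<open>The sums and the distances \<open>\<bar>x - z\<bar>\<close>, in base \<open>64 = (Q + 1) / 2\<close>, determine the unordered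
  pairs \<open>{x, z}\<close>: this is where one bit per configuration is saved.\<close>

definition xzsum :: "nat \<Rightarrow> nat \<Rightarrow> nat" where
  "xzsum n w = vec Q n (\<lambda>i. dig Q (fX n w) i + dig Q (fZ n w) i)"
definition xzdist :: "nat \<Rightarrow> nat \<Rightarrow> nat" where
  "xzdist n w = vec 64 n (\<lambda>i. min
     ((dig Q (fX n w) i + (Q - dig Q (fZ n w) i)) mod Q)
     ((dig Q (fZ n w) i + (Q - dig Q (fX n w) i)) mod Q))"

text \<open>\<open>k\<close> is a separate parameter because a decoder needs it before it knows
  \<open>w\<close>: it sets the lengths of the hash values.\<close>

definition config :: "nat \<Rightarrow> nat \<Rightarrow> nat \<Rightarrow> bool" where
  "config n k w \<longleftrightarrow> good n w \<and> k = card (coinc n (fX n w) (fZ n w))"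

lemma config_le: "config n k w \<Longrightarrow> k \<le> n" "config n k w \<Longrightarrow> Q * k \<le> 4 * n"
  by (auto simp: config_def good_def good_tuple_def card_coinc_le)

lemma comps_less [simp]:
  "c0 n w < Q ^ n" "d1 n w < Q ^ n" "ya n w < Q ^ n" "yb n w < Q ^ n"
  "xzsum n w < Q ^ n" "xzdist n w < 64 ^ n"
  by (simp_all add: c0_def d1_def ya_def yb_def xzsum_def xzdist_def vec_less ordinate_less)

lemmas [simp] = fields_less

lemma h1_less [simp]: "k \<le> n \<Longrightarrow> h1 n k w < Q ^ (k + 1)"
  using hash_less[of "n - k" n] by (simp add: h1_def)

lemma h2_less [simp]: "k \<le> n \<Longrightarrow> h2 n k w < Q ^ (n + 1 - k)"
  unfolding h2_def by (rule hash_less)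

lemma mod_Q_eq_iff: "a mod Q = b mod Q \<longleftrightarrow> int Q dvd int a - int b"
  by (metis cong_def cong_iff_dvd_diff cong_int_iff)

lemma digit_eqI:
  assumes "int Q dvd int a - int b" "a < Q" "b < Q" shows "a = b"
  using assms by (simp flip: mod_Q_eq_iff)

lemma dvd_combine:
  fixes q :: int
  shows "q dvd a \<Longrightarrow> q dvd b \<Longrightarrow> c = u * a + v * b \<Longrightarrow> q dvd c"
  by simp

lemma digit_cancel: "(a + c) mod Q = (b + c) mod Q \<Longrightarrow> a < Q \<Longrightarrow> b < Q \<Longrightarrow> a = b"
  by (rule digit_eqI) (auto simp: mod_Q_eq_iff)

text \<open>The difference of the two equations is (x - z) (g - g') = 0 in the field; the intercepts
  and the symmetric term x z drop out.\<close>

lemma digit_slope: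
  assumes "(e + x * (g + z)) mod Q = (e' + x * (g' + z)) mod Q"
    "(e + z * (g + x)) mod Q = (e' + z * (g' + x)) mod Q"
    "x \<noteq> z" "x < Q" "z < Q" "g < Q" "g' < Q"
  shows "g = g'"
proof (rule digit_eqI)
  let ?q = "int Q"
  have "?q dvd (int x - int z) * (int g - int g')"
    using assms(1,2) unfolding mod_Q_eq_iff
    by (rule dvd_combine[where u = 1 and v = "-1"]) (simp add: algebra_simps)
  then have "?q dvd int x - int z \<or> ?q dvd int g - int g'"
    using prime_Q by (simp add: prime_dvd_mult_iff)
  moreover have "\<not> ?q dvd int x - int z" using digit_eqI[of x z] assms by auto
  ultimately show "?q dvd int g - int g'" by blast
qed (use assms in auto)

lemma mod_sub: assumes "z < Q" shows "int ((x + (Q - z)) mod Q) = (int x - int z) mod int Q"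
proof -
  have "int ((x + (Q - z)) mod Q) = (int x - int z + int Q) mod int Q"
    using assms by (simp add: zmod_int of_nat_diff algebra_simps)
  then show ?thesis by simp
qed

text \<open>Sum and difference determine x and z, as 2 is invertible. The minimum hides only the
  sign of the difference, that is, the order of the pair.\<close>

lemma digit_unordered:
  assumes s: "(x + z) mod Q = (x' + z') mod Q"
    and m: "min ((x + (Q - z)) mod Q) ((z + (Q - x)) mod Q) =
      min ((x' + (Q - z')) mod Q) ((z' + (Q - x')) mod Q)"
    and lt: "x < Q" "z < Q" "x' < Q" "z' < Q"
  shows "x = x' \<and> z = z' \<or> x = z' \<and> z = x'"
proof -
  let ?q = "int Q"
  have s': "?q dvd int (x + z) - int (x' + z')" using s by (simp only: mod_Q_eq_iff)
  \<comment> \<open>64 is the inverse of 2 modulo 127.\<close>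
  have halve: "?q dvd a" if "?q dvd 2 * a" for a
  proof -
    have "?q dvd 64 * (2 * a) - ?q * a" by (rule dvd_diff[OF dvd_mult[OF that] dvd_triv_left])
    also have "64 * (2 * a) - ?q * a = a" by (simp add: Q_def)
    finally show ?thesis .
  qed
  have same: "a = a' \<and> b = b'"
    if "?q dvd int (a + b) - int (a' + b')" "(a + (Q - b)) mod Q = (a' + (Q - b')) mod Q"
      "a < Q" "b < Q" "a' < Q" "b' < Q" for a b a' b'
  proof -
    have "(int a - int b) mod ?q = (int a' - int b') mod ?q"
      using that(2,4,6) by (simp flip: mod_sub)
    then have d: "?q dvd (int a - int b) - (int a' - int b')" by (simp add: mod_eq_dvd_iff)
    have "?q dvd 2 * (int a - int a')" "?q dvd 2 * (int b - int b')"
      by (rule dvd_combine[OF that(1) d, where u = 1 and v = 1], simp)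
        (rule dvd_combine[OF that(1) d, where u = 1 and v = "-1"], simp)
    then show ?thesis using halve digit_eqI that by blast
  qed
  have swap: "?q dvd int (z + x) - int (x' + z')" "?q dvd int (x + z) - int (z' + x')"
    "?q dvd int (z + x) - int (z' + x')"
    using s' by (simp_all add: add.commute)
  \<comment> \<open>Each minimum is one of two opposite differences. In each of the four cases
    \<open>same\<close> applies, up to a swap.\<close>
  show ?thesis
    using m same[OF s'] same[OF swap(1)] same[OF swap(2)] same[OF swap(3)] lt
    by (auto simp: min_def split: if_splits)
qed

lemma dig_comps:
  assumes "i < n"
  shows "dig Q (c0 n w) i = (dig Q (fE n w) i + dig Q (fX n w) i * dig Q (fZ n w) i) mod Q"
    "dig Q (d1 n w) i = (dig Q (fG n w) i + (dig Q (fX n w) i + dig Q (fZ n w) i)) mod Q"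
    "dig Q (ya n w) i = (dig Q (fE n w) i +
       dig Q (fX n w) i * (dig Q (fG n w) i + dig Q (fZ n w) i)) mod Q"
    "dig Q (yb n w) i = (dig Q (fE n w) i +
       dig Q (fZ n w) i * (dig Q (fG n w) i + dig Q (fX n w) i)) mod Q"
    "dig Q (xzsum n w) i = (dig Q (fX n w) i + dig Q (fZ n w) i) mod Q"
  using assms by (simp_all add: c0_def d1_def ya_def yb_def ordinate_def xzsum_def dig_vec)

text \<open>The two residues are opposite modulo 127: both are 0 or they sum to 127, so the smaller
  is at most 63. The reduction modulo 64 in \<open>vec\<close> thus changes nothing.\<close>

lemma dig_xzdist:
  assumes "i < n"
  shows "dig 64 (xzdist n w) i = min
     ((dig Q (fX n w) i + (Q - dig Q (fZ n w) i)) mod Q)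
     ((dig Q (fZ n w) i + (Q - dig Q (fX n w) i)) mod Q)"
proof -
  have "min ((x + (Q - z)) mod Q) ((z + (Q - x)) mod Q) < 64" if "x < Q" "z < Q" for x z
  proof (cases "z \<le> x")
    case True
    then have "x + (Q - z) = (x - z) + Q" using that by simp
    then have "(x + (Q - z)) mod Q = x - z" using that by (metis mod_add_self2 mod_less
        less_imp_diff_less)
    moreover have "z + (Q - x) = Q - (x - z)" using that True by simp
    then have "(z + (Q - x)) mod Q \<le> Q - (x - z)" by (metis mod_less_eq_dividend)
    moreover have "x - z < 64 \<or> Q - (x - z) < 64" unfolding Q_def by linarith
    ultimately show ?thesis unfolding min_less_iff_disj by linarith
  next
    case False
    then have "z + (Q - x) = (z - x) + Q" using that by simp
    then have "(z + (Q - x)) mod Q = z - x" using that by (metis mod_add_self2 mod_less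
        less_imp_diff_less)
    moreover have "x + (Q - z) = Q - (z - x)" using that False by simp
    then have "(x + (Q - z)) mod Q \<le> Q - (z - x)" by (metis mod_less_eq_dividend)
    moreover have "z - x < 64 \<or> Q - (z - x) < 64" unfolding Q_def by linarith
    ultimately show ?thesis unfolding min_less_iff_disj by linarith
  qed
  then show ?thesis
    unfolding xzdist_def by (subst dig_vec) (use assms in \<open>simp_all only: dig_less Q_pos mod_less
        zero_less_numeral\<close>)
qed

lemma mod_add_mult_right: "(a + x * (b mod q)) mod q = (a + x * b) mod (q :: nat)"
  by (metis mod_add_right_eq mod_mult_right_eq)

section \<open>Which data determine which fields\<close>

context
  fixes n w w' :: nat
begin

text \<open>\<open>w'\<close> stands for whatever number a search returns, so here and below it is
  compared with \<open>w\<close> only on the data.\<close>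

lemma e_of_c0:
  assumes "c0 n w' = c0 n w" "fX n w' = fX n w" "fZ n w' = fZ n w"
  shows "fE n w' = fE n w"
proof (rule eq_if_dig_eq)
  fix i assume i: "i < n"
  show "dig Q (fE n w') i = dig Q (fE n w) i"
    by (rule digit_cancel[where c = "dig Q (fX n w) i * dig Q (fZ n w) i"])
      (use dig_comps(1)[OF i, of w] dig_comps(1)[OF i, of w'] assms in
        \<open>simp_all add: dig_less\<close>)
qed simp_all

lemma g_of_d1:
  assumes "d1 n w' = d1 n w" "fX n w' = fX n w" "fZ n w' = fZ n w"
  shows "fG n w' = fG n w"
proof (rule eq_if_dig_eq)
  fix i assume i: "i < n"
  show "dig Q (fG n w') i = dig Q (fG n w) i"
    by (rule digit_cancel[where c = "dig Q (fX n w) i + dig Q (fZ n w) i"])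
      (use dig_comps(2)[OF i, of w] dig_comps(2)[OF i, of w'] assms in
        \<open>simp_all add: dig_less\<close>)
qed simp_all

lemma z_of_d1:
  assumes "d1 n w' = d1 n w" "fX n w' = fX n w" "fG n w' = fG n w"
  shows "fZ n w' = fZ n w"
proof (rule eq_if_dig_eq)
  fix i assume i: "i < n"
  show "dig Q (fZ n w') i = dig Q (fZ n w) i"
    by (rule digit_cancel[where c = "dig Q (fG n w) i + dig Q (fX n w) i"])
      (use dig_comps(2)[OF i, of w] dig_comps(2)[OF i, of w'] assms in
        \<open>simp_all add: dig_less ac_simps\<close>)
qed simp_all

lemma x_of_d1:
  assumes "d1 n w' = d1 n w" "fZ n w' = fZ n w" "fG n w' = fG n w"
  shows "fX n w' = fX n w"
proof (rule eq_if_dig_eq)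
  fix i assume i: "i < n"
  show "dig Q (fX n w') i = dig Q (fX n w) i"
    by (rule digit_cancel[where c = "dig Q (fG n w) i + dig Q (fZ n w) i"])
      (use dig_comps(2)[OF i, of w] dig_comps(2)[OF i, of w'] assms in
        \<open>simp_all add: dig_less ac_simps\<close>)
qed simp_all

lemma e_of_yb:
  assumes "yb n w' = yb n w" "fG n w' = fG n w" "fX n w' = fX n w" "fZ n w' = fZ n w"
  shows "fE n w' = fE n w"
proof (rule eq_if_dig_eq)
  fix i assume i: "i < n"
  show "dig Q (fE n w') i = dig Q (fE n w) i"
    by (rule digit_cancel[where c = "dig Q (fZ n w) i * (dig Q (fG n w) i + dig Q (fX n w) i)"])
      (use dig_comps(4)[OF i, of w] dig_comps(4)[OF i, of w'] assms in
        \<open>simp_all add: dig_less\<close>)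
qed simp_all

lemma e_of_ya:
  assumes "ya n w' = ya n w" "fG n w' = fG n w" "fX n w' = fX n w" "fZ n w' = fZ n w"
  shows "fE n w' = fE n w"
proof (rule eq_if_dig_eq)
  fix i assume i: "i < n"
  show "dig Q (fE n w') i = dig Q (fE n w) i"
    by (rule digit_cancel[where c = "dig Q (fX n w) i * (dig Q (fG n w) i + dig Q (fZ n w) i)"])
      (use dig_comps(3)[OF i, of w] dig_comps(3)[OF i, of w'] assms in
        \<open>simp_all add: dig_less\<close>)
qed simp_all

text \<open>The point over x lies on the line: e + x (g + z) = (e + x z) + g x.\<close>

lemma ya_of_line:
  assumes "c0 n w' = c0 n w" "fG n w' = fG n w" "fX n w' = fX n w"
  shows "ya n w' = ya n w"
proof (rule eq_if_dig_eq)
  fix i assume i: "i < n"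
  have "dig Q (ya n v) i = (dig Q (c0 n v) i + dig Q (fX n v) i * dig Q (fG n v) i) mod Q" for v
    using i by (simp add: dig_comps mod_simps algebra_simps)
  then show "dig Q (ya n w') i = dig Q (ya n w) i" using assms by simp
qed simp_all

lemma yb_of_line:
  assumes "c0 n w' = c0 n w" "fG n w' = fG n w" "fZ n w' = fZ n w"
  shows "yb n w' = yb n w"
proof (rule eq_if_dig_eq)
  fix i assume i: "i < n"
  have "dig Q (yb n v) i = (dig Q (c0 n v) i + dig Q (fZ n v) i * dig Q (fG n v) i) mod Q" for v
    using i by (simp add: dig_comps mod_simps algebra_simps)
  then show "dig Q (yb n w') i = dig Q (yb n w) i" using assms by simp
qed simp_all

lemma ya_of_parabola:
  assumes "fE n w' = fE n w" "d1 n w' = d1 n w" "fX n w' = fX n w"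
  shows "ya n w' = ya n w"
proof (rule eq_if_dig_eq)
  fix i assume i: "i < n"
  \<comment> \<open>The equation of the parabola at t = x, with the square moved to the other side
    to avoid subtraction.\<close>
  have *: "(dig Q (ya n v) i + dig Q (fX n v) i * dig Q (fX n v) i) mod Q =
      (dig Q (fE n v) i + dig Q (fX n v) i * dig Q (d1 n v) i) mod Q" for v
    unfolding dig_comps[OF i] mod_add_mult_right mod_add_left_eq by (simp add: algebra_simps)
  show "dig Q (ya n w') i = dig Q (ya n w) i"
    by (rule digit_cancel[where c = "dig Q (fX n w) i * dig Q (fX n w) i"])
      (use *[of w] *[of w'] assms in \<open>simp_all add: dig_less\<close>)
qed simp_all

lemma yb_of_parabola:
  assumes "fE n w' = fE n w" "d1 n w' = d1 n w" "fZ n w' = fZ n w"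
  shows "yb n w' = yb n w"
proof (rule eq_if_dig_eq)
  fix i assume i: "i < n"
  have *: "(dig Q (yb n v) i + dig Q (fZ n v) i * dig Q (fZ n v) i) mod Q =
      (dig Q (fE n v) i + dig Q (fZ n v) i * dig Q (d1 n v) i) mod Q" for v
    unfolding dig_comps[OF i] mod_add_mult_right mod_add_left_eq by (simp add: algebra_simps)
  show "dig Q (yb n w') i = dig Q (yb n w) i"
    by (rule digit_cancel[where c = "dig Q (fZ n w) i * dig Q (fZ n w) i"])
      (use *[of w] *[of w'] assms in \<open>simp_all add: dig_less\<close>)
qed simp_all

text \<open>Line and parabola involve x and z only through x z and x + z, so an unordered pair is
  enough to pass from one to the other.\<close>

lemma parabola_of_unordered:
  assumes "c0 n w' = c0 n w" "fG n w' = fG n w" "xzsum n w' = xzsum n w" "xzdist n w' = xzdist n w"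
  shows "fE n w' = fE n w" "d1 n w' = d1 n w"
proof -
  have *: "dig Q (fE n w') i = dig Q (fE n w) i \<and> dig Q (d1 n w') i = dig Q (d1 n w) i"
    if i: "i < n" for i
  proof -
    let ?x = "dig Q (fX n w) i" and ?z = "dig Q (fZ n w) i"
    let ?x' = "dig Q (fX n w') i" and ?z' = "dig Q (fZ n w') i"
    have "?x' = ?x \<and> ?z' = ?z \<or> ?x' = ?z \<and> ?z' = ?x"
      by (rule digit_unordered)
        (use dig_comps(5)[OF i, of w] dig_comps(5)[OF i, of w'] dig_xzdist[OF i, of w]
          dig_xzdist[OF i, of w'] assms in \<open>simp_all add: dig_less\<close>)
    then have xz: "?x' * ?z' = ?x * ?z" "?x' + ?z' = ?x + ?z" by auto
    have "dig Q (fE n w') i = dig Q (fE n w) i"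
      by (rule digit_cancel[where c = "?x * ?z"])
        (use dig_comps(1)[OF i, of w] dig_comps(1)[OF i, of w'] assms xz in \<open>simp_all add:
            dig_less\<close>)
    moreover have "dig Q (d1 n w') i = dig Q (d1 n w) i"
      unfolding dig_comps(2)[OF i] xz assms ..
    ultimately show ?thesis ..
  qed
  show "fE n w' = fE n w" by (rule eq_if_dig_eq[where B = Q and n = n]) (simp_all add: *)
  show "d1 n w' = d1 n w" by (rule eq_if_dig_eq[where B = Q and n = n]) (simp_all add: *)
qed

text \<open>At a coincidence the formulas for the two ordinates are the same, so \<open>yb\<close>
  supplies those k digits of \<open>ya\<close>, and the hash pins down the others.\<close>

lemma ya_of_hash:
  assumes w: "config n k w"
    and eq: "fX n w' = fX n w" "fZ n w' = fZ n w" "fS n w' = fS n w" "yb n w' = yb n w"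
      "h2 n k w' = h2 n k w"
  shows "ya n w' = ya n w"
proof -
  let ?J = "coinc n (fX n w) (fZ n w)"
  have p: "pinned n ?J (fS n w) (ya n w)" "k = card ?J"
    using w by (auto simp: config_def good_def good_tuple_def ya_def)
  have "dig Q (ya n w') i = dig Q (ya n w) i" if "i \<in> ?J" for i
  proof -
    have i: "i < n" "dig Q (fX n w) i = dig Q (fZ n w) i" using that by (auto simp: coinc_def)
    have "dig Q (ya n w') i = dig Q (yb n w') i" "dig Q (ya n w) i = dig Q (yb n w) i"
      unfolding dig_comps[OF i(1)] eq(1,2) i(2) by (rule refl)+
    then show ?thesis by (simp only: eq(4))
  qed
  then show ?thesis using p eq(3,5) unfolding pinned_def h2_def by simp
qed

text \<open>Off the coincidences the two points are distinct and fix the slope; the hash pins down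
  its remaining k digits.\<close>

lemma g_of_hash:
  assumes w: "config n k w"
    and eq: "fX n w' = fX n w" "fZ n w' = fZ n w" "fS n w' = fS n w" "ya n w' = ya n w"
      "yb n w' = yb n w" "h1 n k w' = h1 n k w"
  shows "fG n w' = fG n w"
proof -
  let ?J = "{..<n} - coinc n (fX n w) (fZ n w)"
  have p: "pinned n ?J (fS n w) (fG n w)" "k = card (coinc n (fX n w) (fZ n w))"
    using w by (auto simp: config_def good_def good_tuple_def)
  have c: "card ?J = n - k" using p(2) coinc_subset by (simp add: card_Diff_subset)
  have "dig Q (fG n w') i = dig Q (fG n w) i" if "i \<in> ?J" for i
  proof (rule digit_slope)
    have i: "i < n" "dig Q (fX n w) i \<noteq> dig Q (fZ n w) i" using that by (auto simp: coinc_def)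
    then show "dig Q (fX n w) i \<noteq> dig Q (fZ n w) i" by simp
    show "(dig Q (fE n w') i + dig Q (fX n w) i * (dig Q (fG n w') i + dig Q (fZ n w) i)) mod Q =
      (dig Q (fE n w) i + dig Q (fX n w) i * (dig Q (fG n w) i + dig Q (fZ n w) i)) mod Q"
      using dig_comps(3)[OF i(1), of w] dig_comps(3)[OF i(1), of w'] by (simp add: eq)
    show "(dig Q (fE n w') i + dig Q (fZ n w) i * (dig Q (fG n w') i + dig Q (fX n w) i)) mod Q =
      (dig Q (fE n w) i + dig Q (fZ n w) i * (dig Q (fG n w) i + dig Q (fX n w) i)) mod Q"
      using dig_comps(4)[OF i(1), of w] dig_comps(4)[OF i(1), of w'] by (simp add: eq)
  qed (simp_all add: dig_less)
  then show ?thesis using p(1) eq(3,6) unfolding pinned_def h1_def c by simp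
qed

end

lemma mod_mult_div: "0 < b \<Longrightarrow> a mod (b * c) div b = a div b mod (c :: nat)"
  by (simp add: mod_mult2_eq)

text \<open>A search may return a number beyond Q^(6n+1), and the fields say nothing about its
  higher digits. Hence equality modulo that power only.\<close>

lemma mod_eq_of_fields:
  assumes "fE n w' = fE n w" "fG n w' = fG n w" "fX n w' = fX n w" "fZ n w' = fZ n w"
    "fS n w' = fS n w"
  shows "w' mod Q ^ (6 * n + 1) = w mod Q ^ (6 * n + 1)"
proof -
  let ?M = "Q ^ (6 * n + 1)"
  have f: "fE n (v mod ?M) = fE n v \<and> fG n (v mod ?M) = fG n v \<and> fX n (v mod ?M) = fX n v \<and>
      fZ n (v mod ?M) = fZ n v \<and> fS n (v mod ?M) = fS n v" for v
  proof -
    have *: "v mod ?M div Q ^ i mod Q ^ j = v div Q ^ i mod Q ^ j" if "i + j \<le> 6 * n + 1" for i j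
    proof -
      define l where "l = 6 * n + 1 - (i + j)"
      have l: "6 * n + 1 = i + (j + l)" using that by (simp add: l_def)
      have "v mod ?M div Q ^ i = v div Q ^ i mod Q ^ (j + l)"
        unfolding l power_add[of Q i] by (rule mod_mult_div) simp
      then show ?thesis by (simp only: power_add mod_mod_cancel dvd_triv_left)
    qed
    have "fE n (v mod ?M) = fE n v" using *[of 0 n] unfolding fE_def power_0 div_by_1 by linarith
    then show ?thesis unfolding fG_def fX_def fZ_def fS_def by (intro conjI *) simp_all
  qed
  have "w' mod ?M = mk n (fE n w') (fG n w') (fX n w') (fZ n w') (fS n w')"
    using mk_fields[of "w' mod ?M" n] f[of w'] by (simp only: mod_less_divisor zero_less_power
        Q_pos)
  also have "\<dots> = w mod ?M"
    using mk_fields[of "w mod ?M" n] f[of w] by (simp only: assms mod_less_divisor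
        zero_less_power Q_pos)
  finally show ?thesis .
qed

section \<open>Complexity bounds\<close>

lemma recursive_comp3:
  "recursive 3 (\<lambda>xs. f (xs ! 0) (xs ! 1) (xs ! 2)) \<Longrightarrow> recursive n F \<Longrightarrow> recursive n G \<Longrightarrow> recursive n H \<Longrightarrow>
    recursive n (\<lambda>xs. f (F xs) (G xs) (H xs))"
  using recursive_comp[of "[F, G, H]" "\<lambda>xs. f (xs ! 0) (xs ! 1) (xs ! 2)" n]
  by (auto simp: numeral_3_eq_3 numeral_2_eq_2)

lemma recursive_min: "recursive n F \<Longrightarrow> recursive n G \<Longrightarrow> recursive n (\<lambda>xs. min (F xs) (G xs))"
  unfolding min_def by (rule recursive_if_le)

lemma recursive_dig: "recursive n F \<Longrightarrow> recursive n G \<Longrightarrow> recursive n (\<lambda>xs. dig B (F xs) (G xs))"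
  unfolding dig_def by (intro recursive_intros)

lemma recursive_fields:
  assumes "recursive n F" "recursive n G"
  shows "recursive n (\<lambda>xs. fE (F xs) (G xs))" "recursive n (\<lambda>xs. fG (F xs) (G xs))"
    "recursive n (\<lambda>xs. fX (F xs) (G xs))" "recursive n (\<lambda>xs. fZ (F xs) (G xs))"
    "recursive n (\<lambda>xs. fS (F xs) (G xs))"
  unfolding fE_def fG_def fX_def fZ_def fS_def by (intro recursive_intros assms)+

lemma recursive_hash:
  "recursive n F \<Longrightarrow> recursive n G \<Longrightarrow> recursive n H \<Longrightarrow> recursive n I \<Longrightarrow> recursive n (\<lambda>xs. hash (F xs)
      (G xs) (H xs) (I xs))"
  unfolding hash_def by (intro recursive_intros)

lemma recursive_vectors:
  assumes "recursive n F" "recursive n G"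
  shows "recursive n (\<lambda>xs. c0 (F xs) (G xs))" "recursive n (\<lambda>xs. d1 (F xs) (G xs))"
    "recursive n (\<lambda>xs. ya (F xs) (G xs))" "recursive n (\<lambda>xs. yb (F xs) (G xs))"
    "recursive n (\<lambda>xs. xzsum (F xs) (G xs))" "recursive n (\<lambda>xs. xzdist (F xs) (G xs))"
proof -
  note defs = c0_def d1_def ya_def yb_def xzsum_def xzdist_def ordinate_def vec_def
  have "recursive 2 (\<lambda>xs. c0 (xs ! 0) (xs ! 1))" "recursive 2 (\<lambda>xs. d1 (xs ! 0) (xs ! 1))"
    "recursive 2 (\<lambda>xs. ya (xs ! 0) (xs ! 1))" "recursive 2 (\<lambda>xs. yb (xs ! 0) (xs ! 1))"
    "recursive 2 (\<lambda>xs. xzsum (xs ! 0) (xs ! 1))" "recursive 2 (\<lambda>xs. xzdist (xs ! 0) (xs ! 1))"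
    unfolding defs by (intro recursive_intros recursive_dig recursive_fields recursive_min; simp)+
  note this[THEN recursive_comp2, OF assms]
  then show "recursive n (\<lambda>xs. c0 (F xs) (G xs))" "recursive n (\<lambda>xs. d1 (F xs) (G xs))"
    "recursive n (\<lambda>xs. ya (F xs) (G xs))" "recursive n (\<lambda>xs. yb (F xs) (G xs))"
    "recursive n (\<lambda>xs. xzsum (F xs) (G xs))" "recursive n (\<lambda>xs. xzdist (F xs) (G xs))" .
qed

lemma recursive_hashes:
  assumes "recursive n F" "recursive n G" "recursive n H"
  shows "recursive n (\<lambda>xs. h1 (F xs) (G xs) (H xs))" "recursive n (\<lambda>xs. h2 (F xs) (G xs) (H xs))"
  unfolding h1_def h2_def by (intro recursive_hash recursive_diff recursive_fields
      recursive_vectors assms)+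

lemmas recursive_comps = recursive_intros recursive_fields recursive_vectors recursive_hashes

text \<open>The cost of announcing \<open>n\<close> and some \<open>k \<le> n\<close> to a decoder.\<close>

definition err :: "nat \<Rightarrow> real" where
  "err n = 2 * log 2 (real (prod_encode (n, n)) + 1)"

lemma prod_encode_mono: "a \<le> a' \<Longrightarrow> b \<le> b' \<Longrightarrow> prod_encode (a, b) \<le> prod_encode (a', b')"
  unfolding prod_encode_def triangle_def split_conv
  by (intro add_mono div_le_mono mult_le_mono) auto

text \<open>\<open>string_a\<close> is the first component in (a), \<open>string_a2\<close> the one in (b).\<close>

definition string_b :: "nat \<Rightarrow> nat \<Rightarrow> nat" where "string_b n w = fZ n w + Q ^ n * yb n w"
definition string_c :: "nat \<Rightarrow> nat \<Rightarrow> nat" where "string_c n w = c0 n w + Q ^ n * fG n w"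
definition string_d :: "nat \<Rightarrow> nat \<Rightarrow> nat" where "string_d n w = fE n w + Q ^ n * d1 n w"
definition string_a :: "nat \<Rightarrow> nat \<Rightarrow> nat \<Rightarrow> nat" where
  "string_a n k w = fX n w + Q ^ n * (fS n w + Q ^ (2 * n + 1) * h2 n k w)"
definition string_a2 :: "nat \<Rightarrow> nat \<Rightarrow> nat \<Rightarrow> nat" where
  "string_a2 n k w = fX n w + Q ^ n * (ya n w + Q ^ n * (fS n w + Q ^ (2 * n + 1) * h1 n k w))"

lemma pack_eq_iff:
  fixes a M :: nat
  assumes "a < M" "a' < M" shows "a + M * b = a' + M * b' \<longleftrightarrow> a = a' \<and> b = b'"
proof
  assume *: "a + M * b = a' + M * b'"
  from arg_cong[OF *, of "\<lambda>t. t mod M"] arg_cong[OF *, of "\<lambda>t. t div M"] assms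
  show "a = a' \<and> b = b'" by simp
qed simp

lemma pack_less: "a < Q ^ i \<Longrightarrow> b < Q ^ j \<Longrightarrow> a + Q ^ i * b < Q ^ (i + j)"
  unfolding power_add by (rule add_mult_less)

lemma config_h1_less [simp]: "config n k w \<Longrightarrow> h1 n k w < Q ^ (k + 1)"
  and config_h2_less [simp]: "config n k w \<Longrightarrow> h2 n k w < Q ^ (n + 1 - k)"
  using config_le h1_less h2_less by blast+

lemma fS_less' [simp]: "fS n w < Q * Q ^ (2 * n)"
  using fields_less(5)[of n w] by simp

lemma config_less: "config n k w \<Longrightarrow> w < Q ^ (6 * n + 1)"
  by (simp only: config_def good_def)

lemmas field_bounds = fields_less comps_less config_h1_less config_h2_less

lemma strings_less:
  "string_b n w < Q ^ (n + n)" "string_c n w < Q ^ (n + n)" "string_d n w < Q ^ (n + n)"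
  "config n k w \<Longrightarrow> string_a n k w < Q ^ (n + ((2 * n + 1) + (n + 1 - k)))"
  "config n k w \<Longrightarrow> string_a2 n k w < Q ^ (n + (n + ((2 * n + 1) + (k + 1))))"
  unfolding string_b_def string_c_def string_d_def string_a_def string_a2_def by (intro pack_less
      field_bounds; assumption?)+

lemma strings_eq_iff:
  "string_b n w' = string_b n w \<longleftrightarrow> fZ n w' = fZ n w \<and> yb n w' = yb n w"
  "string_c n w' = string_c n w \<longleftrightarrow> c0 n w' = c0 n w \<and> fG n w' = fG n w"
  "string_d n w' = string_d n w \<longleftrightarrow> fE n w' = fE n w \<and> d1 n w' = d1 n w"
  "string_a n k w' = string_a n k w \<longleftrightarrow> fX n w' = fX n w \<and> fS n w' = fS n w \<and> h2 n k w' = h2 n k w"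
  "string_a2 n k w' = string_a2 n k w \<longleftrightarrow> fX n w' = fX n w \<and> ya n w' = ya n w \<and> fS n w' = fS n w \<and>
     h1 n k w' = h1 n k w"
  unfolding string_b_def string_c_def string_d_def string_a_def string_a2_def by (simp_all only:
      pack_eq_iff fields_less comps_less)

lemma recursive_strings:
  assumes "recursive n F" "recursive n G"
  shows "recursive n (\<lambda>xs. string_b (F xs) (G xs))" "recursive n (\<lambda>xs. string_c (F xs) (G xs))"
      "recursive n (\<lambda>xs. string_d (F xs) (G xs))"
    "recursive n H \<Longrightarrow> recursive n (\<lambda>xs. string_a (F xs) (G xs) (H xs))"
    "recursive n H \<Longrightarrow> recursive n (\<lambda>xs. string_a2 (F xs) (G xs) (H xs))"
  unfolding string_b_def string_c_def string_d_def string_a_def string_a2_def by (intro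
      recursive_comps assms; assumption)+

context
  fixes n k w w' :: nat
  assumes cfg: "config n k w"
begin

lemma recover_a:
  assumes "fX n w' = fX n w" "fZ n w' = fZ n w" "fS n w' = fS n w" "ya n w' = ya n w"
    "yb n w' = yb n w" "h1 n k w' = h1 n k w"
  shows "fE n w' = fE n w" "fG n w' = fG n w"
proof -
  show "fG n w' = fG n w" by (rule g_of_hash[OF cfg assms])
  then show "fE n w' = fE n w" using assms by (intro e_of_ya)
qed

lemma h2_eq: "ya n w' = ya n w \<Longrightarrow> fS n w' = fS n w \<Longrightarrow> h2 n k w' = h2 n k w"
  by (simp only: h2_def)

lemma h1_eq: "fG n w' = fG n w \<Longrightarrow> fS n w' = fS n w \<Longrightarrow> h1 n k w' = h1 n k w"
  by (simp only: h1_def)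

end

text \<open>Nonnegative constants can be added up, so that one sum bounds both signs in the final
  estimates.\<close>

lemma nonneg_constant:
  fixes K :: real
  assumes "\<And>n k w. P n k w \<Longrightarrow> f n k w \<le> g n k w + K"
  shows "\<exists>K\<ge>0. \<forall>n k w. P n k w \<longrightarrow> f n k w \<le> g n k w + K"
  by (intro exI[of _ "max 0 K"]) (use assms in fastforce)

lemma log_Q_power: "log 2 (real (Q ^ l)) = real l * log 2 Q"
  by (simp add: log_nat_power)

lemma log_cd: "log 2 (real (Q ^ n * (Q ^ n * (Q ^ n * 64 ^ n)))) = 3 * real n * log 2 Q + 6 *
    real n"
proof -
  have "Q ^ n * (Q ^ n * (Q ^ n * 64 ^ n)) = Q ^ (3 * n) * (2 ^ 6) ^ n"
    by (simp add: power_mult power3_eq_cube power_mult_distrib)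
  also have "\<dots> = Q ^ (3 * n) * 2 ^ (6 * n)" by (simp only: power_mult)
  finally have "log 2 (real (Q ^ n * (Q ^ n * (Q ^ n * 64 ^ n)))) =
      log 2 (real (Q ^ (3 * n))) + log 2 (2 ^ (6 * n))"
    by (simp add: log_mult)
  also have "log 2 ((2::real) ^ (6 * n)) = real (6 * n)" by (rule log_pow_cancel) simp_all
  finally show ?thesis by (simp add: log_nat_power)
qed

section \<open>Bounds for tuples of components\<close>

context
  fixes U :: lang and code :: "str list \<Rightarrow> str"
  assumes univ: "universal_language U" and comp: "computable_tuple_bijection code"
begin

definition tuple :: "nat list \<Rightarrow> nat" where
  "tuple ns = nat_of_str (code (map str_of ns))"

definition CN :: "nat \<Rightarrow> real" where "CN a = plainC U (str_of a)"

lemma str_of_tuple: "str_of (tuple ns) = code (map str_of ns)"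
  by (simp add: tuple_def)

lemma plainC_code2: "plainC U (code [str_of a, str_of b]) = CN (tuple [a, b])"
  and plainC_code3: "plainC U (code [str_of a, str_of b, str_of c]) = CN (tuple [a, b, c])"
  by (simp_all add: CN_def str_of_tuple)

lemma tuple_eq_iff [simp]: "tuple ms = tuple ns \<longleftrightarrow> ms = ns"
proof
  assume "tuple ms = tuple ns"
  then have "code (map str_of ms) = code (map str_of ns)" by (metis str_of_tuple)
  moreover have "inj code" using comp by (simp add: computable_tuple_bijection_def bij_def)
  ultimately have "map str_of ms = map str_of ns" by (simp add: inj_eq)
  then show "ms = ns" by (auto intro: inj_onI dest!: map_inj_on)
qed simp

lemma recursive_tuple:
  assumes "recursive n F" shows "recursive n (\<lambda>xs. tuple (list_decode (F xs)))"
proof (rule recursive_comp1[OF _ assms, of "\<lambda>l. tuple (list_decode l)"])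
  obtain f where f: "partial_recursive 1 f"
    "\<And>ss. f [list_encode (map nat_of_str ss)] = Some (nat_of_str (code ss))"
    using comp unfolding computable_tuple_bijection_def by auto
  have "f xs = Some (tuple (list_decode (xs ! 0)))" if len: "length xs = 1" for xs
  proof -
    have "xs = [list_encode (map nat_of_str (map str_of (list_decode (xs ! 0))))]"
      using len by (auto simp: length_Suc_conv comp_def)
    then show ?thesis using f(2)[of "map str_of (list_decode (xs ! 0))"] by (simp add: tuple_def)
  qed
  then show "recursive 1 (\<lambda>xs. tuple (list_decode (xs ! 0)))"
    unfolding recursive_def using f(1) by (auto simp: partial_def)
qed

lemma recursive_tuples:
  assumes "recursive n F" "recursive n G"
  shows "recursive n (\<lambda>xs. tuple [F xs, G xs])"
    "recursive n H \<Longrightarrow> recursive n (\<lambda>xs. tuple [F xs, G xs, H xs])"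
proof -
  show "recursive n (\<lambda>xs. tuple [F xs, G xs])"
    using recursive_tuple[of n "\<lambda>xs. list_encode [F xs, G xs]"] assms
    by (simp del: list_encode.simps) (simp add: recursive_Suc recursive_prod_encode recursive_const)
  show "recursive n (\<lambda>xs. tuple [F xs, G xs, H xs])" if "recursive n H"
    using recursive_tuple[of n "\<lambda>xs. list_encode [F xs, G xs, H xs]"] assms that
    by (simp del: list_encode.simps) (simp add: recursive_Suc recursive_prod_encode recursive_const)
qed

text \<open>\<open>condC_search\<close> with the pair (n, k) as its parameter; since k \<le> n,
  announcing the pair costs at most \<open>err n\<close>.\<close>

lemma condC_config:
  assumes r: "recursive 3 (\<lambda>xs. T (xs ! 0) (xs ! 1) (xs ! 2))" "recursive 3 (\<lambda>xs. X (xs ! 0) (xs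
      ! 1) (xs ! 2))"
    "recursive 3 (\<lambda>xs. Y (xs ! 0) (xs ! 1) (xs ! 2))" "recursive 3 (\<lambda>xs. Out (xs ! 0) (xs ! 1)
        (xs ! 2))"
    "recursive 2 (\<lambda>xs. E (xs ! 0) (xs ! 1))"
    and lt: "\<And>n k w. config n k w \<Longrightarrow> X n k w < E n k"
    and det: "\<And>n k w w'. config n k w \<Longrightarrow> T n k w' = T n k w \<Longrightarrow> X n k w' = X n k w \<Longrightarrow>
      Y n k w' = Y n k w \<Longrightarrow> Out n k w' = Out n k w"
  obtains K where "\<And>n k w. config n k w \<Longrightarrow>
    condC U (str_of (Out n k w)) (str_of (Y n k w)) \<le>
    condC U (str_of (T n k w)) (str_of (Y n k w)) + log 2 (E n k) + err n + K"
proof -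
  have r2: "recursive 2 (\<lambda>xs. F (fst (prod_decode (xs ! 0))) (snd (prod_decode (xs ! 0))) (xs ! 1))"
    if "recursive 3 (\<lambda>xs. F (xs ! 0) (xs ! 1) (xs ! 2))" for F
    by (rule recursive_comp3[OF that]) (intro recursive_intros; simp)+
  have r1: "recursive 1 (\<lambda>xs. E (fst (prod_decode (xs ! 0))) (snd (prod_decode (xs ! 0))))"
    by (rule recursive_comp2[OF r(5)]) (intro recursive_intros; simp)+
  from condC_search[OF univ r(1-4)[THEN r2] r1] show thesis
  proof (elim exE, goal_cases)
    case (1 K)
    show ?case
    proof (rule that[of K])
      fix n k w assume c: "config n k w"
      have "condC U (str_of (Out n k w)) (str_of (Y n k w)) \<le>
        condC U (str_of (T n k w)) (str_of (Y n k w)) + log 2 (E n k) +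
        2 * log 2 (real (prod_encode (n, k)) + 1) + K"
        using 1[THEN spec, of "prod_encode (n, k)", THEN spec, of w, unfolded prod_encode_inverse
            fst_conv snd_conv]
          lt[OF c] det[OF c] by blast
      moreover have "2 * log 2 (real (prod_encode (n, k)) + 1) \<le> err n"
        using prod_encode_mono[of n n k n] config_le(1)[OF c] by (simp add: err_def)
      ultimately show "condC U (str_of (Out n k w)) (str_of (Y n k w)) \<le>
        condC U (str_of (T n k w)) (str_of (Y n k w)) + log 2 (E n k) + err n + K"
        by linarith
    qed
  qed
qed

definition random_config :: "nat \<Rightarrow> nat \<Rightarrow> nat \<Rightarrow> bool" where
  "random_config n k w \<longleftrightarrow> config n k w \<and> (6 * real n + 1) * log 2 Q - 2 \<le> CN w"

text \<open>Of the two bits lost, one is due to the restriction to good numbers and one to rounding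
  their count down to a power of two.\<close>

lemma exists_random_config:
  assumes "0 < n" shows "\<exists>k w. random_config n k w"
proof -
  let ?G = "{w. good n w}"
  have fin: "finite ?G"
    by (rule finite_subset[of _ "{..<Q ^ (6 * n + 1)}"]) (auto simp: good_def)
  have Qpos: "0 < Q ^ (6 * n + 1)" by simp
  then have pos: "0 < card ?G" using card_good[OF assms] by linarith
  obtain l where l: "2 ^ l \<le> card ?G" "card ?G < 2 ^ (l + 1)"
    using ex_power_ivl1[of 2 "card ?G"] pos by auto
  obtain w where w: "good n w" "real l \<le> CN w"
    using exists_incompressible[OF univ l(1) fin] unfolding CN_def by blast
  have "Q ^ (6 * n + 1) \<le> 2 * 2 ^ (l + 1)" using card_good[OF assms] l(2) by linarith
  then have "Q ^ (6 * n + 1) \<le> 2 ^ (l + 2)" by simp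
  then have "real (Q ^ (6 * n + 1)) \<le> real (2 ^ (l + 2))" by (simp only: of_nat_le_iff)
  then have "log 2 (real (Q ^ (6 * n + 1))) \<le> log 2 (real (2 ^ (l + 2)))"
    using Qpos by (intro log_mono) simp_all
  also have "log 2 (real (2 ^ (l + 2))) = real l + 2"
    using log_pow_cancel[of "2::real" "l + 2"] by (simp only: of_nat_power of_nat_numeral)
  also have "log 2 (real (Q ^ (6 * n + 1))) = (6 * real n + 1) * log 2 Q"
    by (subst of_nat_power, subst log_nat_power) simp_all
  finally have "random_config n (card (coinc n (fX n w) (fZ n w))) w"
    using w by (simp add: random_config_def config_def)
  then show ?thesis by blast
qed

text \<open>If \<open>T\<close> and a supplement of \<open>l\<close> base-\<open>Q\<close> digits
  determine every field, then \<open>T\<close> carries all but \<open>l\<close> of the 6 n + 1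
  digits of an incompressible number.\<close>

lemma lower_bound:
  fixes r :: "nat \<Rightarrow> nat \<Rightarrow> real"
  assumes recursive: "recursive 3 (\<lambda>xs. T (xs ! 0) (xs ! 1) (xs ! 2))" "recursive 3 (\<lambda>xs. X (xs !
      0) (xs ! 1) (xs ! 2))"
    "recursive 2 (\<lambda>xs. l (xs ! 0) (xs ! 1))"
    and r: "\<And>n k w. config n k w \<Longrightarrow> r n k = 6 * real n + 1 - real (l n k)"
    and lt: "\<And>n k w. config n k w \<Longrightarrow> X n k w < Q ^ l n k"
    and det: "\<And>n k w w'. config n k w \<Longrightarrow> T n k w' = T n k w \<Longrightarrow> X n k w' = X n k w \<Longrightarrow>
      fE n w' = fE n w \<and> fG n w' = fG n w \<and> fX n w' = fX n w \<and> fZ n w' = fZ n w \<and> fS n w' = fS n w"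
  shows "\<exists>K\<ge>0. \<forall>n k w. random_config n k w \<longrightarrow> r n k * log 2 Q \<le> CN (T n k w) + err n + K"
proof (rule condC_config[of T X "\<lambda>_ _ _. 0" "\<lambda>n k w. w mod Q ^ (6 * n + 1)" "\<lambda>n k. Q ^ l n k"])
  show "recursive 3 (\<lambda>xs. T (xs ! 0) (xs ! 1) (xs ! 2))" "recursive 3 (\<lambda>xs. X (xs ! 0) (xs ! 1)
      (xs ! 2))"
    by (fact recursive)+
  show "recursive 3 (\<lambda>xs. 0)" by (rule recursive_const)
  show "recursive 2 (\<lambda>xs. Q ^ l (xs ! 0) (xs ! 1))" by (intro recursive_power recursive_const
      recursive(3))
  show "recursive 3 (\<lambda>xs. xs ! 2 mod Q ^ (6 * (xs ! 0) + 1))" by (intro recursive_intros) simp_all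
  show "X n k w < Q ^ l n k" if "config n k w" for n k w using that by (rule lt)
  show "w' mod Q ^ (6 * n + 1) = w mod Q ^ (6 * n + 1)"
    if "config n k w" "T n k w' = T n k w" "X n k w' = X n k w" for n k w w'
    using det[OF that] by (elim conjE) (rule mod_eq_of_fields)
next
  fix K
  assume K: "\<And>n k w. config n k w \<Longrightarrow>
    condC U (str_of (w mod Q ^ (6 * n + 1))) (str_of 0) \<le>
    condC U (str_of (T n k w)) (str_of 0) + log 2 (real (Q ^ l n k)) + err n + K"
  have "r n k * log 2 Q \<le> CN (T n k w) + err n + (K + 2)" if c: "random_config n k w" for n k w
  proof -
    from c have c': "config n k w" "(6 * real n + 1) * log 2 Q - 2 \<le> CN w"
      by (simp_all only: random_config_def)
    have "w mod Q ^ (6 * n + 1) = w" using c'(1) by (simp only: config_def good_def mod_less)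
    moreover have "log 2 (real (Q ^ l n k)) = real (l n k) * log 2 Q" by (simp add: log_nat_power)
    ultimately have "CN w \<le> CN (T n k w) + real (l n k) * log 2 Q + err n + K"
      using K[OF c'(1)] by (simp only: CN_def plainC_def str_of_0)
    then show ?thesis using c'(2) unfolding r[OF c'(1)] by (simp add: algebra_simps)
  qed
  then show ?thesis by (rule nonneg_constant)
qed

text \<open>A number below \<open>E\<close> that determines the output is a description of it with
  log E bits.\<close>

lemma upper_bound:
  assumes recursive: "recursive 3 (\<lambda>xs. Out (xs ! 0) (xs ! 1) (xs ! 2))" "recursive 3 (\<lambda>xs. X (xs
      ! 0) (xs ! 1) (xs ! 2))"
    "recursive 2 (\<lambda>xs. E (xs ! 0) (xs ! 1))"
    and r: "\<And>n k w. config n k w \<Longrightarrow> log 2 (real (E n k)) = r n k"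
    and lt: "\<And>n k w. config n k w \<Longrightarrow> X n k w < E n k"
    and det: "\<And>n k w w'. config n k w \<Longrightarrow> X n k w' = X n k w \<Longrightarrow> Out n k w' = Out n k w"
  shows "\<exists>K\<ge>0. \<forall>n k w. config n k w \<longrightarrow> CN (Out n k w) \<le> r n k + err n + K"
proof (rule condC_config[of "\<lambda>_ _ _. 0" X "\<lambda>_ _ _. 0" Out E])
  show "recursive 3 (\<lambda>xs. 0)" "recursive 3 (\<lambda>xs. 0)" by (rule recursive_const)+
  show "recursive 3 (\<lambda>xs. X (xs ! 0) (xs ! 1) (xs ! 2))" "recursive 3 (\<lambda>xs. Out (xs ! 0) (xs ! 1)
      (xs ! 2))"
    "recursive 2 (\<lambda>xs. E (xs ! 0) (xs ! 1))" by (fact recursive)+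
  show "X n k w < E n k" if "config n k w" for n k w using that by (rule lt)
  show "Out n k w' = Out n k w" if "config n k w" "X n k w' = X n k w" for n k w w'
    using that by (rule det)
next
  fix K
  assume K: "\<And>n k w. config n k w \<Longrightarrow>
    condC U (str_of (Out n k w)) (str_of 0) \<le>
    condC U (str_of 0) (str_of 0) + log 2 (real (E n k)) + err n + K"
  have "CN (Out n k w) \<le> r n k + err n + (condC U (str_of 0) (str_of 0) + K)"
    if c: "config n k w" for n k w
    using K[OF c] by (simp only: r[OF c] CN_def plainC_def str_of_0)
  then show ?thesis by (rule nonneg_constant)
qed

section \<open>Lower bounds from incompressibility\<close>

text \<open>With \<open>yb\<close>, the hash in \<open>a\<close> gives back \<open>ya\<close>; the
  two points and the slope hash then give the line. The supplement has 2 n + k + 1 digits.\<close>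

lemma lower_a:
  "\<exists>K\<ge>0. \<forall>n k w. random_config n k w \<longrightarrow>
    (4 * real n - real k) * log 2 Q \<le> CN (string_a n k w) + err n + K"
proof (rule lower_bound[where X = "\<lambda>n k w. fZ n w + Q ^ n * (yb n w + Q ^ n * h1 n k w)"
      and l = "\<lambda>n k. n + (n + (k + 1))"])
  fix n k w w' assume "config n k w" "string_a n k w' = string_a n k w"
    "fZ n w' + Q ^ n * (yb n w' + Q ^ n * h1 n k w') = fZ n w + Q ^ n * (yb n w + Q ^ n * h1 n k w)"
  then show "fE n w' = fE n w \<and> fG n w' = fG n w \<and> fX n w' = fX n w \<and> fZ n w' = fZ n w \<and>
      fS n w' = fS n w"
    by (auto simp: strings_eq_iff pack_eq_iff intro: recover_a ya_of_hash)
qed ((intro recursive_comps recursive_strings recursive_tuples; simp) | (intro pack_less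
    field_bounds; assumption?) | simp)+

lemma lower_ab:
  "\<exists>K\<ge>0. \<forall>n k w. random_config n k w \<longrightarrow>
    (6 * real n - real k) * log 2 Q \<le> CN (tuple [string_a n k w, string_b n w]) + err n + K"
proof (rule lower_bound[where X = "\<lambda>n k w. h1 n k w"
      and l = "\<lambda>n k. (k + 1)"])
  fix n k w w' assume "config n k w" "tuple [string_a n k w', string_b n w'] = tuple [string_a n
      k w, string_b n w]"
    "h1 n k w' = h1 n k w"
  then show "fE n w' = fE n w \<and> fG n w' = fG n w \<and> fX n w' = fX n w \<and> fZ n w' = fZ n w \<and>
      fS n w' = fS n w"
    by (auto simp: strings_eq_iff pack_eq_iff intro: recover_a ya_of_hash)
qed ((intro recursive_comps recursive_strings recursive_tuples; simp) | (intro pack_less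
    field_bounds; assumption?) | simp)+

lemma lower_b:
  "\<exists>K\<ge>0. \<forall>n k w. random_config n k w \<longrightarrow>
    (2 * real n) * log 2 Q \<le> CN (string_b n w) + err n + K"
proof (rule lower_bound[where X = "\<lambda>n k w. fX n w + Q ^ n * (fG n w + Q ^ n * fS n w)"
      and l = "\<lambda>n k. n + (n + (2 * n + 1))"])
  fix n k w w' assume "config n k w" "string_b n w' = string_b n w"
    "fX n w' + Q ^ n * (fG n w' + Q ^ n * fS n w') = fX n w + Q ^ n * (fG n w + Q ^ n * fS n w)"
  then show "fE n w' = fE n w \<and> fG n w' = fG n w \<and> fX n w' = fX n w \<and> fZ n w' = fZ n w \<and>
      fS n w' = fS n w"
    by (auto simp: strings_eq_iff pack_eq_iff intro: e_of_yb)
qed ((intro recursive_comps recursive_strings recursive_tuples; simp) | (intro pack_less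
    field_bounds; assumption?) | simp)+

lemma lower_c:
  "\<exists>K\<ge>0. \<forall>n k w. random_config n k w \<longrightarrow>
    (2 * real n) * log 2 Q \<le> CN (string_c n w) + err n + K"
proof (rule lower_bound[where X = "\<lambda>n k w. fX n w + Q ^ n * (fZ n w + Q ^ n * fS n w)"
      and l = "\<lambda>n k. n + (n + (2 * n + 1))"])
  fix n k w w' assume "config n k w" "string_c n w' = string_c n w"
    "fX n w' + Q ^ n * (fZ n w' + Q ^ n * fS n w') = fX n w + Q ^ n * (fZ n w + Q ^ n * fS n w)"
  then show "fE n w' = fE n w \<and> fG n w' = fG n w \<and> fX n w' = fX n w \<and> fZ n w' = fZ n w \<and>
      fS n w' = fS n w"
    by (auto simp: strings_eq_iff pack_eq_iff intro: e_of_c0)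
qed ((intro recursive_comps recursive_strings recursive_tuples; simp) | (intro pack_less
    field_bounds; assumption?) | simp)+

lemma lower_d:
  "\<exists>K\<ge>0. \<forall>n k w. random_config n k w \<longrightarrow>
    (2 * real n) * log 2 Q \<le> CN (string_d n w) + err n + K"
proof (rule lower_bound[where X = "\<lambda>n k w. fX n w + Q ^ n * (fZ n w + Q ^ n * fS n w)"
      and l = "\<lambda>n k. n + (n + (2 * n + 1))"])
  fix n k w w' assume "config n k w" "string_d n w' = string_d n w"
    "fX n w' + Q ^ n * (fZ n w' + Q ^ n * fS n w') = fX n w + Q ^ n * (fZ n w + Q ^ n * fS n w)"
  then show "fE n w' = fE n w \<and> fG n w' = fG n w \<and> fX n w' = fX n w \<and> fZ n w' = fZ n w \<and>
      fS n w' = fS n w"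
    by (auto simp: strings_eq_iff pack_eq_iff intro: g_of_d1)
qed ((intro recursive_comps recursive_strings recursive_tuples; simp) | (intro pack_less
    field_bounds; assumption?) | simp)+

lemma lower_ac:
  "\<exists>K\<ge>0. \<forall>n k w. random_config n k w \<longrightarrow>
    (5 * real n + 1) * log 2 Q \<le> CN (tuple [string_a n k w, string_c n w]) + err n + K"
proof (rule lower_bound[where X = "\<lambda>n k w. fZ n w"
      and l = "\<lambda>n k. n"])
  fix n k w w' assume "config n k w" "tuple [string_a n k w', string_c n w'] = tuple [string_a n
      k w, string_c n w]"
    "fZ n w' = fZ n w"
  then show "fE n w' = fE n w \<and> fG n w' = fG n w \<and> fX n w' = fX n w \<and> fZ n w' = fZ n w \<and>
      fS n w' = fS n w"
    by (auto simp: strings_eq_iff pack_eq_iff intro: e_of_c0)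
qed ((intro recursive_comps recursive_strings recursive_tuples; simp) | (intro pack_less
    field_bounds; assumption?) | simp)+

lemma lower_bc:
  "\<exists>K\<ge>0. \<forall>n k w. random_config n k w \<longrightarrow>
    (3 * real n) * log 2 Q \<le> CN (tuple [string_b n w, string_c n w]) + err n + K"
proof (rule lower_bound[where X = "\<lambda>n k w. fX n w + Q ^ n * fS n w"
      and l = "\<lambda>n k. n + (2 * n + 1)"])
  fix n k w w' assume "config n k w" "tuple [string_b n w', string_c n w'] = tuple [string_b n w,
      string_c n w]"
    "fX n w' + Q ^ n * fS n w' = fX n w + Q ^ n * fS n w"
  then show "fE n w' = fE n w \<and> fG n w' = fG n w \<and> fX n w' = fX n w \<and> fZ n w' = fZ n w \<and>
      fS n w' = fS n w"
    by (auto simp: strings_eq_iff pack_eq_iff intro: e_of_c0)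
qed ((intro recursive_comps recursive_strings recursive_tuples; simp) | (intro pack_less
    field_bounds; assumption?) | simp)+

lemma lower_abc:
  "\<exists>K\<ge>0. \<forall>n k w. random_config n k w \<longrightarrow>
    (6 * real n + 1) * log 2 Q \<le> CN (tuple [string_a n k w, string_b n w, string_c n w]) + err n
        + K"
proof (rule lower_bound[where X = "\<lambda>n k w. 0"
      and l = "\<lambda>n k. 0"])
  fix n k w w' assume "config n k w" "tuple [string_a n k w', string_b n w', string_c n w'] =
      tuple [string_a n k w, string_b n w, string_c n w]"
    "0 = 0"
  then show "fE n w' = fE n w \<and> fG n w' = fG n w \<and> fX n w' = fX n w \<and> fZ n w' = fZ n w \<and>
      fS n w' = fS n w"
    by (auto simp: strings_eq_iff pack_eq_iff intro: e_of_c0)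
qed ((intro recursive_comps recursive_strings recursive_tuples; simp) | (intro pack_less
    field_bounds; assumption?) | simp)+

lemma lower_cda:
  "\<exists>K\<ge>0. \<forall>n k w. random_config n k w \<longrightarrow>
    (6 * real n + 1) * log 2 Q \<le> CN (tuple [string_c n w, string_d n w, string_a n k w]) + err n
        + K"
proof (rule lower_bound[where X = "\<lambda>n k w. 0"
      and l = "\<lambda>n k. 0"])
  fix n k w w' assume "config n k w" "tuple [string_c n w', string_d n w', string_a n k w'] =
      tuple [string_c n w, string_d n w, string_a n k w]"
    "0 = 0"
  then show "fE n w' = fE n w \<and> fG n w' = fG n w \<and> fX n w' = fX n w \<and> fZ n w' = fZ n w \<and>
      fS n w' = fS n w"
    by (auto simp: strings_eq_iff pack_eq_iff intro: z_of_d1)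
qed ((intro recursive_comps recursive_strings recursive_tuples; simp) | (intro pack_less
    field_bounds; assumption?) | simp)+

lemma lower_cdb:
  "\<exists>K\<ge>0. \<forall>n k w. random_config n k w \<longrightarrow>
    (4 * real n) * log 2 Q \<le> CN (tuple [string_c n w, string_d n w, string_b n w]) + err n + K"
proof (rule lower_bound[where X = "\<lambda>n k w. fS n w"
      and l = "\<lambda>n k. (2 * n + 1)"])
  fix n k w w' assume "config n k w" "tuple [string_c n w', string_d n w', string_b n w'] = tuple
      [string_c n w, string_d n w, string_b n w]"
    "fS n w' = fS n w"
  then show "fE n w' = fE n w \<and> fG n w' = fG n w \<and> fX n w' = fX n w \<and> fZ n w' = fZ n w \<and>
      fS n w' = fS n w"
    by (auto simp: strings_eq_iff pack_eq_iff intro: x_of_d1)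
qed ((intro recursive_comps recursive_strings recursive_tuples; simp) | (intro pack_less
    field_bounds; assumption?) | simp)+

lemma lower_a2:
  "\<exists>K\<ge>0. \<forall>n k w. random_config n k w \<longrightarrow>
    (4 * real n + 1) * log 2 Q \<le> CN (string_a2 n k w) + err n + K"
proof (rule lower_bound[where X = "\<lambda>n k w. fZ n w + Q ^ n * fG n w"
      and l = "\<lambda>n k. n + n"])
  fix n k w w' assume "config n k w" "string_a2 n k w' = string_a2 n k w"
    "fZ n w' + Q ^ n * fG n w' = fZ n w + Q ^ n * fG n w"
  then show "fE n w' = fE n w \<and> fG n w' = fG n w \<and> fX n w' = fX n w \<and> fZ n w' = fZ n w \<and>
      fS n w' = fS n w"
    by (auto simp: strings_eq_iff pack_eq_iff intro: e_of_ya)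
qed ((intro recursive_comps recursive_strings recursive_tuples; simp) | (intro pack_less
    field_bounds; assumption?) | simp)+

lemma lower_a2c:
  "\<exists>K\<ge>0. \<forall>n k w. random_config n k w \<longrightarrow>
    (5 * real n + 1) * log 2 Q \<le> CN (tuple [string_a2 n k w, string_c n w]) + err n + K"
proof (rule lower_bound[where X = "\<lambda>n k w. fZ n w"
      and l = "\<lambda>n k. n"])
  fix n k w w' assume "config n k w" "tuple [string_a2 n k w', string_c n w'] = tuple [string_a2
      n k w, string_c n w]"
    "fZ n w' = fZ n w"
  then show "fE n w' = fE n w \<and> fG n w' = fG n w \<and> fX n w' = fX n w \<and> fZ n w' = fZ n w \<and>
      fS n w' = fS n w"
    by (auto simp: strings_eq_iff pack_eq_iff intro: e_of_c0)
qed ((intro recursive_comps recursive_strings recursive_tuples; simp) | (intro pack_less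
    field_bounds; assumption?) | simp)+

lemma lower_a2bc:
  "\<exists>K\<ge>0. \<forall>n k w. random_config n k w \<longrightarrow>
    (6 * real n + 1) * log 2 Q \<le> CN (tuple [string_a2 n k w, string_b n w, string_c n w]) + err n
        + K"
proof (rule lower_bound[where X = "\<lambda>n k w. 0"
      and l = "\<lambda>n k. 0"])
  fix n k w w' assume "config n k w" "tuple [string_a2 n k w', string_b n w', string_c n w'] =
      tuple [string_a2 n k w, string_b n w, string_c n w]"
    "0 = 0"
  then show "fE n w' = fE n w \<and> fG n w' = fG n w \<and> fX n w' = fX n w \<and> fZ n w' = fZ n w \<and>
      fS n w' = fS n w"
    by (auto simp: strings_eq_iff pack_eq_iff intro: e_of_c0)
qed ((intro recursive_comps recursive_strings recursive_tuples; simp) | (intro pack_less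
    field_bounds; assumption?) | simp)+

lemma lower_cda2:
  "\<exists>K\<ge>0. \<forall>n k w. random_config n k w \<longrightarrow>
    (6 * real n + 1) * log 2 Q \<le> CN (tuple [string_c n w, string_d n w, string_a2 n k w]) + err n
        + K"
proof (rule lower_bound[where X = "\<lambda>n k w. 0"
      and l = "\<lambda>n k. 0"])
  fix n k w w' assume "config n k w" "tuple [string_c n w', string_d n w', string_a2 n k w'] =
      tuple [string_c n w, string_d n w, string_a2 n k w]"
    "0 = 0"
  then show "fE n w' = fE n w \<and> fG n w' = fG n w \<and> fX n w' = fX n w \<and> fZ n w' = fZ n w \<and>
      fS n w' = fS n w"
    by (auto simp: strings_eq_iff pack_eq_iff intro: z_of_d1)
qed ((intro recursive_comps recursive_strings recursive_tuples; simp) | (intro pack_less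
    field_bounds; assumption?) | simp)+

text \<open>In contrast to \<open>lower_ab\<close>, the slope hash is part of the first string, so
  nothing has to be supplied.\<close>

lemma lower_a2b:
  "\<exists>K\<ge>0. \<forall>n k w. random_config n k w \<longrightarrow>
    (6 * real n + 1) * log 2 Q \<le> CN (tuple [string_a2 n k w, string_b n w]) + err n + K"
proof (rule lower_bound[where X = "\<lambda>n k w. 0"
      and l = "\<lambda>n k. 0"])
  fix n k w w' assume "config n k w" "tuple [string_a2 n k w', string_b n w'] = tuple [string_a2
      n k w, string_b n w]"
    "0 = 0"
  then show "fE n w' = fE n w \<and> fG n w' = fG n w \<and> fX n w' = fX n w \<and> fZ n w' = fZ n w \<and>
      fS n w' = fS n w"
    by (auto simp: strings_eq_iff pack_eq_iff intro: recover_a)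
qed ((intro recursive_comps recursive_strings recursive_tuples; simp) | (intro pack_less
    field_bounds; assumption?) | simp)+

section \<open>Upper bounds from explicit descriptions\<close>

lemma upper_a:
  "\<exists>K\<ge>0. \<forall>n k w. config n k w \<longrightarrow>
    CN (string_a n k w) \<le> (4 * real n - real k + 2) * log 2 Q + err n + K"
proof (rule upper_bound[where X = "\<lambda>n k w. string_a n k w" and E = "\<lambda>n k. Q ^ (n + ((2 * n + 1) +
    (n + 1 - k)))"])
  fix n k w w' assume "config n k w" "string_a n k w' = string_a n k w"
  then show "string_a n k w' = string_a n k w"
    by (auto simp: strings_eq_iff pack_eq_iff)
next
  fix n k w assume "config n k w"
  from config_le(1)[OF this] show "log 2 (real (Q ^ (n + ((2 * n + 1) + (n + 1 - k))))) = (4 *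
      real n - real k + 2) * log 2 Q"
    by (subst log_Q_power) simp
qed ((intro recursive_comps recursive_strings recursive_tuples; simp) | (intro pack_less
    strings_less field_bounds; assumption?))+

lemma upper_b:
  "\<exists>K\<ge>0. \<forall>n k w. config n k w \<longrightarrow>
    CN (string_b n w) \<le> (2 * real n) * log 2 Q + err n + K"
proof (rule upper_bound[where X = "\<lambda>n k w. string_b n w" and E = "\<lambda>n k. Q ^ (n + n)"])
  fix n k w w' assume "config n k w" "string_b n w' = string_b n w"
  then show "string_b n w' = string_b n w"
    by (auto simp: strings_eq_iff pack_eq_iff)
next
  fix n k w assume "config n k w"
  from config_le(1)[OF this] show "log 2 (real (Q ^ (n + n))) = (2 * real n) * log 2 Q"
    by (subst log_Q_power) simp
qed ((intro recursive_comps recursive_strings recursive_tuples; simp) | (intro pack_less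
    strings_less field_bounds; assumption?))+

lemma upper_c:
  "\<exists>K\<ge>0. \<forall>n k w. config n k w \<longrightarrow>
    CN (string_c n w) \<le> (2 * real n) * log 2 Q + err n + K"
proof (rule upper_bound[where X = "\<lambda>n k w. string_c n w" and E = "\<lambda>n k. Q ^ (n + n)"])
  fix n k w w' assume "config n k w" "string_c n w' = string_c n w"
  then show "string_c n w' = string_c n w"
    by (auto simp: strings_eq_iff pack_eq_iff)
next
  fix n k w assume "config n k w"
  from config_le(1)[OF this] show "log 2 (real (Q ^ (n + n))) = (2 * real n) * log 2 Q"
    by (subst log_Q_power) simp
qed ((intro recursive_comps recursive_strings recursive_tuples; simp) | (intro pack_less
    strings_less field_bounds; assumption?))+

lemma upper_ab:
  "\<exists>K\<ge>0. \<forall>n k w. config n k w \<longrightarrow>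
    CN (tuple [string_a n k w, string_b n w]) \<le> (6 * real n - real k + 2) * log 2 Q + err n + K"
proof (rule upper_bound[where X = "\<lambda>n k w. string_b n w + Q ^ (n + n) * string_a n k w" and E =
    "\<lambda>n k. Q ^ ((n + n) + (n + ((2 * n + 1) + (n + 1 - k))))"])
  fix n k w w' assume "config n k w" "string_b n w' + Q ^ (n + n) * string_a n k w' = string_b n
      w + Q ^ (n + n) * string_a n k w"
  then show "tuple [string_a n k w', string_b n w'] = tuple [string_a n k w, string_b n w]"
    by (auto simp: strings_eq_iff pack_eq_iff strings_less)
next
  fix n k w assume "config n k w"
  from config_le(1)[OF this] show "log 2 (real (Q ^ ((n + n) + (n + ((2 * n + 1) + (n + 1 -
      k)))))) = (6 * real n - real k + 2) * log 2 Q"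
    by (subst log_Q_power) simp
qed ((intro recursive_comps recursive_strings recursive_tuples; simp) | (intro pack_less
    strings_less field_bounds; assumption?))+

text \<open>On a known line a point is given by its abscissa, so beyond the abscissa and the seed
  the hash value comes for free.\<close>

lemma upper_ac:
  "\<exists>K\<ge>0. \<forall>n k w. config n k w \<longrightarrow>
    CN (tuple [string_a n k w, string_c n w]) \<le> (5 * real n + 1) * log 2 Q + err n + K"
proof (rule upper_bound[where X = "\<lambda>n k w. c0 n w + Q ^ n * (fG n w + Q ^ n * (fX n w + Q ^ n *
    fS n w))" and E = "\<lambda>n k. Q ^ (n + (n + (n + (2 * n + 1))))"])
  fix n k w w' assume "config n k w" "c0 n w' + Q ^ n * (fG n w' + Q ^ n * (fX n w' + Q ^ n * fS
      n w')) = c0 n w + Q ^ n * (fG n w + Q ^ n * (fX n w + Q ^ n * fS n w))"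
  then show "tuple [string_a n k w', string_c n w'] = tuple [string_a n k w, string_c n w]"
    by (auto simp: strings_eq_iff pack_eq_iff intro: h2_eq ya_of_line)
next
  fix n k w assume "config n k w"
  from config_le(1)[OF this] show "log 2 (real (Q ^ (n + (n + (n + (2 * n + 1)))))) = (5 * real n
      + 1) * log 2 Q"
    by (subst log_Q_power) simp
qed ((intro recursive_comps recursive_strings recursive_tuples; simp) | (intro pack_less
    strings_less field_bounds; assumption?))+

lemma upper_ca:
  "\<exists>K\<ge>0. \<forall>n k w. config n k w \<longrightarrow>
    CN (tuple [string_c n w, string_a n k w]) \<le> (5 * real n + 1) * log 2 Q + err n + K"
proof (rule upper_bound[where X = "\<lambda>n k w. c0 n w + Q ^ n * (fG n w + Q ^ n * (fX n w + Q ^ n *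
    fS n w))" and E = "\<lambda>n k. Q ^ (n + (n + (n + (2 * n + 1))))"])
  fix n k w w' assume "config n k w" "c0 n w' + Q ^ n * (fG n w' + Q ^ n * (fX n w' + Q ^ n * fS
      n w')) = c0 n w + Q ^ n * (fG n w + Q ^ n * (fX n w + Q ^ n * fS n w))"
  then show "tuple [string_c n w', string_a n k w'] = tuple [string_c n w, string_a n k w]"
    by (auto simp: strings_eq_iff pack_eq_iff intro: h2_eq ya_of_line)
next
  fix n k w assume "config n k w"
  from config_le(1)[OF this] show "log 2 (real (Q ^ (n + (n + (n + (2 * n + 1)))))) = (5 * real n
      + 1) * log 2 Q"
    by (subst log_Q_power) simp
qed ((intro recursive_comps recursive_strings recursive_tuples; simp) | (intro pack_less
    strings_less field_bounds; assumption?))+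

lemma upper_bc:
  "\<exists>K\<ge>0. \<forall>n k w. config n k w \<longrightarrow>
    CN (tuple [string_b n w, string_c n w]) \<le> (3 * real n) * log 2 Q + err n + K"
proof (rule upper_bound[where X = "\<lambda>n k w. c0 n w + Q ^ n * (fG n w + Q ^ n * fZ n w)" and E =
    "\<lambda>n k. Q ^ (n + (n + n))"])
  fix n k w w' assume "config n k w" "c0 n w' + Q ^ n * (fG n w' + Q ^ n * fZ n w') = c0 n w + Q
      ^ n * (fG n w + Q ^ n * fZ n w)"
  then show "tuple [string_b n w', string_c n w'] = tuple [string_b n w, string_c n w]"
    by (auto simp: strings_eq_iff pack_eq_iff intro: yb_of_line)
next
  fix n k w assume "config n k w"
  from config_le(1)[OF this] show "log 2 (real (Q ^ (n + (n + n)))) = (3 * real n) * log 2 Q"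
    by (subst log_Q_power) simp
qed ((intro recursive_comps recursive_strings recursive_tuples; simp) | (intro pack_less
    strings_less field_bounds; assumption?))+

lemma upper_abc:
  "\<exists>K\<ge>0. \<forall>n k w. config n k w \<longrightarrow>
    CN (tuple [string_a n k w, string_b n w, string_c n w]) \<le> (6 * real n + 1) * log 2 Q + err n
        + K"
proof (rule upper_bound[where X = "\<lambda>n k w. w" and E = "\<lambda>n k. Q ^ (6 * n + 1)"])
  fix n k w w' assume "config n k w" "w' = w"
  then show "tuple [string_a n k w', string_b n w', string_c n w'] = tuple [string_a n k w,
      string_b n w, string_c n w]"
    by (auto simp: strings_eq_iff pack_eq_iff)
next
  fix n k w assume "config n k w"
  from config_le(1)[OF this] show "log 2 (real (Q ^ (6 * n + 1))) = (6 * real n + 1) * log 2 Q"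
    by (subst log_Q_power) simp
qed ((intro recursive_comps recursive_strings recursive_tuples; simp) | (erule config_less))+

lemma upper_da:
  "\<exists>K\<ge>0. \<forall>n k w. config n k w \<longrightarrow>
    CN (tuple [string_d n w, string_a n k w]) \<le> (5 * real n + 1) * log 2 Q + err n + K"
proof (rule upper_bound[where X = "\<lambda>n k w. fE n w + Q ^ n * (d1 n w + Q ^ n * (fX n w + Q ^ n *
    fS n w))" and E = "\<lambda>n k. Q ^ (n + (n + (n + (2 * n + 1))))"])
  fix n k w w' assume "config n k w" "fE n w' + Q ^ n * (d1 n w' + Q ^ n * (fX n w' + Q ^ n * fS
      n w')) = fE n w + Q ^ n * (d1 n w + Q ^ n * (fX n w + Q ^ n * fS n w))"
  then show "tuple [string_d n w', string_a n k w'] = tuple [string_d n w, string_a n k w]"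
    by (auto simp: strings_eq_iff pack_eq_iff intro: h2_eq ya_of_parabola)
next
  fix n k w assume "config n k w"
  from config_le(1)[OF this] show "log 2 (real (Q ^ (n + (n + (n + (2 * n + 1)))))) = (5 * real n
      + 1) * log 2 Q"
    by (subst log_Q_power) simp
qed ((intro recursive_comps recursive_strings recursive_tuples; simp) | (intro pack_less
    strings_less field_bounds; assumption?))+

lemma upper_db:
  "\<exists>K\<ge>0. \<forall>n k w. config n k w \<longrightarrow>
    CN (tuple [string_d n w, string_b n w]) \<le> (3 * real n) * log 2 Q + err n + K"
proof (rule upper_bound[where X = "\<lambda>n k w. fE n w + Q ^ n * (d1 n w + Q ^ n * fZ n w)" and E =
    "\<lambda>n k. Q ^ (n + (n + n))"])
  fix n k w w' assume "config n k w" "fE n w' + Q ^ n * (d1 n w' + Q ^ n * fZ n w') = fE n w + Q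
      ^ n * (d1 n w + Q ^ n * fZ n w)"
  then show "tuple [string_d n w', string_b n w'] = tuple [string_d n w, string_b n w]"
    by (auto simp: strings_eq_iff pack_eq_iff intro: yb_of_parabola)
next
  fix n k w assume "config n k w"
  from config_le(1)[OF this] show "log 2 (real (Q ^ (n + (n + n)))) = (3 * real n) * log 2 Q"
    by (subst log_Q_power) simp
qed ((intro recursive_comps recursive_strings recursive_tuples; simp) | (intro pack_less
    strings_less field_bounds; assumption?))+

lemma upper_cb:
  "\<exists>K\<ge>0. \<forall>n k w. config n k w \<longrightarrow>
    CN (tuple [string_c n w, string_b n w]) \<le> (3 * real n) * log 2 Q + err n + K"
proof (rule upper_bound[where X = "\<lambda>n k w. c0 n w + Q ^ n * (fG n w + Q ^ n * fZ n w)" and E =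
    "\<lambda>n k. Q ^ (n + (n + n))"])
  fix n k w w' assume "config n k w" "c0 n w' + Q ^ n * (fG n w' + Q ^ n * fZ n w') = c0 n w + Q
      ^ n * (fG n w + Q ^ n * fZ n w)"
  then show "tuple [string_c n w', string_b n w'] = tuple [string_c n w, string_b n w]"
    by (auto simp: strings_eq_iff pack_eq_iff intro: yb_of_line)
next
  fix n k w assume "config n k w"
  from config_le(1)[OF this] show "log 2 (real (Q ^ (n + (n + n)))) = (3 * real n) * log 2 Q"
    by (subst log_Q_power) simp
qed ((intro recursive_comps recursive_strings recursive_tuples; simp) | (intro pack_less
    strings_less field_bounds; assumption?))+

text \<open>Besides the line, one base-\<open>Q\<close> digit for the sum and 6 bits for the
  distance are spent per place. Described separately, c and d take 4 log Q per place, which leaves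
  log Q - 6 as shared information.\<close>

lemma upper_cd:
  "\<exists>K\<ge>0. \<forall>n k w. config n k w \<longrightarrow>
    CN (tuple [string_c n w, string_d n w]) \<le> 3 * real n * log 2 Q + 6 * real n + err n + K"
proof (rule upper_bound[where X = "\<lambda>n k w. c0 n w + Q ^ n * (fG n w + Q ^ n * (xzsum n w + Q ^ n
    * xzdist n w))" and E = "\<lambda>n k. Q ^ n * (Q ^ n * (Q ^ n * 64 ^ n))"])
  fix n k w w' assume "config n k w" "c0 n w' + Q ^ n * (fG n w' + Q ^ n * (xzsum n w' + Q ^ n *
      xzdist n w')) = c0 n w + Q ^ n * (fG n w + Q ^ n * (xzsum n w + Q ^ n * xzdist n w))"
  then show "tuple [string_c n w', string_d n w'] = tuple [string_c n w, string_d n w]"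
    by (auto simp: strings_eq_iff pack_eq_iff intro: parabola_of_unordered)
next
  fix n k w assume "config n k w"
  show "log 2 (real (Q ^ n * (Q ^ n * (Q ^ n * 64 ^ n)))) = 3 * real n * log 2 Q + 6 * real n"
    by (rule log_cd)
qed ((intro recursive_comps recursive_strings recursive_tuples; simp) | (intro add_mult_less
    field_bounds))+

lemma upper_a2:
  "\<exists>K\<ge>0. \<forall>n k w. config n k w \<longrightarrow>
    CN (string_a2 n k w) \<le> (4 * real n + real k + 2) * log 2 Q + err n + K"
proof (rule upper_bound[where X = "\<lambda>n k w. string_a2 n k w" and E = "\<lambda>n k. Q ^ (n + (n + ((2 * n
    + 1) + (k + 1))))"])
  fix n k w w' assume "config n k w" "string_a2 n k w' = string_a2 n k w"
  then show "string_a2 n k w' = string_a2 n k w"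
    by (auto simp: strings_eq_iff pack_eq_iff)
next
  fix n k w assume "config n k w"
  from config_le(1)[OF this] show "log 2 (real (Q ^ (n + (n + ((2 * n + 1) + (k + 1)))))) = (4 *
      real n + real k + 2) * log 2 Q"
    by (subst log_Q_power) simp
qed ((intro recursive_comps recursive_strings recursive_tuples; simp) | (intro pack_less
    strings_less field_bounds; assumption?))+

lemma upper_a2c:
  "\<exists>K\<ge>0. \<forall>n k w. config n k w \<longrightarrow>
    CN (tuple [string_a2 n k w, string_c n w]) \<le> (5 * real n + 1) * log 2 Q + err n + K"
proof (rule upper_bound[where X = "\<lambda>n k w. c0 n w + Q ^ n * (fG n w + Q ^ n * (fX n w + Q ^ n *
    fS n w))" and E = "\<lambda>n k. Q ^ (n + (n + (n + (2 * n + 1))))"])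
  fix n k w w' assume "config n k w" "c0 n w' + Q ^ n * (fG n w' + Q ^ n * (fX n w' + Q ^ n * fS
      n w')) = c0 n w + Q ^ n * (fG n w + Q ^ n * (fX n w + Q ^ n * fS n w))"
  then show "tuple [string_a2 n k w', string_c n w'] = tuple [string_a2 n k w, string_c n w]"
    by (auto simp: strings_eq_iff pack_eq_iff intro: h1_eq ya_of_line)
next
  fix n k w assume "config n k w"
  from config_le(1)[OF this] show "log 2 (real (Q ^ (n + (n + (n + (2 * n + 1)))))) = (5 * real n
      + 1) * log 2 Q"
    by (subst log_Q_power) simp
qed ((intro recursive_comps recursive_strings recursive_tuples; simp) | (intro pack_less
    strings_less field_bounds; assumption?))+

lemma upper_ca2:
  "\<exists>K\<ge>0. \<forall>n k w. config n k w \<longrightarrow>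
    CN (tuple [string_c n w, string_a2 n k w]) \<le> (5 * real n + 1) * log 2 Q + err n + K"
proof (rule upper_bound[where X = "\<lambda>n k w. c0 n w + Q ^ n * (fG n w + Q ^ n * (fX n w + Q ^ n *
    fS n w))" and E = "\<lambda>n k. Q ^ (n + (n + (n + (2 * n + 1))))"])
  fix n k w w' assume "config n k w" "c0 n w' + Q ^ n * (fG n w' + Q ^ n * (fX n w' + Q ^ n * fS
      n w')) = c0 n w + Q ^ n * (fG n w + Q ^ n * (fX n w + Q ^ n * fS n w))"
  then show "tuple [string_c n w', string_a2 n k w'] = tuple [string_c n w, string_a2 n k w]"
    by (auto simp: strings_eq_iff pack_eq_iff intro: h1_eq ya_of_line)
next
  fix n k w assume "config n k w"
  from config_le(1)[OF this] show "log 2 (real (Q ^ (n + (n + (n + (2 * n + 1)))))) = (5 * real n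
      + 1) * log 2 Q"
    by (subst log_Q_power) simp
qed ((intro recursive_comps recursive_strings recursive_tuples; simp) | (intro pack_less
    strings_less field_bounds; assumption?))+

lemma upper_a2bc:
  "\<exists>K\<ge>0. \<forall>n k w. config n k w \<longrightarrow>
    CN (tuple [string_a2 n k w, string_b n w, string_c n w]) \<le> (6 * real n + 1) * log 2 Q + err n
        + K"
proof (rule upper_bound[where X = "\<lambda>n k w. w" and E = "\<lambda>n k. Q ^ (6 * n + 1)"])
  fix n k w w' assume "config n k w" "w' = w"
  then show "tuple [string_a2 n k w', string_b n w', string_c n w'] = tuple [string_a2 n k w,
      string_b n w, string_c n w]"
    by (auto simp: strings_eq_iff pack_eq_iff)
next
  fix n k w assume "config n k w"
  from config_le(1)[OF this] show "log 2 (real (Q ^ (6 * n + 1))) = (6 * real n + 1) * log 2 Q"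
    by (subst log_Q_power) simp
qed ((intro recursive_comps recursive_strings recursive_tuples; simp) | (erule config_less))+

text \<open>Parabola and abscissa give the ordinate of a but, without z, not the slope. The k + 1
  digits of the slope hash must be paid for.\<close>

lemma upper_da2:
  "\<exists>K\<ge>0. \<forall>n k w. config n k w \<longrightarrow>
    CN (tuple [string_d n w, string_a2 n k w]) \<le> (5 * real n + real k + 2) * log 2 Q + err n + K"
proof (rule upper_bound[where X = "\<lambda>n k w. fE n w + Q ^ n * (d1 n w + Q ^ n * (fX n w + Q ^ n *
    (fS n w + Q ^ (2 * n + 1) * h1 n k w)))" and E = "\<lambda>n k. Q ^ (n + (n + (n + ((2 * n + 1) + (k
    + 1)))))"])
  fix n k w w' assume "config n k w" "fE n w' + Q ^ n * (d1 n w' + Q ^ n * (fX n w' + Q ^ n * (fS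
      n w' + Q ^ (2 * n + 1) * h1 n k w'))) = fE n w + Q ^ n * (d1 n w + Q ^ n * (fX n w + Q ^ n
      * (fS n w + Q ^ (2 * n + 1) * h1 n k w)))"
  then show "tuple [string_d n w', string_a2 n k w'] = tuple [string_d n w, string_a2 n k w]"
    by (auto simp: strings_eq_iff pack_eq_iff intro: h1_eq ya_of_parabola)
next
  fix n k w assume "config n k w"
  from config_le(1)[OF this] show "log 2 (real (Q ^ (n + (n + (n + ((2 * n + 1) + (k + 1))))))) =
      (5 * real n + real k + 2) * log 2 Q"
    by (subst log_Q_power) simp
qed ((intro recursive_comps recursive_strings recursive_tuples; simp) | (intro pack_less
    strings_less field_bounds; assumption?))+

text \<open>The two points fix the slope off the coincidences and the appended hash fixes it there,
  so the decoder needs only n and k.\<close>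

lemma condC_line:
  "\<exists>K\<ge>0. \<forall>n k w. config n k w \<longrightarrow>
    condC U (str_of (string_c n w)) (str_of (tuple [string_a2 n k w, string_b n w])) \<le> err n + K"
proof (rule condC_config[of "\<lambda>_ _ _. 0" "\<lambda>_ _ _. 0" "\<lambda>n k w. tuple [string_a2 n k w, string_b n w]"
      "\<lambda>n k w. string_c n w" "\<lambda>_ _. 1"])
  fix n k w w'
  assume c: "config n k w" and "tuple [string_a2 n k w', string_b n w'] = tuple [string_a2 n k w,
      string_b n w]"
  then have eq: "fX n w' = fX n w" "fZ n w' = fZ n w" "fS n w' = fS n w" "ya n w' = ya n w"
    "yb n w' = yb n w" "h1 n k w' = h1 n k w"
    by (simp_all add: strings_eq_iff)
  from recover_a[OF c eq] eq(1,2) show "string_c n w' = string_c n w" by (simp only: string_c_def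
      c0_def)
next
  fix K
  assume K: "\<And>n k w. config n k w \<Longrightarrow>
    condC U (str_of (string_c n w)) (str_of (tuple [string_a2 n k w, string_b n w])) \<le>
    condC U (str_of 0) (str_of (tuple [string_a2 n k w, string_b n w])) + log 2 (real 1) + err n
        + K"
  obtain K' :: nat where "\<And>x y. condC U x y \<le> real (length x) + K'"
    using condC_length_bound[OF univ] by metis
  from this[of "[]"] have K': "condC U (str_of 0) y \<le> K'" for y by simp
  have "condC U (str_of (string_c n w)) (str_of (tuple [string_a2 n k w, string_b n w])) \<le> err n
      + (K' + K)"
    if "config n k w" for n k w
    using K[OF that] K'[of "str_of (tuple [string_a2 n k w, string_b n w])"] by simp
  then show ?thesis by (rule nonneg_constant)
qed ((intro recursive_comps recursive_strings recursive_tuples; simp) | simp)+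

section \<open>Asymptotics\<close>

lemma length_le:
  assumes "N < Q ^ l" shows "real (length (str_of N)) \<le> real l * log 2 Q"
proof -
  have "real (N + 1) \<le> real (Q ^ l)" using assms by (simp only: of_nat_le_iff)
  then have "log 2 (real N + 1) \<le> log 2 (real (Q ^ l))" by (intro log_mono) simp_all
  also have "\<dots> = real l * log 2 Q" by (rule log_Q_power)
  finally show ?thesis using length_str_of_le[of N] by linarith
qed

lemma err_le: assumes "2 \<le> n" shows "err n \<le> 8 / ln 2 * ln (real n)" "0 \<le> err n"
proof -
  have "triangle (n + n) = n * (2 * n + 1)"
    by (simp add: triangle_def mult_2[symmetric])
  then have p: "prod_encode (n, n) + 1 = 2 * n * n + 2 * n + 1"
    by (simp add: prod_encode_def algebra_simps)
  have n2: "2 * 2 \<le> n * n" "2 * n \<le> n * n" using assms by (intro mult_le_mono; simp)+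
  then have "4 * (n * n) \<le> (n * n) * (n * n)" by (intro mult_le_mono) simp_all
  \<comment> \<open>This is 2 n^2 + 2 n + 1 \<le> n^4 for n \<ge> 2; the exponent 4 and the factor 2
    in \<open>err\<close> give the constant 8.\<close>
  then have "prod_encode (n, n) + 1 \<le> n ^ 4"
  proof -
    have "n ^ 4 = (n * n) * (n * n)" by (simp add: power4_eq_xxxx)
    then show ?thesis unfolding p mult.assoc[of 2 n n] using n2 \<open>4 * (n * n) \<le> _\<close> by linarith
  qed
  then have "real (prod_encode (n, n) + 1) \<le> real (n ^ 4)" by (simp only: of_nat_le_iff)
  then have "log 2 (real (prod_encode (n, n)) + 1) \<le> log 2 (real n ^ 4)"
    using assms by (intro log_mono) simp_all
  also have "\<dots> = 4 * log 2 (real n)" using assms by (simp add: log_nat_power)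
  finally show "err n \<le> 8 / ln 2 * ln (real n)" by (simp add: err_def log_def)
  show "0 \<le> err n" by (simp add: err_def)
qed

lemma ln_ge: "2 \<le> n \<Longrightarrow> ln 2 \<le> ln (real n)"
  by (intro ln_mono) auto

lemma bigo_ln_of_err:
  assumes "\<And>n. 0 < n \<Longrightarrow> \<bar>f n\<bar> \<le> C * err n + K" "0 \<le> C" "0 \<le> K"
  shows "f \<in> O(\<lambda>n. ln (real n))"
proof (rule bigoI)
  show "\<forall>\<^sub>F n in sequentially. norm (f n) \<le> (C * (8 / ln 2) + K / ln 2) * norm (ln (real n))"
    using eventually_ge_at_top[of 2]
  proof eventually_elim
    case (elim n)
    have "\<bar>f n\<bar> \<le> C * err n + K" using elim by (intro assms) simp
    also have "C * err n \<le> C * (8 / ln 2 * ln (real n))"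
      using err_le(1)[OF elim] assms(2) by (intro mult_left_mono)
    also have "K \<le> K / ln 2 * ln (real n)"
      using ln_ge[OF elim] assms(3) mult_left_mono[of "ln 2" "ln (real n)" "K / ln 2"] by simp
    finally show ?case using elim by (simp add: algebra_simps)
  qed
qed

text \<open>Half of the slope absorbs the logarithmic error for large n.\<close>

lemma linear_of_err:
  assumes f: "\<And>n. 0 < n \<Longrightarrow> c * real n \<le> f n + C * err n + K" and "0 < c" "0 \<le> C" "0 \<le> K"
  shows "\<forall>\<^sub>F n in sequentially. c / 2 * real n \<le> f n"
proof -
  \<comment> \<open>The summand 1 keeps \<open>D\<close> positive when \<open>C\<close> and
    \<open>K\<close> vanish.\<close>
  define D where "D = C * (8 / ln 2) + K / ln 2 + 1"
  have D: "0 < D" unfolding D_def using assms by (intro add_nonneg_pos add_nonneg_nonneg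
      mult_nonneg_nonneg divide_nonneg_nonneg) auto
  have "\<forall>\<^sub>F n in sequentially. ln (real n) / real n < c / (2 * D)"
    using filterlim_compose[OF ln_x_over_x_tendsto_0 filterlim_real_sequentially] D assms(2)
    by (intro order_tendstoD(2)) auto
  then show ?thesis
    using eventually_ge_at_top[of 2]
  proof eventually_elim
    case (elim n)
    have "C * err n \<le> C * (8 / ln 2 * ln (real n))"
      using err_le(1)[OF elim(2)] assms(3) by (intro mult_left_mono)
    moreover have "K \<le> K / ln 2 * ln (real n)"
      using ln_ge[OF elim(2)] assms(4) mult_left_mono[of "ln 2" "ln (real n)" "K / ln 2"] by simp
    moreover have "0 \<le> ln (real n)" using elim(2) by simp
    ultimately have "C * err n + K \<le> D * ln (real n)" by (simp add: D_def algebra_simps)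
    also have "D * ln (real n) \<le> c / 2 * real n"
      using elim D by (simp add: field_simps)
    finally show ?case using f[of n] elim(2) by (simp add: field_simps)
  qed
qed

lemma grows_linearly_of_err:
  assumes "\<And>n. 0 < n \<Longrightarrow> c * real n \<le> f n + C * err n + K" "0 < c" "0 \<le> C" "0 \<le> K"
  shows "grows_linearly f"
  unfolding grows_linearly_def using linear_of_err[OF assms] assms(2) by (intro exI[of _ "c /
      2"]) simp

text \<open>The size of the number bounds the length from above; from below, complexity exceeds
  length by at most a constant.\<close>

lemma length_bigtheta:
  assumes "\<And>n. 0 < n \<Longrightarrow> s n < Q ^ l n" "\<And>n. 0 < n \<Longrightarrow> l n \<le> 9 * n"
    and "\<And>n. 0 < n \<Longrightarrow> c * real n \<le> CN (s n) + err n + K" "0 < c"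
  shows "(\<lambda>n. real (length (str_of (s n)))) \<in> \<Theta>(\<lambda>n. real n)"
proof (rule bigthetaI)
  have lQ: "0 \<le> log 2 (real Q)" by (simp add: Q_def)
  show "(\<lambda>n. real (length (str_of (s n)))) \<in> O(\<lambda>n. real n)"
  proof (rule bigoI)
    show "\<forall>\<^sub>F n in sequentially. norm (real (length (str_of (s n)))) \<le> (9 * log 2 Q) * norm (real
        n)"
      using eventually_gt_at_top[of 0]
    proof eventually_elim
      case (elim n)
      have "real (length (str_of (s n))) \<le> real (l n) * log 2 Q"
        using assms(1)[OF elim] by (rule length_le)
      also have "\<dots> \<le> real (9 * n) * log 2 Q"
        using assms(2)[OF elim] lQ by (intro mult_right_mono) (simp_all only: of_nat_le_iff)
      finally show ?case by (simp add: algebra_simps)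
    qed
  qed
  obtain K' :: nat where K': "\<And>x y. condC U x y \<le> real (length x) + K'"
    using condC_length_bound[OF univ] by metis
  have "\<forall>\<^sub>F n in sequentially. c / 2 * real n \<le> real (length (str_of (s n)))"
  proof (rule linear_of_err[where C = 1 and K = "\<bar>K\<bar> + K'"])
    fix n :: nat assume "0 < n"
    then show "c * real n \<le> real (length (str_of (s n))) + 1 * err n + (\<bar>K\<bar> + K')"
      using assms(3)[of n] K'[of "str_of (s n)" "[]"] unfolding CN_def plainC_def by linarith
  qed (use assms in auto)
  then show "(\<lambda>n. real (length (str_of (s n)))) \<in> \<Omega>(\<lambda>n. real n)"
    using assms(4) by (intro landau_omega.bigI[of "c / 2"]) (auto elim!: eventually_mono)
qed

text \<open>The lower bound keeps the gain log Q - 6 at 0.9 or more; the upper one turns left-over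
  multiples of log Q into constants.\<close>

lemma log_Q_bounds: "69 / 10 \<le> log 2 (real Q)" "log 2 (real Q) \<le> 7"
proof -
  have "(2::real) ^ 69 \<le> real Q ^ 10" by (simp add: Q_def)
  then have "log 2 (2 ^ 69) \<le> log 2 (real Q ^ 10)" by (intro log_mono) simp_all
  also have "\<dots> = 10 * log 2 (real Q)" by (simp add: log_nat_power)
  also have "log 2 ((2::real) ^ 69) = 69" using log_pow_cancel[of "2::real" 69] by simp
  finally show "69 / 10 \<le> log 2 (real Q)" by simp
  have "log 2 (real Q) \<le> log 2 (2 ^ 7)" by (intro log_mono) (simp_all add: Q_def)
  also have "log 2 ((2::real) ^ 7) = 7" using log_pow_cancel[of "2::real" 7] by simp
  finally show "log 2 (real Q) \<le> 7" .
qed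

lemma mutual_info_str_of:
  "mutual_info U code (str_of x) (str_of y) = CN x + CN y - CN (tuple [x, y])"
  by (simp add: mutual_info_def plainC_code2 flip: CN_def)

lemma cond_mutual_info_str_of:
  "cond_mutual_info U code (str_of x) (str_of y) (str_of z) =
    CN (tuple [x, z]) + CN (tuple [y, z]) - CN (tuple [x, y, z]) - CN z"
  by (simp add: cond_mutual_info_def plainC_code2 plainC_code3 flip: CN_def)

text \<open>The final estimates are linear in the products \<open>real n * log 2 Q\<close> and
  \<open>real k * log 2 Q\<close>, hence this form.\<close>

lemma config_log_le:
  assumes "config n k w"
  shows "127 * (real k * log 2 Q) \<le> 4 * (real n * log 2 Q)"
proof -
  have "127 * real k \<le> 4 * real n" using config_le(2)[OF assms] by (simp add: Q_def)
  then have "127 * real k * log 2 Q \<le> 4 * real n * log 2 Q"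
    using log_Q_bounds by (intro mult_right_mono) simp_all
  then show ?thesis by (simp only: mult.assoc)
qed

lemma mult_log_Q_ge: "69 / 10 * real n \<le> real n * log 2 Q"
  using mult_left_mono[OF log_Q_bounds(1), of "real n"] by (simp add: mult.commute)

section \<open>The two families of quadruples\<close>

lemma quadruples_a:
  "\<exists>a b c d :: nat \<Rightarrow> str.
     (\<lambda>n. real (length (a n))) \<in> \<Theta>(\<lambda>n. real n) \<and>
     (\<lambda>n. real (length (b n))) \<in> \<Theta>(\<lambda>n. real n) \<and>
     (\<lambda>n. real (length (c n))) \<in> \<Theta>(\<lambda>n. real n) \<and>
     (\<lambda>n. real (length (d n))) \<in> \<Theta>(\<lambda>n. real n) \<and>
     (\<lambda>n. mutual_info U code (a n) (b n)) \<in> O(\<lambda>n. ln (real n)) \<and>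
     (\<lambda>n. cond_mutual_info U code (a n) (b n) (c n)) \<in> O(\<lambda>n. ln (real n)) \<and>
     grows_linearly (\<lambda>n. mutual_info U code (c n) (d n)
       - cond_mutual_info U code (c n) (d n) (a n)
       - cond_mutual_info U code (c n) (d n) (b n))"
proof -
  \<comment> \<open>Configurations are chosen for positive n only; the values at 0 are arbitrary,
    and the asymptotic claims do not see them.\<close>
  obtain k w where rc: "\<And>n. 0 < n \<Longrightarrow> random_config n (k n) (w n)"
    using exists_random_config by metis
  then have cf: "config n (k n) (w n)" if "0 < n" for n
    using that by (simp add: random_config_def)
  note kn = config_le(1)[OF cf] and kl = config_log_le[OF cf]
  define A B C D where defs: "A n = string_a n (k n) (w n)" "B n = string_b n (w n)" "C n =
      string_c n (w n)"
    "D n = string_d n (w n)" for n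
  obtain Kla where la0: "0 \<le> Kla" and la: "\<And>n. 0 < n \<Longrightarrow>
      (4 * real n - real (k n)) * log 2 Q \<le> CN (A n) + err n + Kla"
    using lower_a rc unfolding defs by blast
  obtain Klb where lb0: "0 \<le> Klb" and lb: "\<And>n. 0 < n \<Longrightarrow>
      (2 * real n) * log 2 Q \<le> CN (B n) + err n + Klb"
    using lower_b rc unfolding defs by blast
  obtain Klc where lc0: "0 \<le> Klc" and lc: "\<And>n. 0 < n \<Longrightarrow>
      (2 * real n) * log 2 Q \<le> CN (C n) + err n + Klc"
    using lower_c rc unfolding defs by blast
  obtain Kld where ld0: "0 \<le> Kld" and ld: "\<And>n. 0 < n \<Longrightarrow>
      (2 * real n) * log 2 Q \<le> CN (D n) + err n + Kld"
    using lower_d rc unfolding defs by blast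
  obtain Klab where lab0: "0 \<le> Klab" and lab: "\<And>n. 0 < n \<Longrightarrow>
      (6 * real n - real (k n)) * log 2 Q \<le> CN (tuple [A n, B n]) + err n + Klab"
    using lower_ab rc unfolding defs by blast
  obtain Klac where lac0: "0 \<le> Klac" and lac: "\<And>n. 0 < n \<Longrightarrow>
      (5 * real n + 1) * log 2 Q \<le> CN (tuple [A n, C n]) + err n + Klac"
    using lower_ac rc unfolding defs by blast
  obtain Klbc where lbc0: "0 \<le> Klbc" and lbc: "\<And>n. 0 < n \<Longrightarrow>
      (3 * real n) * log 2 Q \<le> CN (tuple [B n, C n]) + err n + Klbc"
    using lower_bc rc unfolding defs by blast
  obtain Klabc where labc0: "0 \<le> Klabc" and labc: "\<And>n. 0 < n \<Longrightarrow>
      (6 * real n + 1) * log 2 Q \<le> CN (tuple [A n, B n, C n]) + err n + Klabc"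
    using lower_abc rc unfolding defs by blast
  obtain Klcda where lcda0: "0 \<le> Klcda" and lcda: "\<And>n. 0 < n \<Longrightarrow>
      (6 * real n + 1) * log 2 Q \<le> CN (tuple [C n, D n, A n]) + err n + Klcda"
    using lower_cda rc unfolding defs by blast
  obtain Klcdb where lcdb0: "0 \<le> Klcdb" and lcdb: "\<And>n. 0 < n \<Longrightarrow>
      (4 * real n) * log 2 Q \<le> CN (tuple [C n, D n, B n]) + err n + Klcdb"
    using lower_cdb rc unfolding defs by blast
  obtain Kua where ua0: "0 \<le> Kua" and ua: "\<And>n. 0 < n \<Longrightarrow>
      CN (A n) \<le> (4 * real n - real (k n) + 2) * log 2 Q + err n + Kua"
    using upper_a cf unfolding defs by blast
  obtain Kub where ub0: "0 \<le> Kub" and ub: "\<And>n. 0 < n \<Longrightarrow>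
      CN (B n) \<le> (2 * real n) * log 2 Q + err n + Kub"
    using upper_b cf unfolding defs by blast
  obtain Kuc where uc0: "0 \<le> Kuc" and uc: "\<And>n. 0 < n \<Longrightarrow>
      CN (C n) \<le> (2 * real n) * log 2 Q + err n + Kuc"
    using upper_c cf unfolding defs by blast
  obtain Kuab where uab0: "0 \<le> Kuab" and uab: "\<And>n. 0 < n \<Longrightarrow>
      CN (tuple [A n, B n]) \<le> (6 * real n - real (k n) + 2) * log 2 Q + err n + Kuab"
    using upper_ab cf unfolding defs by blast
  obtain Kuac where uac0: "0 \<le> Kuac" and uac: "\<And>n. 0 < n \<Longrightarrow>
      CN (tuple [A n, C n]) \<le> (5 * real n + 1) * log 2 Q + err n + Kuac"
    using upper_ac cf unfolding defs by blast
  obtain Kuca where uca0: "0 \<le> Kuca" and uca: "\<And>n. 0 < n \<Longrightarrow>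
      CN (tuple [C n, A n]) \<le> (5 * real n + 1) * log 2 Q + err n + Kuca"
    using upper_ca cf unfolding defs by blast
  obtain Kubc where ubc0: "0 \<le> Kubc" and ubc: "\<And>n. 0 < n \<Longrightarrow>
      CN (tuple [B n, C n]) \<le> (3 * real n) * log 2 Q + err n + Kubc"
    using upper_bc cf unfolding defs by blast
  obtain Kucb where ucb0: "0 \<le> Kucb" and ucb: "\<And>n. 0 < n \<Longrightarrow>
      CN (tuple [C n, B n]) \<le> (3 * real n) * log 2 Q + err n + Kucb"
    using upper_cb cf unfolding defs by blast
  obtain Kuabc where uabc0: "0 \<le> Kuabc" and uabc: "\<And>n. 0 < n \<Longrightarrow>
      CN (tuple [A n, B n, C n]) \<le> (6 * real n + 1) * log 2 Q + err n + Kuabc"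
    using upper_abc cf unfolding defs by blast
  obtain Kuda where uda0: "0 \<le> Kuda" and uda: "\<And>n. 0 < n \<Longrightarrow>
      CN (tuple [D n, A n]) \<le> (5 * real n + 1) * log 2 Q + err n + Kuda"
    using upper_da cf unfolding defs by blast
  obtain Kudb where udb0: "0 \<le> Kudb" and udb: "\<And>n. 0 < n \<Longrightarrow>
      CN (tuple [D n, B n]) \<le> (3 * real n) * log 2 Q + err n + Kudb"
    using upper_db cf unfolding defs by blast
  obtain Kucd where ucd0: "0 \<le> Kucd" and ucd: "\<And>n. 0 < n \<Longrightarrow>
      CN (tuple [C n, D n]) \<le> 3 * real n * log 2 Q + 6 * real n + err n + Kucd"
    using upper_cd cf unfolding defs by blast
  note K0 = la0 lb0 lc0 ld0 lab0 lac0 lbc0 labc0 lcda0 lcdb0 ua0 ub0 uc0 uab0 uac0 uca0 ubc0 ucb0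
      uabc0 uda0 udb0 ucd0
  note lin = ring_distribs mult.assoc
  show ?thesis
  proof (rule exI[of _ "\<lambda>n. str_of (A n)"], rule exI[of _ "\<lambda>n. str_of (B n)"],
      rule exI[of _ "\<lambda>n. str_of (C n)"], rule exI[of _ "\<lambda>n. str_of (D n)"], intro conjI)
    show "(\<lambda>n. real (length (str_of (A n)))) \<in> \<Theta>(\<lambda>n. real n)"
    proof (rule length_bigtheta[where c = 1 and l = "\<lambda>n. n + ((2 * n + 1) + (n + 1 - k n))"])
      show "A n < Q ^ (n + ((2 * n + 1) + (n + 1 - k n)))" if "0 < n" for n
        unfolding defs using cf[OF that] by (rule strings_less)
      show "1 * real n \<le> CN (A n) + err n + Kla" if "0 < n" for n
        using la[OF that, unfolded lin] kl[OF that] mult_log_Q_ge[of n] by linarith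
    qed simp_all
    show "(\<lambda>n. real (length (str_of (B n)))) \<in> \<Theta>(\<lambda>n. real n)"
    proof (rule length_bigtheta[where c = 1 and l = "\<lambda>n. n + n"])
      show "B n < Q ^ (n + n)" for n unfolding defs by (rule strings_less)
      show "1 * real n \<le> CN (B n) + err n + Klb" if "0 < n" for n
        using lb[OF that, unfolded lin] mult_log_Q_ge[of n] by linarith
    qed simp_all
    show "(\<lambda>n. real (length (str_of (C n)))) \<in> \<Theta>(\<lambda>n. real n)"
    proof (rule length_bigtheta[where c = 1 and l = "\<lambda>n. n + n"])
      show "C n < Q ^ (n + n)" for n unfolding defs by (rule strings_less)
      show "1 * real n \<le> CN (C n) + err n + Klc" if "0 < n" for n
        using lc[OF that, unfolded lin] mult_log_Q_ge[of n] by linarith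
    qed simp_all
    show "(\<lambda>n. real (length (str_of (D n)))) \<in> \<Theta>(\<lambda>n. real n)"
    proof (rule length_bigtheta[where c = 1 and l = "\<lambda>n. n + n"])
      show "D n < Q ^ (n + n)" for n unfolding defs by (rule strings_less)
      show "1 * real n \<le> CN (D n) + err n + Kld" if "0 < n" for n
        using ld[OF that, unfolded lin] mult_log_Q_ge[of n] by linarith
    qed simp_all
    \<comment> \<open>All terms with n and k cancel in C(a) + C(b) - C(a,b); at most 2 log Q \<le>
      14 is left in absolute value.\<close>
    let ?K = "14 + Kla + Klb + Klab + Kua + Kub + Kuab"
    show "(\<lambda>n. mutual_info U code (str_of (A n)) (str_of (B n))) \<in> O(\<lambda>n. ln (real n))"
    proof (rule bigo_ln_of_err[where C = 3 and K = ?K])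
      fix n :: nat assume n: "0 < n"
      note est = la lb lab ua ub uab
      show "\<bar>mutual_info U code (str_of (A n)) (str_of (B n))\<bar> \<le> 3 * err n + ?K"
        using est[OF n, unfolded lin] log_Q_bounds K0
        unfolding mutual_info_str_of by linarith
    qed (use K0 in simp_all)
    \<comment> \<open>The main terms cancel exactly: (5 n + 1) + 3 n - (6 n + 1) - 2 n = 0.\<close>
    let ?K = "0 + Klc + Klac + Klbc + Klabc + Kuc + Kuac + Kubc + Kuabc"
    show "(\<lambda>n. cond_mutual_info U code (str_of (A n)) (str_of (B n)) (str_of (C n))) \<in> O(\<lambda>n. ln
        (real n))"
    proof (rule bigo_ln_of_err[where C = 4 and K = ?K])
      fix n :: nat assume n: "0 < n"
      note est = lc lac lbc labc uc uac ubc uabc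
      show "\<bar>cond_mutual_info U code (str_of (A n)) (str_of (B n)) (str_of (C n))\<bar> \<le> 4 * err n + ?K"
        using est[OF n, unfolded lin] log_Q_bounds K0
        unfolding cond_mutual_info_str_of by linarith
    qed (use K0 in simp_all)
    \<comment> \<open>Only I(c:d|a) loses, namely (k + 1) log Q. With k \<le> 4 n / 127, the main
      part n (log Q - 6) - k log Q is at least (6.9 * 123 / 127 - 6) n, more than 2/5 n. The 7
      bounds the single log Q, and 11 complexities are estimated.\<close>
    let ?K = "7 + Kla + Klb + Klc + Kld + Klcda + Klcdb + Kuca + Kucb + Kuda + Kudb +
      Kucd"
    show "grows_linearly (\<lambda>n. mutual_info U code (str_of (C n)) (str_of (D n))
       - cond_mutual_info U code (str_of (C n)) (str_of (D n)) (str_of (A n))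
       - cond_mutual_info U code (str_of (C n)) (str_of (D n)) (str_of (B n)))"
    proof (rule grows_linearly_of_err[where c = "2 / 5" and C = 11 and K = ?K])
      fix n :: nat assume n: "0 < n"
      note est = la lb lc ld lcda lcdb uca ucb uda udb ucd
      show "2 / 5 * real n \<le> mutual_info U code (str_of (C n)) (str_of (D n))
       - cond_mutual_info U code (str_of (C n)) (str_of (D n)) (str_of (A n))
       - cond_mutual_info U code (str_of (C n)) (str_of (D n)) (str_of (B n)) + 11 * err n + ?K"
        using est[OF n, unfolded lin] kl[OF n] mult_log_Q_ge[of n] log_Q_bounds K0
        unfolding cond_mutual_info_str_of mutual_info_str_of by linarith
    qed (use K0 in simp_all)
  qed
qed

lemma quadruples_b:
  "\<exists>a b c d :: nat \<Rightarrow> str.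
     (\<lambda>n. real (length (a n))) \<in> \<Theta>(\<lambda>n. real n) \<and>
     (\<lambda>n. real (length (b n))) \<in> \<Theta>(\<lambda>n. real n) \<and>
     (\<lambda>n. real (length (c n))) \<in> \<Theta>(\<lambda>n. real n) \<and>
     (\<lambda>n. real (length (d n))) \<in> \<Theta>(\<lambda>n. real n) \<and>
     (\<lambda>n. condC U (c n) (code [a n, b n])) \<in> O(\<lambda>n. ln (real n)) \<and>
     (\<lambda>n. cond_mutual_info U code (a n) (b n) (c n)) \<in> O(\<lambda>n. ln (real n)) \<and>
     grows_linearly (\<lambda>n. mutual_info U code (c n) (d n)
       - cond_mutual_info U code (c n) (d n) (a n)
       - cond_mutual_info U code (c n) (d n) (b n)
       - mutual_info U code (a n) (b n))"
proof -
  obtain k w where rc: "\<And>n. 0 < n \<Longrightarrow> random_config n (k n) (w n)"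
    using exists_random_config by metis
  then have cf: "config n (k n) (w n)" if "0 < n" for n
    using that by (simp add: random_config_def)
  note kn = config_le(1)[OF cf] and kl = config_log_le[OF cf]
  define A B C D where defs: "A n = string_a2 n (k n) (w n)" "B n = string_b n (w n)" "C n =
      string_c n (w n)"
    "D n = string_d n (w n)" for n
  obtain Kla where la0: "0 \<le> Kla" and la: "\<And>n. 0 < n \<Longrightarrow>
      (4 * real n + 1) * log 2 Q \<le> CN (A n) + err n + Kla"
    using lower_a2 rc unfolding defs by blast
  obtain Klb where lb0: "0 \<le> Klb" and lb: "\<And>n. 0 < n \<Longrightarrow>
      (2 * real n) * log 2 Q \<le> CN (B n) + err n + Klb"
    using lower_b rc unfolding defs by blast
  obtain Klc where lc0: "0 \<le> Klc" and lc: "\<And>n. 0 < n \<Longrightarrow>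
      (2 * real n) * log 2 Q \<le> CN (C n) + err n + Klc"
    using lower_c rc unfolding defs by blast
  obtain Kld where ld0: "0 \<le> Kld" and ld: "\<And>n. 0 < n \<Longrightarrow>
      (2 * real n) * log 2 Q \<le> CN (D n) + err n + Kld"
    using lower_d rc unfolding defs by blast
  obtain Klab where lab0: "0 \<le> Klab" and lab: "\<And>n. 0 < n \<Longrightarrow>
      (6 * real n + 1) * log 2 Q \<le> CN (tuple [A n, B n]) + err n + Klab"
    using lower_a2b rc unfolding defs by blast
  obtain Klac where lac0: "0 \<le> Klac" and lac: "\<And>n. 0 < n \<Longrightarrow>
      (5 * real n + 1) * log 2 Q \<le> CN (tuple [A n, C n]) + err n + Klac"
    using lower_a2c rc unfolding defs by blast
  obtain Klbc where lbc0: "0 \<le> Klbc" and lbc: "\<And>n. 0 < n \<Longrightarrow>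
      (3 * real n) * log 2 Q \<le> CN (tuple [B n, C n]) + err n + Klbc"
    using lower_bc rc unfolding defs by blast
  obtain Klabc where labc0: "0 \<le> Klabc" and labc: "\<And>n. 0 < n \<Longrightarrow>
      (6 * real n + 1) * log 2 Q \<le> CN (tuple [A n, B n, C n]) + err n + Klabc"
    using lower_a2bc rc unfolding defs by blast
  obtain Klcda where lcda0: "0 \<le> Klcda" and lcda: "\<And>n. 0 < n \<Longrightarrow>
      (6 * real n + 1) * log 2 Q \<le> CN (tuple [C n, D n, A n]) + err n + Klcda"
    using lower_cda2 rc unfolding defs by blast
  obtain Klcdb where lcdb0: "0 \<le> Klcdb" and lcdb: "\<And>n. 0 < n \<Longrightarrow>
      (4 * real n) * log 2 Q \<le> CN (tuple [C n, D n, B n]) + err n + Klcdb"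
    using lower_cdb rc unfolding defs by blast
  obtain Kua where ua0: "0 \<le> Kua" and ua: "\<And>n. 0 < n \<Longrightarrow>
      CN (A n) \<le> (4 * real n + real (k n) + 2) * log 2 Q + err n + Kua"
    using upper_a2 cf unfolding defs by blast
  obtain Kub where ub0: "0 \<le> Kub" and ub: "\<And>n. 0 < n \<Longrightarrow>
      CN (B n) \<le> (2 * real n) * log 2 Q + err n + Kub"
    using upper_b cf unfolding defs by blast
  obtain Kuc where uc0: "0 \<le> Kuc" and uc: "\<And>n. 0 < n \<Longrightarrow>
      CN (C n) \<le> (2 * real n) * log 2 Q + err n + Kuc"
    using upper_c cf unfolding defs by blast
  obtain Kuac where uac0: "0 \<le> Kuac" and uac: "\<And>n. 0 < n \<Longrightarrow>
      CN (tuple [A n, C n]) \<le> (5 * real n + 1) * log 2 Q + err n + Kuac"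
    using upper_a2c cf unfolding defs by blast
  obtain Kuca where uca0: "0 \<le> Kuca" and uca: "\<And>n. 0 < n \<Longrightarrow>
      CN (tuple [C n, A n]) \<le> (5 * real n + 1) * log 2 Q + err n + Kuca"
    using upper_ca2 cf unfolding defs by blast
  obtain Kubc where ubc0: "0 \<le> Kubc" and ubc: "\<And>n. 0 < n \<Longrightarrow>
      CN (tuple [B n, C n]) \<le> (3 * real n) * log 2 Q + err n + Kubc"
    using upper_bc cf unfolding defs by blast
  obtain Kucb where ucb0: "0 \<le> Kucb" and ucb: "\<And>n. 0 < n \<Longrightarrow>
      CN (tuple [C n, B n]) \<le> (3 * real n) * log 2 Q + err n + Kucb"
    using upper_cb cf unfolding defs by blast
  obtain Kuabc where uabc0: "0 \<le> Kuabc" and uabc: "\<And>n. 0 < n \<Longrightarrow>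
      CN (tuple [A n, B n, C n]) \<le> (6 * real n + 1) * log 2 Q + err n + Kuabc"
    using upper_a2bc cf unfolding defs by blast
  obtain Kuda where uda0: "0 \<le> Kuda" and uda: "\<And>n. 0 < n \<Longrightarrow>
      CN (tuple [D n, A n]) \<le> (5 * real n + real (k n) + 2) * log 2 Q + err n + Kuda"
    using upper_da2 cf unfolding defs by blast
  obtain Kudb where udb0: "0 \<le> Kudb" and udb: "\<And>n. 0 < n \<Longrightarrow>
      CN (tuple [D n, B n]) \<le> (3 * real n) * log 2 Q + err n + Kudb"
    using upper_db cf unfolding defs by blast
  obtain Kucd where ucd0: "0 \<le> Kucd" and ucd: "\<And>n. 0 < n \<Longrightarrow>
      CN (tuple [C n, D n]) \<le> 3 * real n * log 2 Q + 6 * real n + err n + Kucd"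
    using upper_cd cf unfolding defs by blast
  note K0 = la0 lb0 lc0 ld0 lab0 lac0 lbc0 labc0 lcda0 lcdb0 ua0 ub0 uc0 uac0 uca0 ubc0 ucb0
      uabc0 uda0 udb0 ucd0
  obtain Kl where line: "0 \<le> Kl" "\<And>n. 0 < n \<Longrightarrow> condC U (str_of (C n)) (str_of (tuple [A n, B n]))
      \<le> err n + Kl"
    using condC_line cf unfolding defs by blast
  note lin = ring_distribs mult.assoc
  show ?thesis
  proof (rule exI[of _ "\<lambda>n. str_of (A n)"], rule exI[of _ "\<lambda>n. str_of (B n)"],
      rule exI[of _ "\<lambda>n. str_of (C n)"], rule exI[of _ "\<lambda>n. str_of (D n)"], intro conjI)
    show "(\<lambda>n. real (length (str_of (A n)))) \<in> \<Theta>(\<lambda>n. real n)"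
    proof (rule length_bigtheta[where c = 1 and l = "\<lambda>n. n + (n + ((2 * n + 1) + (k n + 1)))"])
      show "A n < Q ^ (n + (n + ((2 * n + 1) + (k n + 1))))" if "0 < n" for n
        unfolding defs using cf[OF that] by (rule strings_less)
      show "1 * real n \<le> CN (A n) + err n + Kla" if "0 < n" for n
        using la[OF that, unfolded lin] mult_log_Q_ge[of n] log_Q_bounds by linarith
      show "n + (n + ((2 * n + 1) + (k n + 1))) \<le> 9 * n" if "0 < n" for n
        using kn[OF that] that by linarith
    qed simp_all
    show "(\<lambda>n. real (length (str_of (B n)))) \<in> \<Theta>(\<lambda>n. real n)"
    proof (rule length_bigtheta[where c = 1 and l = "\<lambda>n. n + n"])
      show "B n < Q ^ (n + n)" for n unfolding defs by (rule strings_less)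
      show "1 * real n \<le> CN (B n) + err n + Klb" if "0 < n" for n
        using lb[OF that, unfolded lin] mult_log_Q_ge[of n] by linarith
    qed simp_all
    show "(\<lambda>n. real (length (str_of (C n)))) \<in> \<Theta>(\<lambda>n. real n)"
    proof (rule length_bigtheta[where c = 1 and l = "\<lambda>n. n + n"])
      show "C n < Q ^ (n + n)" for n unfolding defs by (rule strings_less)
      show "1 * real n \<le> CN (C n) + err n + Klc" if "0 < n" for n
        using lc[OF that, unfolded lin] mult_log_Q_ge[of n] by linarith
    qed simp_all
    show "(\<lambda>n. real (length (str_of (D n)))) \<in> \<Theta>(\<lambda>n. real n)"
    proof (rule length_bigtheta[where c = 1 and l = "\<lambda>n. n + n"])
      show "D n < Q ^ (n + n)" for n unfolding defs by (rule strings_less)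
      show "1 * real n \<le> CN (D n) + err n + Kld" if "0 < n" for n
        using ld[OF that, unfolded lin] mult_log_Q_ge[of n] by linarith
    qed simp_all
    show "(\<lambda>n. condC U (str_of (C n)) (code [str_of (A n), str_of (B n)])) \<in> O(\<lambda>n. ln (real n))"
    proof (rule bigo_ln_of_err[where C = 1 and K = Kl])
      fix n :: nat assume n: "0 < n"
      have "0 \<le> condC U (str_of (C n)) (str_of (tuple [A n, B n]))" by (simp add: condC_def)
      then have "\<bar>condC U (str_of (C n)) (str_of (tuple [A n, B n]))\<bar> \<le> 1 * err n + Kl"
        using line(2)[OF n] by linarith
      then show "\<bar>condC U (str_of (C n)) (code [str_of (A n), str_of (B n)])\<bar> \<le> 1 * err n + Kl"
        by (simp add: str_of_tuple)
    qed (use line(1) in simp_all)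
    let ?K = "0 + Klc + Klac + Klbc + Klabc + Kuc + Kuac + Kubc + Kuabc"
    show "(\<lambda>n. cond_mutual_info U code (str_of (A n)) (str_of (B n)) (str_of (C n))) \<in> O(\<lambda>n. ln
        (real n))"
    proof (rule bigo_ln_of_err[where C = 4 and K = ?K])
      fix n :: nat assume n: "0 < n"
      note est = lc lac lbc labc uc uac ubc uabc
      show "\<bar>cond_mutual_info U code (str_of (A n)) (str_of (B n)) (str_of (C n))\<bar> \<le> 4 * err n + ?K"
        using est[OF n, unfolded lin] log_Q_bounds K0
        unfolding cond_mutual_info_str_of by linarith
    qed (use K0 in simp_all)
    \<comment> \<open>Both I(c:d|a) and I(a:b) lose (k + 1) log Q. The main part is still at least
      (6.9 * 119 / 127 - 6) n, more than 2/5 n. The 14 in the constant bounds 2 log Q; the factor 14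
      of \<open>err\<close> counts the complexities estimated.\<close>
    let ?K = "14 + Kla + Klb + Klc + Kld + Klab + Klcda + Klcdb + Kua + Kub + Kuca +
      Kucb + Kuda + Kudb + Kucd"
    show "grows_linearly (\<lambda>n. mutual_info U code (str_of (C n)) (str_of (D n))
       - cond_mutual_info U code (str_of (C n)) (str_of (D n)) (str_of (A n))
       - cond_mutual_info U code (str_of (C n)) (str_of (D n)) (str_of (B n))
       - mutual_info U code (str_of (A n)) (str_of (B n)))"
    proof (rule grows_linearly_of_err[where c = "2 / 5" and C = 14 and K = ?K])
      fix n :: nat assume n: "0 < n"
      note est = la lb lc ld lab lcda lcdb ua ub uca ucb uda udb ucd
      show "2 / 5 * real n \<le> mutual_info U code (str_of (C n)) (str_of (D n))
       - cond_mutual_info U code (str_of (C n)) (str_of (D n)) (str_of (A n))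
       - cond_mutual_info U code (str_of (C n)) (str_of (D n)) (str_of (B n))
       - mutual_info U code (str_of (A n)) (str_of (B n)) + 14 * err n + ?K"
        using est[OF n, unfolded lin] kl[OF n] mult_log_Q_ge[of n] log_Q_bounds K0
        unfolding cond_mutual_info_str_of mutual_info_str_of by linarith
    qed (use K0 in simp_all)
  qed
qed

end

theorem theorem10:
  fixes U :: lang and code :: "str list \<Rightarrow> str"
  assumes "universal_language U"
    and "computable_tuple_bijection code"
  shows "(\<exists>a b c d :: nat \<Rightarrow> str.
       (\<lambda>n. real (length (a n))) \<in> \<Theta>(\<lambda>n. real n) \<and>
       (\<lambda>n. real (length (b n))) \<in> \<Theta>(\<lambda>n. real n) \<and>
       (\<lambda>n. real (length (c n))) \<in> \<Theta>(\<lambda>n. real n) \<and>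
       (\<lambda>n. real (length (d n))) \<in> \<Theta>(\<lambda>n. real n) \<and>
       (\<lambda>n. mutual_info U code (a n) (b n)) \<in> O(\<lambda>n. ln (real n)) \<and>
       (\<lambda>n. cond_mutual_info U code (a n) (b n) (c n)) \<in> O(\<lambda>n. ln (real n)) \<and>
       grows_linearly (\<lambda>n. mutual_info U code (c n) (d n)
         - cond_mutual_info U code (c n) (d n) (a n)
         - cond_mutual_info U code (c n) (d n) (b n)))
    \<and> (\<exists>a b c d :: nat \<Rightarrow> str.
       (\<lambda>n. real (length (a n))) \<in> \<Theta>(\<lambda>n. real n) \<and>
       (\<lambda>n. real (length (b n))) \<in> \<Theta>(\<lambda>n. real n) \<and>
       (\<lambda>n. real (length (c n))) \<in> \<Theta>(\<lambda>n. real n) \<and>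
       (\<lambda>n. real (length (d n))) \<in> \<Theta>(\<lambda>n. real n) \<and>
       (\<lambda>n. condC U (c n) (code [a n, b n])) \<in> O(\<lambda>n. ln (real n)) \<and>
       (\<lambda>n. cond_mutual_info U code (a n) (b n) (c n)) \<in> O(\<lambda>n. ln (real n)) \<and>
       grows_linearly (\<lambda>n. mutual_info U code (c n) (d n)
         - cond_mutual_info U code (c n) (d n) (a n)
         - cond_mutual_info U code (c n) (d n) (b n)
         - mutual_info U code (a n) (b n)))"
  using quadruples_a[OF assms] quadruples_b[OF assms] by (rule conjI)

end
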